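(* Suppose $(F,g,I,J,\mathfrak t)$ is an $A$-deformation of a locally toric Kähler structure $(F,g_K,J_K,\mathfrak t)$ defined on $\mathring M$. Suppose $(F,\mathfrak t)$ extends smoothly to a manifold $M$ such that $\mathring M$ is a dense open subset of $M$. Then $(g_K,J_K)$ extends smoothly to $M$ if and only if $(g,I,J)$ does. In this case, one has $g_K\ge g$. In particular, if $(g,I,J)$ is defined on $M$ and $g$ is a complete Riemannian metric on $M$, then $g_K$ is also a complete Riemannian metric on $M$.
   Context: A locally toric Kähler structure $(F,g_K,J_K,\mathfrak t)$ on a $2n$-manifold $\mathring M$ is a Kähler structure with $F=g_K(J_K\cdot,\cdot)$ and commuting vector fields $X_1,\dots,X_n$ preserving it, pointwise linearly independent on $\mathring M$, with $F(X_i,X_j)=0$; $\mathfrak t=\mathrm{span}_{\mathbb R}\{X_i\}$. Locally there are coordinates $(t_i,\mu_i)$ with $X_i=\partial_{t_i}$, $\iota_{X_i}F=-d\mu_i$, $F=\sum_id\mu_i\wedge dt_i$, $J_K\partial_{\mu_i}=\sum_jG_{ij}\partial_{t_j}$, $J_K\partial_{t_i}=-\sum_j(G^{-1})_{ij}\partial_{\mu_j}$, $G=\mathrm{Hess}(u)(\mu)>0$, $g_K=\sum_{i,j}(G_{ij}d\mu_id\mu_j+(G^{-1})_{ij}dt_idt_j)$. For $A=\sum A_{ij}X_i\wedge X_j\in\Lambda^2\mathfrak t$ (constant skew matrix $(A_{ij})$) put $\Psi=G+A$. The $A$-deformation is $(F,g,I,J)$ with $J\partial_{\mu_i}=\sum_j\Psi_{ij}\partial_{t_j}$,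 $J\partial_{t_i}=-\sum_j(\Psi^{-1})_{ij}\partial_{\mu_j}$, $I$ given by the same formulas with $\Psi^T$ in place of $\Psi$, and $g=\sum_{i,j}(G_{ij}d\mu_id\mu_j+((\Psi^{-1})^s)_{ij}dt_idt_j)$ ($s$ = symmetric part). It is a generalized Kähler structure (i.e. $I,J$ are integrable and $g$-compatible, $d^c_I\omega_I=H=-d^c_J\omega_J$, $dH=0$) with $F=-2g(I+J)^{-1}$. "$(F,\mathfrak t)$ extends smoothly to $M$" means that $F$ extends to a symplectic form on $M$ and the vector fields $X_i$ extend to smooth vector fields on $M$ (possibly dependent or vanishing off $\mathring M$). "$(g_K,J_K)$ (resp. $(g,I,J)$) extends smoothly" means it extends to a smooth Kähler (resp. generalized Kähler) structure on $M$, in particular with positive definite metric. *)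

theory Defs
  imports "HOL-Analysis.Analysis"
begin

section \<open>Smooth manifolds\<close>

primrec Ck_on :: "nat \<Rightarrow> ('a::real_normed_vector \<Rightarrow> 'b::real_normed_vector) \<Rightarrow> 'a set \<Rightarrow> bool" where
  "Ck_on 0 f S \<longleftrightarrow> continuous_on S f"
| "Ck_on (Suc k) f S \<longleftrightarrow>
     (\<forall>x\<in>S. f differentiable (at x)) \<and> (\<forall>v. Ck_on k (\<lambda>x. frechet_derivative f (at x) v) S)"

text \<open>Only used for open sets.\<close>

definition smooth_on :: "('a::real_normed_vector \<Rightarrow> 'b::real_normed_vector) \<Rightarrow> 'a set \<Rightarrow> bool" where
  "smooth_on f S \<longleftrightarrow> (\<forall>k. Ck_on k f S)"

text \<open>A chart is a pair of a domain and a coordinate map; the values of the coordinate map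
  outside the domain are irrelevant. The manifold is the whole type \<open>'m\<close>.\<close>

type_synonym ('m, 'e) chart = "'m set \<times> ('m \<Rightarrow> 'e)"

definition inv_chart :: "('m, 'e) chart \<Rightarrow> 'e \<Rightarrow> 'm" where
  "inv_chart c = inv_into (fst c) (snd c)"

definition is_chart :: "('m::topological_space, 'e::euclidean_space) chart \<Rightarrow> bool" where
  "is_chart c \<longleftrightarrow> open (fst c) \<and> open (snd c ` fst c) \<and>
     homeomorphism (fst c) (snd c ` fst c) (snd c) (inv_chart c)"

definition transition :: "('m, 'e) chart \<Rightarrow> ('m, 'e) chart \<Rightarrow> 'e \<Rightarrow> 'e" where
  "transition c d = snd d \<circ> inv_chart c"

definition compatible :: "('m, 'e::euclidean_space) chart \<Rightarrow> ('m, 'e) chart \<Rightarrow> bool" where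
  "compatible c d \<longleftrightarrow>
     smooth_on (transition c d) (snd c ` (fst c \<inter> fst d)) \<and>
     smooth_on (transition d c) (snd d ` (fst c \<inter> fst d))"

definition smooth_structure :: "('m::topological_space, 'e::euclidean_space) chart set \<Rightarrow> bool" where
  "smooth_structure \<A> \<longleftrightarrow>
     (\<forall>c\<in>\<A>. is_chart c) \<and> (\<Union>c\<in>\<A>. fst c) = UNIV \<and>
     (\<forall>c\<in>\<A>. \<forall>d\<in>\<A>. compatible c d) \<and>
     (\<forall>c. is_chart c \<and> (\<forall>d\<in>\<A>. compatible c d) \<longrightarrow> c \<in> \<A>)"


section \<open>Tensor fields\<close>

text \<open>A tensor field \<open>T\<close> is given by its components in all charts: \<open>T c p\<close> is the tensor at
  the point \<open>p\<close>, expressed in the coordinates of the chart \<open>c\<close>. The components in different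
  charts are related by the usual transformation laws. Fields defined on an open set \<open>W\<close> are
  only constrained at points of \<open>W\<close>.\<close>

type_synonym ('m, 'e, 'a) field = "('m, 'e) chart \<Rightarrow> 'm \<Rightarrow> 'a"
type_synonym ('m, 'e) vec_field = "('m, 'e, 'e) field"
type_synonym ('m, 'e) bil_field = "('m, 'e, 'e \<Rightarrow> 'e \<Rightarrow> real) field"
type_synonym ('m, 'e) end_field = "('m, 'e, 'e \<Rightarrow> 'e) field"

definition local_rep :: "('m, 'e) chart \<Rightarrow> ('m, 'e, 'a) field \<Rightarrow> 'e \<Rightarrow> 'a" where
  "local_rep c T x = T c (inv_chart c x)"

definition change :: "('m, 'e::euclidean_space) chart \<Rightarrow> ('m, 'e) chart \<Rightarrow> 'm \<Rightarrow> 'e \<Rightarrow> 'e" where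
  "change c d p = frechet_derivative (transition c d) (at (snd c p))"

definition vector_field ::
  "('m, 'e::euclidean_space) chart set \<Rightarrow> 'm set \<Rightarrow> ('m, 'e) vec_field \<Rightarrow> bool" where
  "vector_field \<A> W X \<longleftrightarrow>
     (\<forall>c\<in>\<A>. smooth_on (local_rep c X) (snd c ` (fst c \<inter> W))) \<and>
     (\<forall>c\<in>\<A>. \<forall>d\<in>\<A>. \<forall>p\<in>fst c \<inter> fst d \<inter> W. X d p = change c d p (X c p))"

definition bilinear_field ::
  "('m, 'e::euclidean_space) chart set \<Rightarrow> 'm set \<Rightarrow> ('m, 'e) bil_field \<Rightarrow> bool" where
  "bilinear_field \<A> W B \<longleftrightarrow>
     (\<forall>c\<in>\<A>. \<forall>p\<in>fst c \<inter> W. bilinear (B c p)) \<and>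
     (\<forall>c\<in>\<A>. \<forall>v w. smooth_on (\<lambda>x. local_rep c B x v w) (snd c ` (fst c \<inter> W))) \<and>
     (\<forall>c\<in>\<A>. \<forall>d\<in>\<A>. \<forall>p\<in>fst c \<inter> fst d \<inter> W. \<forall>v w.
        B d p (change c d p v) (change c d p w) = B c p v w)"

definition endo_field ::
  "('m, 'e::euclidean_space) chart set \<Rightarrow> 'm set \<Rightarrow> ('m, 'e) end_field \<Rightarrow> bool" where
  "endo_field \<A> W J \<longleftrightarrow>
     (\<forall>c\<in>\<A>. \<forall>p\<in>fst c \<inter> W. linear (J c p)) \<and>
     (\<forall>c\<in>\<A>. \<forall>v. smooth_on (\<lambda>x. local_rep c J x v) (snd c ` (fst c \<inter> W))) \<and>
     (\<forall>c\<in>\<A>. \<forall>d\<in>\<A>. \<forall>p\<in>fst c \<inter> fst d \<inter> W. \<forall>v.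
        J d p (change c d p v) = change c d p (J c p v))"

definition agree_on ::
  "('m, 'e) chart set \<Rightarrow> 'm set \<Rightarrow> ('m, 'e, 'a) field \<Rightarrow> ('m, 'e, 'a) field \<Rightarrow> bool" where
  "agree_on \<A> W T T' \<longleftrightarrow> (\<forall>c\<in>\<A>. \<forall>p\<in>fst c \<inter> W. T' c p = T c p)"


section \<open>Differential operators in local coordinates\<close>

text \<open>These are applied to local representatives. Where vectors \<open>u v w z\<close> occur as arguments
  they stand for constant (coordinate) vector fields, whose brackets vanish.\<close>

definition lie_bracket :: "('e::euclidean_space \<Rightarrow> 'e) \<Rightarrow> ('e \<Rightarrow> 'e) \<Rightarrow> 'e \<Rightarrow> 'e" where
  "lie_bracket X Y x = frechet_derivative Y (at x) (X x) - frechet_derivative X (at x) (Y x)"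

definition nijenhuis :: "('e::euclidean_space \<Rightarrow> 'e \<Rightarrow> 'e) \<Rightarrow> 'e \<Rightarrow> 'e \<Rightarrow> 'e \<Rightarrow> 'e" where
  "nijenhuis J x u v =
     lie_bracket (\<lambda>y. J y u) (\<lambda>y. J y v) x
     - J x (lie_bracket (\<lambda>y. J y u) (\<lambda>y. v) x)
     - J x (lie_bracket (\<lambda>y. u) (\<lambda>y. J y v) x)
     - lie_bracket (\<lambda>y. u) (\<lambda>y. v) x"

definition lie_bil ::
  "('e::euclidean_space \<Rightarrow> 'e) \<Rightarrow> ('e \<Rightarrow> 'e \<Rightarrow> 'e \<Rightarrow> real) \<Rightarrow> 'e \<Rightarrow> 'e \<Rightarrow> 'e \<Rightarrow> real" where
  "lie_bil X B x v w = frechet_derivative (\<lambda>y. B y v w) (at x) (X x)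
     - B x (lie_bracket X (\<lambda>y. v) x) w - B x v (lie_bracket X (\<lambda>y. w) x)"

definition lie_endo ::
  "('e::euclidean_space \<Rightarrow> 'e) \<Rightarrow> ('e \<Rightarrow> 'e \<Rightarrow> 'e) \<Rightarrow> 'e \<Rightarrow> 'e \<Rightarrow> 'e" where
  "lie_endo X J x v = lie_bracket X (\<lambda>y. J y v) x - J x (lie_bracket X (\<lambda>y. v) x)"

definition ext_d2 ::
  "('e::euclidean_space \<Rightarrow> 'e \<Rightarrow> 'e \<Rightarrow> real) \<Rightarrow> 'e \<Rightarrow> 'e \<Rightarrow> 'e \<Rightarrow> 'e \<Rightarrow> real" where
  "ext_d2 \<omega> x u v w =
     frechet_derivative (\<lambda>y. \<omega> y v w) (at x) u
     - frechet_derivative (\<lambda>y. \<omega> y u w) (at x) v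
     + frechet_derivative (\<lambda>y. \<omega> y u v) (at x) w"

definition ext_d3 ::
  "('e::euclidean_space \<Rightarrow> 'e \<Rightarrow> 'e \<Rightarrow> 'e \<Rightarrow> real) \<Rightarrow> 'e \<Rightarrow> 'e \<Rightarrow> 'e \<Rightarrow> 'e \<Rightarrow> 'e \<Rightarrow> real" where
  "ext_d3 H x u v w z =
     frechet_derivative (\<lambda>y. H y v w z) (at x) u
     - frechet_derivative (\<lambda>y. H y u w z) (at x) v
     + frechet_derivative (\<lambda>y. H y u v z) (at x) w
     - frechet_derivative (\<lambda>y. H y u v w) (at x) z"

text \<open>\<open>d\<^sup>c\<^sub>I = I\<inverse> d I = i (\<partial>bar - \<partial>)\<close> on 2-forms, where \<open>I\<close> acts on forms by
  \<open>(I \<alpha>)(v, \<dots>) = \<alpha>(I v, \<dots>)\<close>; the sign comes from \<open>I\<inverse> = - I\<close>.\<close>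

definition dc2 ::
  "('e::euclidean_space \<Rightarrow> 'e \<Rightarrow> 'e) \<Rightarrow> ('e \<Rightarrow> 'e \<Rightarrow> 'e \<Rightarrow> real) \<Rightarrow> 'e \<Rightarrow> 'e \<Rightarrow> 'e \<Rightarrow> 'e \<Rightarrow> real" where
  "dc2 I \<omega> x u v w = - ext_d2 (\<lambda>y a b. \<omega> y (I y a) (I y b)) x (I x u) (I x v) (I x w)"


section \<open>Riemannian, symplectic, Kaehler and generalized Kaehler structures\<close>

definition riemannian ::
  "('m, 'e::euclidean_space) chart set \<Rightarrow> 'm set \<Rightarrow> ('m, 'e) bil_field \<Rightarrow> bool" where
  "riemannian \<A> W g \<longleftrightarrow> bilinear_field \<A> W g \<and>
     (\<forall>c\<in>\<A>. \<forall>p\<in>fst c \<inter> W.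
        (\<forall>v w. g c p v w = g c p w v) \<and> (\<forall>v. v \<noteq> 0 \<longrightarrow> 0 < g c p v v))"

definition symplectic ::
  "('m, 'e::euclidean_space) chart set \<Rightarrow> 'm set \<Rightarrow> ('m, 'e) bil_field \<Rightarrow> bool" where
  "symplectic \<A> W F \<longleftrightarrow> bilinear_field \<A> W F \<and>
     (\<forall>c\<in>\<A>. \<forall>p\<in>fst c \<inter> W.
        (\<forall>v w. F c p v w = - F c p w v) \<and>
        (\<forall>v. (\<forall>w. F c p v w = 0) \<longrightarrow> v = 0) \<and>
        (\<forall>u v w. ext_d2 (local_rep c F) (snd c p) u v w = 0))"

definition complex_structure ::
  "('m, 'e::euclidean_space) chart set \<Rightarrow> 'm set \<Rightarrow> ('m, 'e) end_field \<Rightarrow> bool" where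
  "complex_structure \<A> W J \<longleftrightarrow> endo_field \<A> W J \<and>
     (\<forall>c\<in>\<A>. \<forall>p\<in>fst c \<inter> W.
        (\<forall>v. J c p (J c p v) = - v) \<and>
        (\<forall>u v. nijenhuis (local_rep c J) (snd c p) u v = 0))"

definition hermitian ::
  "('m, 'e::euclidean_space) chart set \<Rightarrow> 'm set \<Rightarrow> ('m, 'e) bil_field \<Rightarrow> ('m, 'e) end_field \<Rightarrow> bool" where
  "hermitian \<A> W g J \<longleftrightarrow> riemannian \<A> W g \<and> complex_structure \<A> W J \<and>
     (\<forall>c\<in>\<A>. \<forall>p\<in>fst c \<inter> W. \<forall>v w. g c p (J c p v) (J c p w) = g c p v w)"

definition fund_form :: "('m, 'e) bil_field \<Rightarrow> ('m, 'e) end_field \<Rightarrow> ('m, 'e) bil_field" where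
  "fund_form g J c p v w = g c p (J c p v) w"

definition kaehler ::
  "('m, 'e::euclidean_space) chart set \<Rightarrow> 'm set \<Rightarrow> ('m, 'e) bil_field \<Rightarrow> ('m, 'e) bil_field
     \<Rightarrow> ('m, 'e) end_field \<Rightarrow> bool" where
  "kaehler \<A> W F g J \<longleftrightarrow> hermitian \<A> W g J \<and> symplectic \<A> W F \<and>
     (\<forall>c\<in>\<A>. \<forall>p\<in>fst c \<inter> W. F c p = fund_form g J c p)"

definition generalized_kaehler ::
  "('m, 'e::euclidean_space) chart set \<Rightarrow> 'm set \<Rightarrow> ('m, 'e) bil_field \<Rightarrow> ('m, 'e) end_field
     \<Rightarrow> ('m, 'e) end_field \<Rightarrow> bool" where
  "generalized_kaehler \<A> W g I J \<longleftrightarrow> hermitian \<A> W g I \<and> hermitian \<A> W g J \<and>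
     (\<forall>c\<in>\<A>.
        let H\<^sub>I = dc2 (local_rep c I) (local_rep c (fund_form g I));
            H\<^sub>J = dc2 (local_rep c J) (local_rep c (fund_form g J))
        in \<forall>p\<in>fst c \<inter> W.
             (\<forall>u v w. H\<^sub>I (snd c p) u v w = - H\<^sub>J (snd c p) u v w) \<and>
             (\<forall>u v w z. ext_d3 H\<^sub>I (snd c p) u v w z = 0))"


section \<open>Completeness\<close>

definition C1_path_on ::
  "('m::topological_space, 'e::euclidean_space) chart set \<Rightarrow> (real \<Rightarrow> 'm) \<Rightarrow> real set \<Rightarrow> bool" where
  "C1_path_on \<A> \<gamma> S \<longleftrightarrow> continuous_on S \<gamma> \<and>
     (\<forall>c\<in>\<A>. let S\<^sub>c = {t\<in>S. \<gamma> t \<in> fst c} in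
        \<exists>D. continuous_on S\<^sub>c D \<and>
            (\<forall>t\<in>S\<^sub>c. ((snd c \<circ> \<gamma>) has_vector_derivative D t) (at t within S\<^sub>c)))"

text \<open>Each piece is \<open>C\<^sup>1\<close> up to its end points.\<close>

definition piecewise_C1_path ::
  "('m::topological_space, 'e::euclidean_space) chart set \<Rightarrow> (real \<Rightarrow> 'm) \<Rightarrow> bool" where
  "piecewise_C1_path \<A> \<gamma> \<longleftrightarrow> continuous_on {0..1} \<gamma> \<and>
     (\<exists>K. finite K \<and> (\<forall>a b. 0 \<le> a \<and> a < b \<and> b \<le> 1 \<and> {a<..<b} \<inter> K = {}
        \<longrightarrow> C1_path_on \<A> \<gamma> {a..b}))"

text \<open>The choice of the chart is irrelevant by the transformation law of \<open>g\<close>, and the values at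
  the finitely many break points do not affect the length.\<close>

definition speed ::
  "('m, 'e::euclidean_space) chart set \<Rightarrow> ('m, 'e) bil_field \<Rightarrow> (real \<Rightarrow> 'm) \<Rightarrow> real \<Rightarrow> real" where
  "speed \<A> g \<gamma> t =
     (let c = (SOME c. c \<in> \<A> \<and> \<gamma> t \<in> fst c);
          v = vector_derivative (snd c \<circ> \<gamma>) (at t)
      in sqrt (g c (\<gamma> t) v v))"

text \<open>Infinite for points in different connected components.\<close>

definition riem_dist ::
  "('m::topological_space, 'e::euclidean_space) chart set \<Rightarrow> ('m, 'e) bil_field \<Rightarrow> 'm \<Rightarrow> 'm \<Rightarrow> ennreal" where
  "riem_dist \<A> g p q =
     (INF \<gamma>\<in>{\<gamma>. piecewise_C1_path \<A> \<gamma> \<and> \<gamma> 0 = p \<and> \<gamma> 1 = q}.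
        ennreal (integral {0..1} (speed \<A> g \<gamma>)))"

definition complete_riemannian ::
  "('m::topological_space, 'e::euclidean_space) chart set \<Rightarrow> ('m, 'e) bil_field \<Rightarrow> bool" where
  "complete_riemannian \<A> g \<longleftrightarrow> riemannian \<A> UNIV g \<and>
     (\<forall>s :: nat \<Rightarrow> 'm.
        (\<forall>\<epsilon>>0. \<exists>N. \<forall>i\<ge>N. \<forall>j\<ge>N. riem_dist \<A> g (s i) (s j) < \<epsilon>) \<longrightarrow>
        (\<exists>p. (\<lambda>i. riem_dist \<A> g (s i) p) \<longlonglongrightarrow> 0))"


section \<open>Locally toric Kaehler structures and their deformations\<close>

text \<open>The model space of a \<open>2n\<close>-manifold is \<open>\<real>\<^sup>n \<times> \<real>\<^sup>n\<close>, with coordinates \<open>(t, \<mu>)\<close>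
  and \<open>n = CARD('n)\<close>.\<close>

type_synonym 'n model = "(real ^ 'n) \<times> (real ^ 'n)"

definition dt :: "'n::finite \<Rightarrow> 'n model" where
  "dt i = (axis i 1, 0)"

definition dmu :: "'n::finite \<Rightarrow> 'n model" where
  "dmu i = (0, axis i 1)"

definition locally_toric_kaehler ::
  "('m, 'n::finite model) chart set \<Rightarrow> 'm set \<Rightarrow> ('m, 'n model) bil_field \<Rightarrow> ('m, 'n model) bil_field
     \<Rightarrow> ('m, 'n model) end_field \<Rightarrow> ('n \<Rightarrow> ('m, 'n model) vec_field) \<Rightarrow> bool" where
  "locally_toric_kaehler \<A> W F g J X \<longleftrightarrow> kaehler \<A> W F g J \<and> (\<forall>i. vector_field \<A> W (X i)) \<and>
     (\<forall>c\<in>\<A>. \<forall>p\<in>fst c \<inter> W.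
        (\<forall>i j. lie_bracket (local_rep c (X i)) (local_rep c (X j)) (snd c p) = 0) \<and>
        (\<forall>i v w. lie_bil (local_rep c (X i)) (local_rep c F) (snd c p) v w = 0) \<and>
        (\<forall>i v w. lie_bil (local_rep c (X i)) (local_rep c g) (snd c p) v w = 0) \<and>
        (\<forall>i v. lie_endo (local_rep c (X i)) (local_rep c J) (snd c p) v = 0) \<and>
        (\<forall>a. (\<Sum>i\<in>UNIV. a i *\<^sub>R X i c p) = 0 \<longrightarrow> (\<forall>i. a i = 0)) \<and>
        (\<forall>i j. F c p (X i c p) (X j c p) = 0))"

definition hess :: "(real ^ 'n \<Rightarrow> real) \<Rightarrow> real ^ 'n \<Rightarrow> real ^ 'n ^ 'n" where
  "hess u x = (\<chi> i j. frechet_derivative (\<lambda>y. frechet_derivative u (at y) (axis j 1)) (at x) (axis i 1))"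

definition sym_part :: "real ^ 'n ^ 'n \<Rightarrow> real ^ 'n ^ 'n" where
  "sym_part B = (1/2) *\<^sub>R (B + transpose B)"

text \<open>The form \<open>\<Sum>\<^sub>i\<^sub>j P\<^sub>i\<^sub>j d\<mu>\<^sub>i d\<mu>\<^sub>j + Q\<^sub>i\<^sub>j dt\<^sub>i dt\<^sub>j\<close>, and the endomorphism determined by
  \<open>\<partial>\<^sub>\<mu>\<^sub>i \<mapsto> \<Sum>\<^sub>j P\<^sub>i\<^sub>j \<partial>\<^sub>t\<^sub>j\<close>, \<open>\<partial>\<^sub>t\<^sub>i \<mapsto> - \<Sum>\<^sub>j (P\<inverse>)\<^sub>i\<^sub>j \<partial>\<^sub>\<mu>\<^sub>j\<close>.\<close>

definition block_metric ::
  "real ^ 'n ^ 'n \<Rightarrow> real ^ 'n ^ 'n \<Rightarrow> 'n::finite model \<Rightarrow> 'n model \<Rightarrow> real" where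
  "block_metric P Q v w =
     (\<Sum>i\<in>UNIV. \<Sum>j\<in>UNIV. P $ i $ j * (snd v $ i * snd w $ j) + Q $ i $ j * (fst v $ i * fst w $ j))"

definition has_block_form :: "('n::finite model \<Rightarrow> 'n model) \<Rightarrow> real ^ 'n ^ 'n \<Rightarrow> bool" where
  "has_block_form J P \<longleftrightarrow> (\<forall>i.
     J (dmu i) = (\<Sum>j\<in>UNIV. P $ i $ j *\<^sub>R dt j) \<and>
     J (dt i) = - (\<Sum>j\<in>UNIV. matrix_inv P $ i $ j *\<^sub>R dmu j))"

text \<open>The chart \<open>c\<close> is a system of coordinates \<open>(t, \<mu>)\<close> in which \<open>X\<^sub>i = \<partial>\<^sub>t\<^sub>i\<close>,
  \<open>\<iota>\<^bsub>X\<^sub>i\<^esub> F = - d\<mu>\<^sub>i\<close>, \<open>F = \<Sum>\<^sub>i d\<mu>\<^sub>i \<and> dt\<^sub>i\<close> and \<open>(g\<^sub>K, J\<^sub>K)\<close> is given by \<open>G = Hess(u)(\<mu>)\<close>.\<close>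

definition toric_chart ::
  "('m, 'n::finite model) chart \<Rightarrow> ('m, 'n model) bil_field \<Rightarrow> ('m, 'n model) bil_field
     \<Rightarrow> ('m, 'n model) end_field \<Rightarrow> ('n \<Rightarrow> ('m, 'n model) vec_field) \<Rightarrow> (real ^ 'n \<Rightarrow> real) \<Rightarrow> bool" where
  "toric_chart c F g\<^sub>K J\<^sub>K X u \<longleftrightarrow>
     smooth_on u (snd ` snd c ` fst c) \<and>
     (\<forall>p\<in>fst c. let G = hess u (snd (snd c p)) in
        (\<forall>i. X i c p = dt i) \<and>
        (\<forall>i w. F c p (X i c p) w = - (snd w $ i)) \<and>
        (\<forall>v w. F c p v w = (\<Sum>i\<in>UNIV. snd v $ i * fst w $ i - fst v $ i * snd w $ i)) \<and>
        (\<forall>\<xi>. \<xi> \<noteq> 0 \<longrightarrow> 0 < \<xi> \<bullet> (G *v \<xi>)) \<and>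
        has_block_form (J\<^sub>K c p) G \<and>
        g\<^sub>K c p = block_metric G (matrix_inv G))"

text \<open>The bivector is \<open>\<Sum>\<^sub>i\<^sub>j A\<^sub>i\<^sub>j X\<^sub>i \<and> X\<^sub>j\<close>. Coordinates as above exist around every point; the
  formulas for \<open>(g, I, J)\<close> do not depend on their choice, so it suffices to state them in one
  such system around each point.\<close>

definition A_deformation ::
  "('m, 'n::finite model) chart set \<Rightarrow> 'm set \<Rightarrow> real ^ 'n ^ 'n \<Rightarrow> ('m, 'n model) bil_field
     \<Rightarrow> ('m, 'n model) bil_field \<Rightarrow> ('m, 'n model) end_field \<Rightarrow> ('n \<Rightarrow> ('m, 'n model) vec_field)
     \<Rightarrow> ('m, 'n model) bil_field \<Rightarrow> ('m, 'n model) end_field \<Rightarrow> ('m, 'n model) end_field \<Rightarrow> bool" where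
  "A_deformation \<A> W A F g\<^sub>K J\<^sub>K X g I J \<longleftrightarrow>
     transpose A = - A \<and>
     bilinear_field \<A> W g \<and> endo_field \<A> W I \<and> endo_field \<A> W J \<and>
     (\<forall>p\<in>W. \<exists>c\<in>\<A>. \<exists>u. p \<in> fst c \<and> fst c \<subseteq> W \<and> toric_chart c F g\<^sub>K J\<^sub>K X u \<and>
        (\<forall>q\<in>fst c.
           let G = hess u (snd (snd c q)); \<Psi> = G + A in
             has_block_form (J c q) \<Psi> \<and>
             has_block_form (I c q) (transpose \<Psi>) \<and>
             g c q = block_metric G (sym_part (matrix_inv \<Psi>))))"


section \<open>Smooth extensions\<close>

definition toric_extension ::
  "('m, 'e::euclidean_space) chart set \<Rightarrow> 'm set \<Rightarrow> ('m, 'e) bil_field \<Rightarrow> ('i \<Rightarrow> ('m, 'e) vec_field)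
     \<Rightarrow> ('m, 'e) bil_field \<Rightarrow> ('i \<Rightarrow> ('m, 'e) vec_field) \<Rightarrow> bool" where
  "toric_extension \<A> W F X F' X' \<longleftrightarrow>
     symplectic \<A> UNIV F' \<and> agree_on \<A> W F F' \<and>
     (\<forall>i. vector_field \<A> UNIV (X' i) \<and> agree_on \<A> W (X i) (X' i))"

definition kaehler_extension ::
  "('m, 'e::euclidean_space) chart set \<Rightarrow> 'm set \<Rightarrow> ('m, 'e) bil_field \<Rightarrow> ('m, 'e) bil_field
     \<Rightarrow> ('m, 'e) end_field \<Rightarrow> ('m, 'e) bil_field \<Rightarrow> ('m, 'e) end_field \<Rightarrow> bool" where
  "kaehler_extension \<A> W F' g\<^sub>K J\<^sub>K g\<^sub>K' J\<^sub>K' \<longleftrightarrow>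
     kaehler \<A> UNIV F' g\<^sub>K' J\<^sub>K' \<and> agree_on \<A> W g\<^sub>K g\<^sub>K' \<and> agree_on \<A> W J\<^sub>K J\<^sub>K'"

definition gk_extension ::
  "('m, 'e::euclidean_space) chart set \<Rightarrow> 'm set \<Rightarrow> ('m, 'e) bil_field \<Rightarrow> ('m, 'e) end_field
     \<Rightarrow> ('m, 'e) end_field \<Rightarrow> ('m, 'e) bil_field \<Rightarrow> ('m, 'e) end_field \<Rightarrow> ('m, 'e) end_field \<Rightarrow> bool" where
  "gk_extension \<A> W g I J g' I' J' \<longleftrightarrow>
     generalized_kaehler \<A> UNIV g' I' J' \<and>
     agree_on \<A> W g g' \<and> agree_on \<A> W I I' \<and> agree_on \<A> W J J'"

end

theory Submission
  imports Defs
begin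

text \<open>Let \<open>B = \<Sum> A\<^sub>i\<^sub>j F(X\<^sub>i, \<cdot>) X\<^sub>j\<close>. It extends to \<open>M\<close> with \<open>(F, X)\<close> and vanishes on its own image, because the
  \<open>X\<^sub>i\<close> span isotropic subspaces. In toric coordinates one checks \<open>J T = T J\<^sub>K\<close> for \<open>T = 1 + B J\<^sub>K\<close>, similarly
  \<open>I S = S J\<^sub>K\<close> for \<open>S = 1 - B J\<^sub>K\<close>, and conversely \<open>J\<^sub>K R = R J\<close> for \<open>R = 1 - B J\<close>, while \<open>g\<close> is the
  symmetric part of \<open>F(\<cdot>, J \<cdot>)\<close>. If \<open>J\<^sub>K\<close> (or \<open>J\<close>) is tamed by \<open>F\<close> on all of \<open>M\<close>, then \<open>T\<close> and \<open>S\<close> (or \<open>R\<close>) are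
  invertible there: \<open>v = - B J v\<close> implies \<open>F(v, J v) = - F(B J v, J v) = 0\<close>. Moreover \<open>F(T v, T J v) = F(v, J v)\<close>, so
  conjugation by the shear yields a tamed smooth structure on \<open>M\<close>; its integrability follows from that on the dense
  set by continuity. The torsion condition is automatic, since \<open>d\<^sup>c\<^sub>J \<omega>\<^sub>J\<close> is the differential of the skew part of
  \<open>F(\<cdot>, J \<cdot>)\<close>, and for \<open>I\<close>, the \<open>F\<close>-adjoint of \<open>- J\<close>, that skew part changes sign.\<close>

section \<open>Calculus\<close>

text \<open>The obstacle is that \<open>G\<close>, \<open>\<Psi>\<close> and the toric coordinates
  lose their meaning where the \<open>X_i\<close> degenerate, so the relation between
  \<open>J_K\<close> and \<open>J\<close> has to be written through \<open>F\<close>, the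
  \<open>X_i\<close> and \<open>A\<close> alone. The origin of \<open>T\<close>: with
  \<open>U = G - A\<close>, toric coordinates give \<open>J_K (a, b) = (G b, - G^-1 a)\<close> and
  \<open>J (a, b) = (U b, - U^-1 a)\<close>. The block-diagonal map
  \<open>(a, b) -> (U G^-1 a, b)\<close> conjugates one into the other, and
  \<open>U G^-1 = 1 - A G^-1\<close> is the \<open>t\<close>-block of \<open>1 + B J_K\<close>. Over
  the dense set \<open>T\<close> and \<open>R\<close> are mutually inverse, so the converse is the
  same construction with \<open>- A\<close> applied to \<open>J\<close>. Integrability of
  \<open>I\<close> and \<open>J\<close> is not part of the definition of a deformation: on the dense
  set it is derived from the Hessian form in toric charts and carried to the other charts by
  naturality. For completeness, \<open>g \<le> g_K\<close> turns Cauchy sequences of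
  \<open>g_K\<close> into Cauchy sequences of \<open>g\<close>, but does not bound the larger
  distance to the limit; the limit is transferred through the topology of the manifold, which both
  distances describe near a point.\<close>

lemma frechet_derivative_cong_open:
  assumes "open S" "x \<in> S" "\<And>y. y \<in> S \<Longrightarrow> f y = g y"
  shows "frechet_derivative f (at x) = frechet_derivative g (at x)"
proof -
  \<comment> \<open>\<open>frechet_derivative\<close> is a choice among all derivatives, so it is
    enough that both functions have the same ones; this also covers points without
    derivative.\<close>
  have "(f has_derivative D) (at x) \<longleftrightarrow> (g has_derivative D) (at x)" for D
    using assms has_derivative_transform_within_open[OF _ assms(1,2), of f D UNIV g]
      has_derivative_transform_within_open[OF _ assms(1,2), of g D UNIV f] by auto
  then show ?thesis
    by (simp add: frechet_derivative_def)
qed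

lemma differentiable_cong_open:
  assumes "open S" "x \<in> S" "\<And>y. y \<in> S \<Longrightarrow> f y = g y" "f differentiable (at x)"
  shows "g differentiable (at x)"
  using assms has_derivative_transform_within_open[OF _ assms(1,2), of f _ UNIV g]
  by (auto simp: differentiable_def)

lemma frechet_derivative_eqI:
  assumes "(f has_derivative D) (at x)"
  shows "frechet_derivative f (at x) v = D v"
  using frechet_derivative_at[OF assms] by simp

lemma has_derivative_frechet:
  assumes "f differentiable (at x)"
  shows "(f has_derivative (\<lambda>h. frechet_derivative f (at x) h)) (at x)"
  using assms frechet_derivative_works by auto

section \<open>Closure properties of C^k maps on open sets\<close>

lemma Ck_on_cong:
  assumes "open S" "\<And>x. x \<in> S \<Longrightarrow> f x = g x" "Ck_on k f S"
  shows "Ck_on k g S"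
  using assms(2,3)
proof (induction k arbitrary: f g)
  case 0
  then show ?case by (simp cong: continuous_on_cong)
next
  case (Suc k)
  have fg: "frechet_derivative f (at x) = frechet_derivative g (at x)" if "x \<in> S" for x
    using frechet_derivative_cong_open[OF assms(1) that Suc.prems(1)] by simp
  have "Ck_on k (\<lambda>x. frechet_derivative g (at x) v) S" for v
    by (rule Suc.IH[of "\<lambda>x. frechet_derivative f (at x) v"]) (use fg Suc.prems in auto)
  moreover have "g differentiable (at x)" if "x \<in> S" for x
    using differentiable_cong_open[OF assms(1) that Suc.prems(1)] Suc.prems(2) that by simp
  ultimately show ?case by simp
qed

lemma Ck_on_SucD: "Ck_on (Suc k) f S \<Longrightarrow> Ck_on k f S"
proof (induction k arbitrary: f)
  case 0
  then show ?case
    by (auto intro!: continuous_at_imp_continuous_on differentiable_imp_continuous_within)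
next
  case (Suc k)
  then have "Ck_on (Suc k) (\<lambda>x. frechet_derivative f (at x) v) S" for v
    by (simp only: Ck_on.simps(2)[of "Suc k" f])
  then have "Ck_on k (\<lambda>x. frechet_derivative f (at x) v) S" for v
    by (rule Suc.IH)
  then show ?case using Suc.prems by simp
qed

lemma Ck_on_subset: "Ck_on k f S \<Longrightarrow> T \<subseteq> S \<Longrightarrow> Ck_on k f T"
  by (induction k arbitrary: f) (auto intro: continuous_on_subset)

lemma Ck_on_const: "Ck_on k (\<lambda>x. a) S"
  by (induction k arbitrary: a) (auto simp: frechet_derivative_const)

lemma Ck_on_add:
  assumes "open S" "Ck_on k f S" "Ck_on k g S"
  shows "Ck_on k (\<lambda>x. f x + g x) S"
  using assms(2,3)
proof (induction k arbitrary: f g)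
  case 0
  then show ?case by (simp add: continuous_on_add)
next
  case (Suc k)
  have "Ck_on k (\<lambda>x. frechet_derivative (\<lambda>x. f x + g x) (at x) v) S" for v
    by (rule Ck_on_cong[OF assms(1), of "\<lambda>x. frechet_derivative f (at x) v + frechet_derivative g (at x) v"])
      (use Suc.IH Suc.prems in simp_all, use Suc.prems in \<open>auto intro!: frechet_derivative_eqI[symmetric] has_derivative_add has_derivative_frechet\<close>)
  then show ?case using Suc.prems by simp
qed

text \<open>One product rule for scaling, multiplication and inner product. The derivative of the
  product involves the undifferentiated factors as well, which is why regularity of one order lower
  is extracted from the hypotheses.\<close>

lemma Ck_on_bilinear:
  fixes pr :: "'b::real_normed_vector \<Rightarrow> 'c::real_normed_vector \<Rightarrow> 'd::real_normed_vector"
    and f :: "'a::real_normed_vector \<Rightarrow> 'b"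
  assumes "bounded_bilinear pr" "open S" "Ck_on k f S" "Ck_on k g S"
  shows "Ck_on k (\<lambda>x. pr (f x) (g x)) S"
  using assms(3,4)
proof (induction k arbitrary: f g)
  case 0
  then show ?case by (simp add: bounded_bilinear.continuous_on[OF assms(1)])
next
  case (Suc k)
  have der: "((\<lambda>x. pr (f x) (g x)) has_derivative
      (\<lambda>h. pr (f x) (frechet_derivative g (at x) h) + pr (frechet_derivative f (at x) h) (g x))) (at x)"
    if "x \<in> S" for x
    using Suc.prems that by (intro bounded_bilinear.FDERIV[OF assms(1)] has_derivative_frechet) auto
  have "Ck_on k (\<lambda>x. pr (f x) (frechet_derivative g (at x) v) + pr (frechet_derivative f (at x) v) (g x)) S" for v
    using Suc.prems Ck_on_SucD[OF Suc.prems(1)] Ck_on_SucD[OF Suc.prems(2)]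
    by (intro Ck_on_add[OF assms(2)] Suc.IH) auto
  then have "Ck_on k (\<lambda>x. frechet_derivative (\<lambda>x. pr (f x) (g x)) (at x) v) S" for v
    by (rule Ck_on_cong[OF assms(2), rotated]) (simp add: frechet_derivative_eqI[OF der])
  then show ?case using der by (auto simp: differentiable_def)
qed

lemma smooth_on_cong: "open S \<Longrightarrow> (\<And>x. x \<in> S \<Longrightarrow> f x = g x) \<Longrightarrow> smooth_on f S \<Longrightarrow> smooth_on g S"
  unfolding smooth_on_def by (blast intro: Ck_on_cong)

lemma smooth_on_subset: "smooth_on f S \<Longrightarrow> T \<subseteq> S \<Longrightarrow> smooth_on f T"
  unfolding smooth_on_def by (blast intro: Ck_on_subset)

lemma smooth_on_const: "smooth_on (\<lambda>x. a) S"
  by (simp add: smooth_on_def Ck_on_const)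

lemma smooth_on_add: "open S \<Longrightarrow> smooth_on f S \<Longrightarrow> smooth_on g S \<Longrightarrow> smooth_on (\<lambda>x. f x + g x) S"
  by (simp add: smooth_on_def Ck_on_add)

lemma smooth_on_scaleR:
  "open S \<Longrightarrow> smooth_on f S \<Longrightarrow> smooth_on g S \<Longrightarrow> smooth_on (\<lambda>x. f x *\<^sub>R g x) S"
  by (simp add: smooth_on_def Ck_on_bilinear[OF bounded_bilinear_scaleR])

lemma smooth_on_mult:
  fixes f g :: "_ \<Rightarrow> real"
  shows "open S \<Longrightarrow> smooth_on f S \<Longrightarrow> smooth_on g S \<Longrightarrow> smooth_on (\<lambda>x. f x * g x) S"
  by (simp add: smooth_on_def Ck_on_bilinear[OF bounded_bilinear_mult])

lemma smooth_on_inner: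
  "open S \<Longrightarrow> smooth_on f S \<Longrightarrow> smooth_on g S \<Longrightarrow> smooth_on (\<lambda>x. f x \<bullet> g x) S"
  by (simp add: smooth_on_def Ck_on_bilinear[OF bounded_bilinear_inner])

lemma smooth_on_uminus: "open S \<Longrightarrow> smooth_on f S \<Longrightarrow> smooth_on (\<lambda>x. - f x) S"
  using smooth_on_scaleR[OF _ smooth_on_const[of "-1"], of S f] by simp

lemma smooth_on_diff:
  "open S \<Longrightarrow> smooth_on f S \<Longrightarrow> smooth_on g S \<Longrightarrow> smooth_on (\<lambda>x. f x - g x) S"
  using smooth_on_add[of S f "\<lambda>x. - g x"] by (simp add: smooth_on_uminus)

lemma smooth_on_sum:
  "open S \<Longrightarrow> (\<And>i. i \<in> I \<Longrightarrow> smooth_on (f i) S) \<Longrightarrow> smooth_on (\<lambda>x. \<Sum>i\<in>I. f i x) S"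
  by (induction I rule: infinite_finite_induct) (auto intro: smooth_on_const smooth_on_add)

lemma smooth_on_imp_differentiable: "smooth_on f S \<Longrightarrow> x \<in> S \<Longrightarrow> f differentiable (at x)"
  unfolding smooth_on_def by (metis Ck_on.simps(2))

lemma smooth_on_frechet_derivative:
  "smooth_on f S \<Longrightarrow> smooth_on (\<lambda>x. frechet_derivative f (at x) v) S"
  unfolding smooth_on_def by (metis Ck_on.simps(2))

lemma smooth_on_imp_continuous_on: "smooth_on f S \<Longrightarrow> continuous_on S f"
  unfolding smooth_on_def by (metis Ck_on.simps(1))

section \<open>Pointwise linear families evaluated on varying vectors\<close>

lemma linear_expand_Basis:
  fixes f :: "'a::euclidean_space \<Rightarrow> 'b::real_vector"
  assumes "linear f"
  shows "f z = (\<Sum>b\<in>Basis. (z \<bullet> b) *\<^sub>R f b)"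
  by (metis (no_types, lifting) assms euclidean_representation linear_scale linear_sum sum.cong)

lemma bilinear_expand_Basis:
  fixes f :: "'a::euclidean_space \<Rightarrow> 'a \<Rightarrow> real"
  assumes "bilinear f"
  shows "f v w = (\<Sum>b\<in>Basis. \<Sum>b'\<in>Basis. (v \<bullet> b) * (w \<bullet> b') * f b b')"
proof -
  have lin: "linear (f v)" "linear (\<lambda>v. f v w)" for v w using assms by (simp_all add: bilinear_def)
  have "f v w = (\<Sum>b\<in>Basis. (v \<bullet> b) *\<^sub>R f b w)" by (rule linear_expand_Basis[OF lin(2)])
  also have "\<dots> = (\<Sum>b\<in>Basis. (v \<bullet> b) *\<^sub>R (\<Sum>b'\<in>Basis. (w \<bullet> b') *\<^sub>R f b b'))"
    by (subst linear_expand_Basis[OF lin(1)]) simp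
  finally show ?thesis by (simp add: sum_distrib_left mult.assoc)
qed

text \<open>Tensor fields are smooth by definition only when evaluated on constant vectors;
  expanding the argument in \<open>Basis\<close> reduces varying vectors to sums of
  products.\<close>

lemma smooth_on_linear_app:
  fixes L :: "'a::real_normed_vector \<Rightarrow> 'b::euclidean_space \<Rightarrow> 'c::real_normed_vector"
  assumes "open S" "\<And>x. x \<in> S \<Longrightarrow> linear (L x)" "\<And>v. smooth_on (\<lambda>x. L x v) S" "smooth_on f S"
  shows "smooth_on (\<lambda>x. L x (f x)) S"
proof -
  have "smooth_on (\<lambda>x. \<Sum>b\<in>Basis. (f x \<bullet> b) *\<^sub>R L x b) S"
    using assms by (intro smooth_on_sum smooth_on_scaleR smooth_on_inner smooth_on_const) auto
  then show ?thesis
    by (rule smooth_on_cong[OF assms(1), rotated]) (metis assms(2) linear_expand_Basis)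
qed

lemma smooth_on_bilinear_app:
  fixes B :: "'a::real_normed_vector \<Rightarrow> 'b::euclidean_space \<Rightarrow> 'b \<Rightarrow> real"
  assumes "open S" "\<And>x. x \<in> S \<Longrightarrow> bilinear (B x)" "\<And>v w. smooth_on (\<lambda>x. B x v w) S"
    "smooth_on f S" "smooth_on g S"
  shows "smooth_on (\<lambda>x. B x (f x) (g x)) S"
proof -
  have "smooth_on (\<lambda>x. B x v (g x)) S" for v
  proof (rule smooth_on_linear_app[where L = "\<lambda>x w. B x v w", OF assms(1) _ _ assms(5)])
    show "linear (\<lambda>w. B x v w)" if "x \<in> S" for x
      using assms(2)[OF that] by (simp add: bilinear_def)
  qed (rule assms(3))
  moreover have "linear (\<lambda>v. B x v (g x))" if "x \<in> S" for x
    using assms(2)[OF that] by (simp add: bilinear_def)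
  ultimately show ?thesis
    using smooth_on_linear_app[where L = "\<lambda>x v. B x v (g x)", OF assms(1) _ _ assms(4)] by blast
qed

text \<open>At a zero of one factor the other factor needs no derivative. This is what allows the
  inverse of a family of maps to be differentiated when only its continuity is known.\<close>

lemma has_derivative_mult_vanishing:
  fixes f :: "'a::real_normed_vector \<Rightarrow> real" and g :: "'a \<Rightarrow> 'b::real_normed_vector"
  assumes f: "(f has_derivative D) (at x)" "f x = 0" and g: "isCont g x"
  shows "((\<lambda>y. f y *\<^sub>R g y) has_derivative (\<lambda>h. D h *\<^sub>R g x)) (at x)"
proof -
  have bl: "bounded_linear D" using f(1) by (rule has_derivative_bounded_linear)
  obtain K where K: "\<And>h. norm (D h) \<le> norm h * K" using bl bounded_linear.bounded by blast
  have lim: "((\<lambda>h. norm (f (x+h) - f x - D h) / norm h) \<longlongrightarrow> 0) (at 0)"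
    using f(1) unfolding has_derivative_at by simp
  have gl: "((\<lambda>h. g (x+h)) \<longlongrightarrow> g x) (at 0)"
    using g unfolding isCont_iff .
  have gd: "((\<lambda>h. norm (g (x+h) - g x)) \<longlongrightarrow> 0) (at 0)"
    using LIM_zero[OF gl] tendsto_norm_zero by blast
  have "((\<lambda>h. (norm (f (x+h) - f x - D h) / norm h) * norm (g (x+h)) + \<bar>K\<bar> * norm (g (x+h) - g x))
      \<longlongrightarrow> 0 * norm (g x) + \<bar>K\<bar> * 0) (at 0)"
    by (intro tendsto_intros lim gl gd)
  then have main: "((\<lambda>h. (norm (f (x+h) - f x - D h) / norm h) * norm (g (x+h)) + \<bar>K\<bar> * norm (g (x+h) - g x))
      \<longlongrightarrow> 0) (at 0)" by simp
  have bd: "norm (f (x+h) *\<^sub>R g (x+h) - f x *\<^sub>R g x - D h *\<^sub>R g x) / norm h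
      \<le> (norm (f (x+h) - f x - D h) / norm h) * norm (g (x+h)) + \<bar>K\<bar> * norm (g (x+h) - g x)"
    if "h \<noteq> 0" for h
  proof -
    have "f (x+h) *\<^sub>R g (x+h) - f x *\<^sub>R g x - D h *\<^sub>R g x =
        (f (x+h) - f x - D h) *\<^sub>R g (x+h) + D h *\<^sub>R (g (x+h) - g x)"
      using f(2) by (simp add: algebra_simps)
    then have "norm (f (x+h) *\<^sub>R g (x+h) - f x *\<^sub>R g x - D h *\<^sub>R g x)
        \<le> norm (f (x+h) - f x - D h) * norm (g (x+h)) + norm (D h) * norm (g (x+h) - g x)"
      by (metis norm_scaleR norm_triangle_ineq real_norm_def)
    also have "\<dots> \<le> norm (f (x+h) - f x - D h) * norm (g (x+h)) + (norm h * \<bar>K\<bar>) * norm (g (x+h) - g x)"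
      using order_trans[OF K mult_left_mono[OF abs_ge_self norm_ge_zero]]
      by (intro add_left_mono mult_right_mono) auto
    finally show ?thesis using that by (simp add: field_simps)
  qed
  have "((\<lambda>h. norm (f (x+h) *\<^sub>R g (x+h) - f x *\<^sub>R g x - D h *\<^sub>R g x) / norm h) \<longlongrightarrow> 0) (at 0)"
    by (rule Lim_null_comparison[OF _ main]) (simp add: eventually_at_filter, intro always_eventually allI impI, use bd in simp)
  moreover have "bounded_linear (\<lambda>h. D h *\<^sub>R g x)"
    using bl by (rule bounded_linear_scaleR_const)
  ultimately show ?thesis unfolding has_derivative_at by simp
qed

section \<open>Smoothness of the inverse of a family of linear maps\<close>

text \<open>The differential of \<open>x \<mapsto> W x v = (T x)\<inverse> v\<close> is \<open>h \<mapsto> - W x (T'(h) (W x v))\<close>; since it is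
  built from \<open>W\<close> itself, differentiability bootstraps to smoothness.\<close>

lemma smooth_on_inverse:
  fixes T W :: "'a::real_normed_vector \<Rightarrow> 'e::euclidean_space \<Rightarrow> 'e"
  assumes S: "open S" and T: "\<And>x. x \<in> S \<Longrightarrow> linear (T x)" "\<And>v. smooth_on (\<lambda>x. T x v) S"
    and TW: "\<And>x v. x \<in> S \<Longrightarrow> T x (W x v) = v" and WT: "\<And>x v. x \<in> S \<Longrightarrow> W x (T x v) = v"
  shows "smooth_on (\<lambda>x. W x v) S"
proof -
  have W: "linear (W x)" if "x \<in> S" for x
  proof (rule linearI)
    show "W x (a + b) = W x a + W x b" for a b
      using linear_add[OF T(1)[OF that]] TW WT that by metis
    show "W x (r *\<^sub>R a) = r *\<^sub>R W x a" for r a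
      using linear_scale[OF T(1)[OF that]] TW WT that by metis
  qed
  have Tcont: "isCont (\<lambda>x. T x v) x" if "x \<in> S" for x v
    using smooth_on_imp_differentiable[OF T(2) that] by (rule differentiable_imp_continuous_within)
  \<comment> \<open>Resolvent identity \<open>W x - W x0 = - W x (T x - T x0) W x0\<close>;
    continuity and differentiability of \<open>W\<close> both come from it.\<close>
  have diff_eq: "W x v - W x0 v = - W x (T x (W x0 v) - T x0 (W x0 v))" if "x \<in> S" "x0 \<in> S" for x x0 v
    using that by (simp add: linear_diff[OF W] TW WT)
  have Wcont: "isCont (\<lambda>x. W x v) x0" if x0: "x0 \<in> S" for x0 v
  proof -
    have "inj (T x0)" using WT[OF x0] by (metis injI)
    then obtain B where B: "B > 0" "\<And>z. B * norm z \<le> norm (T x0 z)"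
      using linear_inj_bounded_below_pos[OF T(1)[OF x0]] by blast
    have "((\<lambda>x. \<Sum>b\<in>Basis. norm (T x b - T x0 b)) \<longlongrightarrow> (\<Sum>b\<in>(Basis::'e set). norm (T x0 b - T x0 b))) (at x0)"
      using Tcont[OF x0] unfolding isCont_def by (intro tendsto_intros)
    then have "\<forall>\<^sub>F x in at x0. (\<Sum>b\<in>Basis. norm (T x b - T x0 b)) < B/2"
      using B(1) by (intro order_tendstoD) auto
    moreover have "\<forall>\<^sub>F x in at x0. x \<in> S"
      using S x0 by (rule eventually_at_in_open')
    ultimately have ev: "\<forall>\<^sub>F x in at x0. norm (W x v - W x0 v) \<le> (2/B) * norm (T x (W x0 v) - T x0 (W x0 v))"
    proof eventually_elim
      case (elim x)
      \<comment> \<open>\<open>T x\<close> differs from \<open>T x0\<close> by less than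
        \<open>B/2\<close> in operator norm, so half of the lower bound \<open>B\<close> survives
        and \<open>W x\<close> is bounded by \<open>2/B\<close> uniformly near
        \<open>x0\<close>.\<close>
      have lower: "(B/2) * norm z \<le> norm (T x z)" for z
      proof -
        have "linear (\<lambda>z. T x z - T x0 z)" using T(1) elim x0 by (intro linear_compose_sub) auto
        then have "T x z - T x0 z = (\<Sum>b\<in>Basis. (z \<bullet> b) *\<^sub>R (T x b - T x0 b))"
          by (rule linear_expand_Basis)
        then have "norm (T x z - T x0 z) \<le> (\<Sum>b\<in>Basis. norm ((z \<bullet> b) *\<^sub>R (T x b - T x0 b)))"
          by (metis norm_sum)
        also have "\<dots> \<le> (\<Sum>b\<in>Basis. norm z * norm (T x b - T x0 b))"
          by (intro sum_mono) (auto intro!: mult_right_mono Basis_le_norm)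
        also have "\<dots> = norm z * (\<Sum>b\<in>Basis. norm (T x b - T x0 b))" by (simp add: sum_distrib_left)
        also have "\<dots> \<le> norm z * (B/2)" using elim by (intro mult_left_mono) auto
        finally have "norm (T x z - T x0 z) \<le> norm z * (B/2)" .
        moreover have "norm (T x0 z) \<le> norm (T x z) + norm (T x z - T x0 z)"
          by (metis norm_minus_commute norm_triangle_sub)
        ultimately show ?thesis using B(2)[of z] by (simp add: algebra_simps)
      qed
      let ?d = "T x (W x0 v) - T x0 (W x0 v)"
      have "(B/2) * norm (W x ?d) \<le> norm ?d" using lower[of "W x ?d"] TW elim by simp
      moreover have "norm (W x v - W x0 v) = norm (W x ?d)"
        using diff_eq[of x x0 v] elim x0 by simp
      ultimately show ?case using B(1) by (simp add: field_simps)
    qed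
    have "((\<lambda>x. (2/B) * norm (T x (W x0 v) - T x0 (W x0 v))) \<longlongrightarrow> (2/B) * norm (T x0 (W x0 v) - T x0 (W x0 v))) (at x0)"
      using Tcont[OF x0] unfolding isCont_def by (intro tendsto_intros)
    then have "((\<lambda>x. W x v - W x0 v) \<longlongrightarrow> 0) (at x0)"
      by (intro Lim_null_comparison[OF ev]) simp
    then show ?thesis unfolding isCont_def by (rule LIM_zero_cancel)
  qed
  have Wder: "((\<lambda>x. W x v) has_derivative
      (\<lambda>h. - (\<Sum>b\<in>Basis. (frechet_derivative (\<lambda>x. T x (W x0 v)) (at x0) h \<bullet> b) *\<^sub>R W x0 b))) (at x0)"
    if x0: "x0 \<in> S" for x0 v
  proof -
    let ?y = "W x0 v"
    let ?f = "\<lambda>b x. (T x ?y - T x0 ?y) \<bullet> b"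
    have f: "(?f b has_derivative (\<lambda>h. frechet_derivative (\<lambda>x. T x ?y) (at x0) h \<bullet> b)) (at x0)" for b
      by (rule derivative_eq_intros has_derivative_frechet smooth_on_imp_differentiable[OF T(2) x0] refl | simp)+
    \<comment> \<open>The coefficients \<open>?f b\<close> vanish at \<open>x0\<close>, so the
      continuity of \<open>W\<close> already suffices to differentiate the products.\<close>
    have "((\<lambda>x. W x0 v + - (\<Sum>b\<in>Basis. ?f b x *\<^sub>R W x b)) has_derivative
        (\<lambda>h. 0 + - (\<Sum>b\<in>Basis. (frechet_derivative (\<lambda>x. T x ?y) (at x0) h \<bullet> b) *\<^sub>R W x0 b))) (at x0)"
      by (intro has_derivative_add has_derivative_const has_derivative_minus has_derivative_sum
          has_derivative_mult_vanishing f Wcont x0) simp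
    then have "((\<lambda>x. W x0 v + - (\<Sum>b\<in>Basis. ?f b x *\<^sub>R W x b)) has_derivative
        (\<lambda>h. - (\<Sum>b\<in>Basis. (frechet_derivative (\<lambda>x. T x ?y) (at x0) h \<bullet> b) *\<^sub>R W x0 b))) (at x0)"
      by simp
    then show ?thesis
    proof (rule has_derivative_transform_within_open[OF _ S x0])
      fix x assume x: "x \<in> S"
      have "W x (T x ?y - T x0 ?y) = (\<Sum>b\<in>Basis. ?f b x *\<^sub>R W x b)"
        by (rule linear_expand_Basis[OF W[OF x]])
      then show "W x0 v + - (\<Sum>b\<in>Basis. ?f b x *\<^sub>R W x b) = W x v"
        using diff_eq[OF x x0, of v] by (simp add: algebra_simps)
    qed
  qed
  have "Ck_on k (\<lambda>x. W x v) S" for k v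
  proof (induction k arbitrary: v)
    case 0
    then show ?case using Wcont by (simp add: continuous_at_imp_continuous_on)
  next
    case (Suc k)
    have "Ck_on k (\<lambda>x. frechet_derivative (\<lambda>x. W x v) (at x) h) S" for h
    proof -
      \<comment> \<open>The vector fed to \<open>T\<close> will be \<open>W x v\<close>, which moves
        with \<open>x\<close>; the expansion leaves only derivatives of \<open>T\<close> on constant
        vectors, whose smoothness is known.\<close>
      have lin: "frechet_derivative (\<lambda>x. T x y) (at x) h =
          (\<Sum>b\<in>Basis. (y \<bullet> b) *\<^sub>R frechet_derivative (\<lambda>x. T x b) (at x) h)" if x: "x \<in> S" for x y
      proof (rule frechet_derivative_eqI)
        have "((\<lambda>x. \<Sum>b\<in>Basis. (y \<bullet> b) *\<^sub>R T x b) has_derivative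
            (\<lambda>h. \<Sum>b\<in>Basis. (y \<bullet> b) *\<^sub>R frechet_derivative (\<lambda>x. T x b) (at x) h)) (at x)"
          by (intro has_derivative_sum has_derivative_scaleR_right has_derivative_frechet
              smooth_on_imp_differentiable[OF T(2) x])
        then show "((\<lambda>x. T x y) has_derivative
            (\<lambda>h. \<Sum>b\<in>Basis. (y \<bullet> b) *\<^sub>R frechet_derivative (\<lambda>x. T x b) (at x) h)) (at x)"
          by (rule has_derivative_transform_within_open[OF _ S x])
            (metis T(1) linear_expand_Basis)
      qed
      have cs: "Ck_on k (\<lambda>x. \<Sum>i\<in>I. f i x) S" if "\<And>i. i \<in> I \<Longrightarrow> Ck_on k (f i) S"
        for I :: "'e set" and f :: "'e \<Rightarrow> 'a \<Rightarrow> 'e"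
        using that by (induction I rule: infinite_finite_induct) (auto intro: Ck_on_const Ck_on_add[OF S])
      have "Ck_on k (\<lambda>x. (-1::real) *\<^sub>R (\<Sum>b\<in>Basis. ((\<Sum>b'\<in>Basis. (W x v \<bullet> b') *\<^sub>R frechet_derivative (\<lambda>x. T x b') (at x) h) \<bullet> b) *\<^sub>R W x b)) S"
        using smooth_on_frechet_derivative[OF T(2)] unfolding smooth_on_def
        by (intro Ck_on_bilinear[OF bounded_bilinear_scaleR S] Ck_on_bilinear[OF bounded_bilinear_inner S]
            cs Ck_on_const Suc.IH) auto
      then show ?thesis
        by (rule Ck_on_cong[OF S, rotated]) (simp add: frechet_derivative_eqI[OF Wder] lin)
    qed
    then show ?case using Wder by (auto simp: differentiable_def)
  qed
  then show ?thesis by (simp add: smooth_on_def)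
qed

text \<open>The second difference of \<open>f\<close> over the parallelogram spanned by
  \<open>h v\<close> and \<open>h w\<close> is symmetric in \<open>v\<close> and \<open>w\<close>.
  Two mean value theorems write it as \<open>h * h\<close> times a mixed derivative at a nearby
  point, in either order; continuity of the mixed derivatives does the rest.\<close>

lemma second_derivative_symmetric_real:
  fixes f :: "'a::real_normed_vector \<Rightarrow> real"
  assumes S: "open S" "x \<in> S" and f: "smooth_on f S"
  shows "frechet_derivative (\<lambda>y. frechet_derivative f (at y) v) (at x) w =
         frechet_derivative (\<lambda>y. frechet_derivative f (at y) w) (at x) v"
proof -
  define D where "D v y = frechet_derivative f (at y) v" for v y
  have Dsm: "smooth_on (D v) S" for v
    unfolding D_def using f by (rule smooth_on_frechet_derivative)
  have der: "((\<lambda>s. g (p + s *\<^sub>R a)) has_real_derivative frechet_derivative g (at (p + s *\<^sub>R a)) a) (at s)"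
    if "smooth_on g S" "p + s *\<^sub>R a \<in> S" for g :: "'a \<Rightarrow> real" and p a s
  proof -
    have gd: "g differentiable (at (p + s *\<^sub>R a))" using that smooth_on_imp_differentiable by blast
    have "((\<lambda>s. g (p + s *\<^sub>R a)) has_derivative (\<lambda>h. frechet_derivative g (at (p + s *\<^sub>R a)) (h *\<^sub>R a))) (at s)"
      by (rule has_derivative_compose[of "\<lambda>s. p + s *\<^sub>R a" "\<lambda>h. h *\<^sub>R a" s UNIV g])
        (use has_derivative_frechet[OF gd] in \<open>auto intro!: derivative_eq_intros\<close>)
    then show ?thesis
      unfolding has_field_derivative_def
      by (rule has_derivative_eq_rhs) (simp add: fun_eq_iff linear_scale[OF linear_frechet_derivative[OF gd]])
  qed
  obtain e where e: "e > 0" "ball x e \<subseteq> S" using S openE by blast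
  have step: "\<exists>s t. 0 \<le> s \<and> s \<le> h \<and> 0 \<le> t \<and> t \<le> h \<and>
      f (x + h *\<^sub>R a + h *\<^sub>R b) - f (x + h *\<^sub>R a) - f (x + h *\<^sub>R b) + f x =
      h * h * frechet_derivative (D a) (at (x + s *\<^sub>R a + t *\<^sub>R b)) b"
    if h: "h > 0" "h * (norm a + norm b) < e" for h a b
  proof -
    have inS: "x + s *\<^sub>R a + t *\<^sub>R b \<in> S" if "0 \<le> s" "s \<le> h" "0 \<le> t" "t \<le> h" for s t
    proof -
      have "norm (s *\<^sub>R a + t *\<^sub>R b) \<le> s * norm a + t * norm b"
        using that by (metis abs_of_nonneg norm_scaleR norm_triangle_ineq)
      also have "\<dots> \<le> h * norm a + h * norm b" using that by (intro add_mono mult_right_mono) auto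
      finally have "norm (s *\<^sub>R a + t *\<^sub>R b) < e" using h by (simp add: algebra_simps)
      then show ?thesis using e by (auto simp: subset_iff dist_norm add.assoc norm_minus_commute)
    qed
    \<comment> \<open>Increment of \<open>f\<close> across the edge \<open>h b\<close>. Its change
      from \<open>0\<close> to \<open>h\<close> is the second difference, so the first mean value
      theorem differentiates along \<open>a\<close> and the second along \<open>b\<close>.\<close>
    define \<phi> where "\<phi> s = f ((x + h *\<^sub>R b) + s *\<^sub>R a) - f (x + s *\<^sub>R a)" for s
    have \<phi>': "(\<phi> has_real_derivative D a ((x + h *\<^sub>R b) + s *\<^sub>R a) - D a (x + s *\<^sub>R a)) (at s)"
      if "0 \<le> s" "s \<le> h" for s
      unfolding \<phi>_def D_def
    proof (intro DERIV_diff der[OF f])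
      have eq: "x + h *\<^sub>R b + s *\<^sub>R a = x + s *\<^sub>R a + h *\<^sub>R b" by (simp add: add.commute add.left_commute)
      show "x + h *\<^sub>R b + s *\<^sub>R a \<in> S" unfolding eq using that h(1) by (intro inS) simp_all
      show "x + s *\<^sub>R a \<in> S" using inS[of s 0] that h(1) by simp
    qed
    then obtain s where s: "0 < s" "s < h" "\<phi> h - \<phi> 0 = (h - 0) * (D a ((x + h *\<^sub>R b) + s *\<^sub>R a) - D a (x + s *\<^sub>R a))"
      using MVT2[OF h(1) \<phi>'] by blast
    have D': "((\<lambda>t. D a ((x + s *\<^sub>R a) + t *\<^sub>R b)) has_real_derivative
        frechet_derivative (D a) (at ((x + s *\<^sub>R a) + t *\<^sub>R b)) b) (at t)"
      if "0 \<le> t" "t \<le> h" for t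
      using inS[of s t] that s by (intro der[OF Dsm]) auto
    then obtain t where t: "0 < t" "t < h"
      "D a ((x + s *\<^sub>R a) + h *\<^sub>R b) - D a ((x + s *\<^sub>R a) + 0 *\<^sub>R b) = (h - 0) * frechet_derivative (D a) (at ((x + s *\<^sub>R a) + t *\<^sub>R b)) b"
      using MVT2[OF h(1) D'] by blast
    have "f (x + h *\<^sub>R a + h *\<^sub>R b) - f (x + h *\<^sub>R a) - f (x + h *\<^sub>R b) + f x = \<phi> h - \<phi> 0"
      by (simp add: \<phi>_def algebra_simps)
    also have "\<dots> = h * h * frechet_derivative (D a) (at (x + s *\<^sub>R a + t *\<^sub>R b)) b"
      using s(3) t(3) by (simp add: algebra_simps)
    finally show ?thesis using s t by (intro exI[of _ s] exI[of _ t]) auto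
  qed
  define P where "P = frechet_derivative (D v) (at x) w"
  define Q where "Q = frechet_derivative (D w) (at x) v"
  have "P = Q"
  proof (rule ccontr)
    assume "P \<noteq> Q"
    \<comment> \<open>Half of the gap: one common value cannot lie within \<open>\<delta>\<close> of
      both \<open>P\<close> and \<open>Q\<close>.\<close>
    define \<delta> where "\<delta> = \<bar>P - Q\<bar> / 2"
    have \<delta>: "\<delta> > 0" using \<open>P \<noteq> Q\<close> by (simp add: \<delta>_def)
    have "isCont (\<lambda>y. frechet_derivative (D v) (at y) w) x" "isCont (\<lambda>y. frechet_derivative (D w) (at y) v) x"
      using smooth_on_imp_continuous_on[OF smooth_on_frechet_derivative[OF Dsm]] S
      by (simp_all add: continuous_on_eq_continuous_at)
    then have "\<exists>d>0. \<forall>y. dist y x < d \<longrightarrow> dist (frechet_derivative (D v) (at y) w) P < \<delta>"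
      "\<exists>d>0. \<forall>y. dist y x < d \<longrightarrow> dist (frechet_derivative (D w) (at y) v) Q < \<delta>"
      using \<delta> by (simp_all add: continuous_at_eps_delta P_def Q_def)
    then obtain d1 d2 where d: "d1 > 0" "d2 > 0"
      "\<And>y. dist y x < d1 \<Longrightarrow> dist (frechet_derivative (D v) (at y) w) P < \<delta>"
      "\<And>y. dist y x < d2 \<Longrightarrow> dist (frechet_derivative (D w) (at y) v) Q < \<delta>"
      by auto
    define m where "m = min e (min d1 d2)"
    \<comment> \<open>Keeps every sampling point within \<open>m\<close> of \<open>x\<close>; the
      \<open>1\<close> covers \<open>v = w = 0\<close>, and the factor \<open>2\<close> makes the
      bound strict.\<close>
    define h where "h = m / (2 * (norm v + norm w + 1))"
    have m: "m > 0" using d e by (simp add: m_def)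
    have pos: "2 * (norm v + norm w + 1) > 0" by (smt (verit) norm_ge_zero)
    have h: "h > 0" using m pos by (simp add: h_def)
    have "h * (norm v + norm w) \<le> h * (norm v + norm w + 1)" using h by simp
    also have "\<dots> = m / 2" using pos by (simp add: h_def field_simps)
    also have "\<dots> < m" using m by simp
    finally have hm: "h * (norm v + norm w) < m" .
    have near: "dist (x + s *\<^sub>R a + t *\<^sub>R b) x < m"
      if "0 \<le> s" "s \<le> h" "0 \<le> t" "t \<le> h" "h * (norm a + norm b) < m" for s t a b
    proof -
      have "dist (x + s *\<^sub>R a + t *\<^sub>R b) x = norm (s *\<^sub>R a + t *\<^sub>R b)" by (simp add: dist_norm add.assoc)
      also have "\<dots> \<le> s * norm a + t * norm b"
        using that by (metis abs_of_nonneg norm_scaleR norm_triangle_ineq)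
      also have "\<dots> \<le> h * norm a + h * norm b" using that by (intro add_mono mult_right_mono) auto
      finally show ?thesis using that by (simp add: algebra_simps)
    qed
    have hm': "h * (norm w + norm v) < m" using hm by (simp add: add.commute)
    obtain s t where st: "0 \<le> s" "s \<le> h" "0 \<le> t" "t \<le> h"
      "f (x + h *\<^sub>R v + h *\<^sub>R w) - f (x + h *\<^sub>R v) - f (x + h *\<^sub>R w) + f x =
      h * h * frechet_derivative (D v) (at (x + s *\<^sub>R v + t *\<^sub>R w)) w"
      using step[OF h, of v w] hm by (auto simp: m_def)
    obtain s' t' where st': "0 \<le> s'" "s' \<le> h" "0 \<le> t'" "t' \<le> h"
      "f (x + h *\<^sub>R w + h *\<^sub>R v) - f (x + h *\<^sub>R w) - f (x + h *\<^sub>R v) + f x =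
      h * h * frechet_derivative (D w) (at (x + s' *\<^sub>R w + t' *\<^sub>R v)) v"
      using step[OF h, of w v] hm' by (auto simp: m_def)
    have "f (x + h *\<^sub>R w + h *\<^sub>R v) = f (x + h *\<^sub>R v + h *\<^sub>R w)" by (simp add: algebra_simps)
    then have "h * h * frechet_derivative (D v) (at (x + s *\<^sub>R v + t *\<^sub>R w)) w =
      h * h * frechet_derivative (D w) (at (x + s' *\<^sub>R w + t' *\<^sub>R v)) v"
      using st(5) st'(5) by linarith
    then have eq: "frechet_derivative (D v) (at (x + s *\<^sub>R v + t *\<^sub>R w)) w =
       frechet_derivative (D w) (at (x + s' *\<^sub>R w + t' *\<^sub>R v)) v"
      using h by simp
    have "dist (frechet_derivative (D v) (at (x + s *\<^sub>R v + t *\<^sub>R w)) w) P < \<delta>"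
      using near[OF st(1-4) hm] by (intro d) (simp add: m_def)
    moreover have "dist (frechet_derivative (D w) (at (x + s' *\<^sub>R w + t' *\<^sub>R v)) v) Q < \<delta>"
      using near[OF st'(1-4) hm'] by (intro d) (simp add: m_def)
    ultimately have "\<bar>P - Q\<bar> < 2 * \<delta>" using eq by (simp add: dist_real_def)
    then show False by (simp add: \<delta>_def)
  qed
  moreover have "D a = (\<lambda>y. frechet_derivative f (at y) a)" for a
    by (simp add: D_def fun_eq_iff)
  ultimately show ?thesis by (simp add: P_def Q_def)
qed

lemma second_derivative_symmetric:
  fixes f :: "'a::real_normed_vector \<Rightarrow> 'b::euclidean_space"
  assumes S: "open S" "x \<in> S" and f: "smooth_on f S"
  shows "frechet_derivative (\<lambda>y. frechet_derivative f (at y) v) (at x) w =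
         frechet_derivative (\<lambda>y. frechet_derivative f (at y) w) (at x) v"
proof (rule euclidean_eqI)
  fix b :: 'b
  assume b: "b \<in> Basis"
  have in1: "frechet_derivative (\<lambda>y. g y \<bullet> b) (at y) v = frechet_derivative g (at y) v \<bullet> b"
    if "smooth_on g S" "y \<in> S" for g y v
    by (rule frechet_derivative_eqI)
      (intro has_derivative_inner_left has_derivative_frechet smooth_on_imp_differentiable[OF that])
  have in2: "frechet_derivative (\<lambda>y. frechet_derivative f (at y) v) (at x) w \<bullet> b =
      frechet_derivative (\<lambda>y. frechet_derivative (\<lambda>y. f y \<bullet> b) (at y) v) (at x) w" for v w
  proof -
    have "frechet_derivative (\<lambda>y. frechet_derivative f (at y) v) (at x) w \<bullet> b =
      frechet_derivative (\<lambda>y. frechet_derivative f (at y) v \<bullet> b) (at x) w"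
      using in1[OF smooth_on_frechet_derivative[OF f] S(2)] by simp
    also have "\<dots> = frechet_derivative (\<lambda>y. frechet_derivative (\<lambda>y. f y \<bullet> b) (at y) v) (at x) w"
      by (rule fun_cong[OF frechet_derivative_cong_open[OF S]]) (simp add: in1[OF f])
    finally show ?thesis .
  qed
  have "smooth_on (\<lambda>y. f y \<bullet> b) S"
    by (intro smooth_on_inner S f smooth_on_const)
  then show "frechet_derivative (\<lambda>y. frechet_derivative f (at y) v) (at x) w \<bullet> b =
      frechet_derivative (\<lambda>y. frechet_derivative f (at y) w) (at x) v \<bullet> b"
    unfolding in2 by (rule second_derivative_symmetric_real[OF S])
qed


section \<open>Leibniz rules for families of linear and bilinear maps\<close>

lemma linear_frechet_param:
  fixes L :: "'a::real_normed_vector \<Rightarrow> 'b::real_vector \<Rightarrow> 'c::real_normed_vector"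
  assumes "open S" "x \<in> S" "\<And>y. y \<in> S \<Longrightarrow> linear (L y)" "\<And>v. (\<lambda>y. L y v) differentiable (at x)"
  shows "linear (\<lambda>v. frechet_derivative (\<lambda>y. L y v) (at x) h)"
proof (rule linearI)
  fix a b :: 'b and r :: real
  have "((\<lambda>y. L y (a + b)) has_derivative
      (\<lambda>h. frechet_derivative (\<lambda>y. L y a) (at x) h + frechet_derivative (\<lambda>y. L y b) (at x) h)) (at x)"
    by (rule has_derivative_transform_within_open[OF has_derivative_add[OF has_derivative_frechet[OF assms(4)]
          has_derivative_frechet[OF assms(4)]] assms(1,2)])
      (simp add: linear_add[OF assms(3)])
  then show "frechet_derivative (\<lambda>y. L y (a + b)) (at x) h =
      frechet_derivative (\<lambda>y. L y a) (at x) h + frechet_derivative (\<lambda>y. L y b) (at x) h"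
    by (rule frechet_derivative_eqI)
  have "((\<lambda>y. L y (r *\<^sub>R a)) has_derivative (\<lambda>h. r *\<^sub>R frechet_derivative (\<lambda>y. L y a) (at x) h)) (at x)"
    by (rule has_derivative_transform_within_open[OF has_derivative_scaleR_right[OF
            has_derivative_frechet[OF assms(4)]] assms(1,2)])
      (simp add: linear_scale[OF assms(3)])
  then show "frechet_derivative (\<lambda>y. L y (r *\<^sub>R a)) (at x) h = r *\<^sub>R frechet_derivative (\<lambda>y. L y a) (at x) h"
    by (rule frechet_derivative_eqI)
qed

text \<open>Leibniz rule with the argument frozen in the first term: the total derivative splits
  into the variation of \<open>L\<close> on a constant vector and the variation of the vector, both
  of which are accessible.\<close>

lemma has_derivative_linear_app:
  fixes L :: "'a::real_normed_vector \<Rightarrow> 'b::euclidean_space \<Rightarrow> 'c::real_normed_vector"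
  assumes "open S" "x \<in> S" "\<And>y. y \<in> S \<Longrightarrow> linear (L y)" "\<And>v. (\<lambda>y. L y v) differentiable (at x)"
    and a: "(a has_derivative a') (at x)"
  shows "((\<lambda>y. L y (a y)) has_derivative
     (\<lambda>h. frechet_derivative (\<lambda>y. L y (a x)) (at x) h + L x (a' h))) (at x)"
proof -
  have "((\<lambda>y. \<Sum>b\<in>Basis. (a y \<bullet> b) *\<^sub>R L y b) has_derivative
      (\<lambda>h. \<Sum>b\<in>Basis. (a x \<bullet> b) *\<^sub>R frechet_derivative (\<lambda>y. L y b) (at x) h + (a' h \<bullet> b) *\<^sub>R L x b)) (at x)"
    by (intro has_derivative_sum has_derivative_scaleR has_derivative_inner_left a
        has_derivative_frechet[OF assms(4)])
  moreover have "(\<Sum>b\<in>Basis. (a x \<bullet> b) *\<^sub>R frechet_derivative (\<lambda>y. L y b) (at x) h + (a' h \<bullet> b) *\<^sub>R L x b)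
      = frechet_derivative (\<lambda>y. L y (a x)) (at x) h + L x (a' h)" for h
    using linear_expand_Basis[OF linear_frechet_param[OF assms(1-4)], of "a x" h]
      linear_expand_Basis[OF assms(3)[OF assms(2)], of "a' h"] by (simp add: sum.distrib)
  ultimately have "((\<lambda>y. \<Sum>b\<in>Basis. (a y \<bullet> b) *\<^sub>R L y b) has_derivative
      (\<lambda>h. frechet_derivative (\<lambda>y. L y (a x)) (at x) h + L x (a' h))) (at x)" by simp
  then show ?thesis
    by (rule has_derivative_transform_within_open[OF _ assms(1,2)]) (metis assms(3) linear_expand_Basis)
qed

lemma has_derivative_bilinear_app:
  fixes B :: "'a::real_normed_vector \<Rightarrow> 'b::euclidean_space \<Rightarrow> 'b \<Rightarrow> 'c::real_normed_vector"
  assumes "open S" "x \<in> S" "\<And>y. y \<in> S \<Longrightarrow> bilinear (B y)" "\<And>v w. (\<lambda>y. B y v w) differentiable (at x)"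
    and a: "(a has_derivative a') (at x)" and b: "(b has_derivative b') (at x)"
  shows "((\<lambda>y. B y (a y) (b y)) has_derivative
     (\<lambda>h. frechet_derivative (\<lambda>y. B y (a x) (b x)) (at x) h + B x (a' h) (b x) + B x (a x) (b' h))) (at x)"
proof -
  have lin1: "linear (\<lambda>w. B y v w)" and lin2: "linear (\<lambda>v. B y v w)" if "y \<in> S" for y v w
    using assms(3)[OF that] by (simp_all add: bilinear_def)
  have 1: "((\<lambda>y. B y v (b y)) has_derivative
     (\<lambda>h. frechet_derivative (\<lambda>y. B y v (b x)) (at x) h + B x v (b' h))) (at x)" for v
    by (rule has_derivative_linear_app[where L = "\<lambda>y w. B y v w", OF assms(1,2) lin1 assms(4) b])
  then have 2: "(\<lambda>y. B y v (b y)) differentiable (at x)" for v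
    by (auto simp: differentiable_def)
  have "((\<lambda>y. B y (a y) (b y)) has_derivative
     (\<lambda>h. frechet_derivative (\<lambda>y. B y (a x) (b y)) (at x) h + B x (a' h) (b x))) (at x)"
    by (rule has_derivative_linear_app[where L = "\<lambda>y v. B y v (b y)", OF assms(1,2) lin2 2 a])
  then show ?thesis
    by (rule has_derivative_eq_rhs) (simp add: frechet_derivative_eqI[OF 1] fun_eq_iff)
qed

section \<open>Integrability in coordinates\<close>

lemma nijenhuis_eq:
  assumes "linear (J x)"
  shows "nijenhuis J x u v =
    frechet_derivative (\<lambda>y. J y v) (at x) (J x u) - frechet_derivative (\<lambda>y. J y u) (at x) (J x v)
    + J x (frechet_derivative (\<lambda>y. J y u) (at x) v) - J x (frechet_derivative (\<lambda>y. J y v) (at x) u)"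
  by (simp add: nijenhuis_def lie_bracket_def frechet_derivative_const linear_neg[OF assms]
      linear_diff[OF assms])

lemma nijenhuis_cong:
  assumes "open S" "x \<in> S" "\<And>y v. y \<in> S \<Longrightarrow> J y v = J' y v"
  shows "nijenhuis J x u v = nijenhuis J' x u v"
proof -
  have "frechet_derivative (\<lambda>y. J y v) (at x) = frechet_derivative (\<lambda>y. J' y v) (at x)" for v
    using assms by (intro frechet_derivative_cong_open) auto
  then show ?thesis using assms by (simp add: nijenhuis_def lie_bracket_def)
qed

lemma continuous_on_nijenhuis:
  assumes "open S" "\<And>y. y \<in> S \<Longrightarrow> linear (J y)" "\<And>v. smooth_on (\<lambda>y. J y v) S"
  shows "continuous_on S (\<lambda>x. nijenhuis J x u v)"
proof -
  have d: "smooth_on (\<lambda>x. frechet_derivative (\<lambda>y. J y v) (at x) (a x)) S" if "smooth_on a S" for v a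
    by (rule smooth_on_linear_app[where L = "\<lambda>x. frechet_derivative (\<lambda>y. J y v) (at x)", OF assms(1) _ _ that])
      (blast intro: linear_frechet_derivative smooth_on_frechet_derivative smooth_on_imp_differentiable assms(3))+
  have s: "smooth_on (\<lambda>x. J x (a x)) S" if "smooth_on a S" for a
    using assms(2,3) by (rule smooth_on_linear_app[where L = J, OF assms(1) _ _ that])
  have d2: "smooth_on (\<lambda>x. J x (frechet_derivative (\<lambda>y. J y v) (at x) u)) S" for u v
    by (rule s[OF smooth_on_frechet_derivative[OF assms(3)]])
  have d1: "smooth_on (\<lambda>x. frechet_derivative (\<lambda>y. J y v) (at x) (J x u)) S" for u v
    by (rule d[OF assms(3)])
  have "smooth_on (\<lambda>x. frechet_derivative (\<lambda>y. J y v) (at x) (J x u) - frechet_derivative (\<lambda>y. J y u) (at x) (J x v)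
    + J x (frechet_derivative (\<lambda>y. J y u) (at x) v) - J x (frechet_derivative (\<lambda>y. J y v) (at x) u)) S"
    by (rule smooth_on_diff[OF assms(1) smooth_on_add[OF assms(1) smooth_on_diff[OF assms(1) d1 d1] d2] d2])
  then have "smooth_on (\<lambda>x. nijenhuis J x u v) S"
    by (rule smooth_on_cong[OF assms(1), rotated]) (simp add: nijenhuis_eq assms(2))
  then show ?thesis by (rule smooth_on_imp_continuous_on)
qed

text \<open>Differentiating \<open>J J = - 1\<close> shows that every directional derivative of
  \<open>J\<close> anticommutes with \<open>J\<close>.\<close>

lemma frechet_square_minus_one:
  fixes J :: "'e::euclidean_space \<Rightarrow> 'e \<Rightarrow> 'e"
  assumes "open S" "x \<in> S" "\<And>y. y \<in> S \<Longrightarrow> linear (J y)" "\<And>v. (\<lambda>y. J y v) differentiable (at x)"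
    "\<And>y v. y \<in> S \<Longrightarrow> J y (J y v) = - v"
  shows "frechet_derivative (\<lambda>y. J y (J x v)) (at x) h = - J x (frechet_derivative (\<lambda>y. J y v) (at x) h)"
proof -
  have "((\<lambda>y. J y (J y v)) has_derivative
     (\<lambda>h. frechet_derivative (\<lambda>y. J y (J x v)) (at x) h + J x (frechet_derivative (\<lambda>y. J y v) (at x) h))) (at x)"
    using assms(4) by (intro has_derivative_linear_app[OF assms(1-4)] has_derivative_frechet)
  moreover have "((\<lambda>y. J y (J y v)) has_derivative (\<lambda>h. 0)) (at x)"
    by (rule has_derivative_transform_within_open[OF has_derivative_const[of "- v"] assms(1,2)])
      (simp add: assms(5))
  ultimately have "frechet_derivative (\<lambda>y. J y (J x v)) (at x) h + J x (frechet_derivative (\<lambda>y. J y v) (at x) h) = 0"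
    by (rule has_derivative_unique[THEN fun_cong])
  then show ?thesis by (simp add: eq_neg_iff_add_eq_0)
qed

lemma nijenhuis_skew: "nijenhuis J x u v = - nijenhuis J x v u" if "linear (J x)"
  using that by (simp add: nijenhuis_eq)

text \<open>Comes from the anticommutation of \<open>J\<close> with its derivatives. It reduces the
  vanishing of the Nijenhuis tensor to vectors that span the space together with their images under
  \<open>J\<close>.\<close>

lemma nijenhuis_J_left:
  fixes J :: "'e::euclidean_space \<Rightarrow> 'e \<Rightarrow> 'e"
  assumes "open S" "x \<in> S" "\<And>y. y \<in> S \<Longrightarrow> linear (J y)" "\<And>v. (\<lambda>y. J y v) differentiable (at x)"
    "\<And>y v. y \<in> S \<Longrightarrow> J y (J y v) = - v"
  shows "nijenhuis J x (J x u) v = - J x (nijenhuis J x u v)"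
proof -
  have lin: "linear (J x)" using assms by simp
  have lin': "linear (frechet_derivative (\<lambda>y. J y v) (at x))" for v
    by (rule linear_frechet_derivative[OF assms(4)])
  show ?thesis
    using assms(5)[OF assms(2)]
    by (simp add: nijenhuis_eq lin frechet_square_minus_one[OF assms] linear_neg[OF lin] linear_neg[OF lin']
        linear_add[OF lin] linear_diff[OF lin])
qed

lemma linear_nijenhuis_left:
  fixes J :: "'e::euclidean_space \<Rightarrow> 'e \<Rightarrow> 'e"
  assumes "open S" "x \<in> S" "\<And>y. y \<in> S \<Longrightarrow> linear (J y)" "\<And>v. (\<lambda>y. J y v) differentiable (at x)"
  shows "linear (\<lambda>u. nijenhuis J x u v)"
proof -
  have lin: "linear (J x)" using assms by simp
  have lin': "linear (frechet_derivative (\<lambda>y. J y v) (at x))" for v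
    by (rule linear_frechet_derivative[OF assms(4)])
  have lin'': "linear (\<lambda>v. frechet_derivative (\<lambda>y. J y v) (at x) h)" for h
    by (rule linear_frechet_param[OF assms])
  show ?thesis
    by (rule linearI) (simp_all add: nijenhuis_eq lin linear_add[OF lin] linear_add[OF lin'] linear_add[OF lin'']
        linear_scale[OF lin] linear_scale[OF lin'] linear_scale[OF lin''] algebra_simps)
qed

text \<open>Differentiating the relation \<open>tr\<close> expresses the derivatives of
  \<open>J'\<close> by those of \<open>J\<close> and by second derivatives of \<open>\<phi>\<close>.
  The latter are symmetric and therefore cancel in the skew expression of the Nijenhuis
  tensor.\<close>

lemma nijenhuis_naturality:
  fixes J J' :: "'e::euclidean_space \<Rightarrow> 'e \<Rightarrow> 'e" and \<phi> :: "'e \<Rightarrow> 'e"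
  assumes S: "open S" "x \<in> S" and \<phi>: "smooth_on \<phi> S" and S': "open S'" "\<And>y. y \<in> S \<Longrightarrow> \<phi> y \<in> S'"
    and J: "\<And>y. y \<in> S \<Longrightarrow> linear (J y)" "\<And>v. (\<lambda>y. J y v) differentiable (at x)"
    and J': "\<And>y. y \<in> S' \<Longrightarrow> linear (J' y)" "\<And>v. (\<lambda>y. J' y v) differentiable (at (\<phi> x))"
    and tr: "\<And>y v. y \<in> S \<Longrightarrow> J' (\<phi> y) (frechet_derivative \<phi> (at y) v) = frechet_derivative \<phi> (at y) (J y v)"
  shows "nijenhuis J' (\<phi> x) (frechet_derivative \<phi> (at x) u) (frechet_derivative \<phi> (at x) v) =
    frechet_derivative \<phi> (at x) (nijenhuis J x u v)"
proof -
  define \<phi>' where "\<phi>' = frechet_derivative \<phi> (at x)"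
  define \<phi>'' where "\<phi>'' h v = frechet_derivative (\<lambda>y. frechet_derivative \<phi> (at y) v) (at x) h" for h v
  define D where "D h v = frechet_derivative (\<lambda>y. J y v) (at x) h" for h v
  define D' where "D' h v = frechet_derivative (\<lambda>y. J' y v) (at (\<phi> x)) h" for h v
  have \<phi>d: "\<phi> differentiable (at y)" if "y \<in> S" for y
    using \<phi> that by (rule smooth_on_imp_differentiable)
  have lin\<phi>: "linear (frechet_derivative \<phi> (at y))" if "y \<in> S" for y
    using \<phi>d[OF that] by (rule linear_frechet_derivative)
  have lin': "linear \<phi>'" unfolding \<phi>'_def using lin\<phi> S by blast
  have \<phi>dd: "(\<lambda>y. frechet_derivative \<phi> (at y) v) differentiable (at x)" for v
    using smooth_on_imp_differentiable[OF smooth_on_frechet_derivative[OF \<phi>]] S by blast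
  have sym: "\<phi>'' h v = \<phi>'' v h" for h v
    unfolding \<phi>''_def by (rule second_derivative_symmetric[OF S \<phi>])
  have chain: "((\<lambda>y. J' (\<phi> y) v) has_derivative (\<lambda>h. D' (\<phi>' h) v)) (at x)" for v
    unfolding D'_def \<phi>'_def
    using has_derivative_compose[OF has_derivative_frechet[OF \<phi>d[OF S(2)]] has_derivative_frechet[OF J'(2)]] .
  have L: "((\<lambda>y. J' (\<phi> y) (frechet_derivative \<phi> (at y) v)) has_derivative
     (\<lambda>h. frechet_derivative (\<lambda>y. J' (\<phi> y) (frechet_derivative \<phi> (at x) v)) (at x) h
        + J' (\<phi> x) (frechet_derivative (\<lambda>y. frechet_derivative \<phi> (at y) v) (at x) h))) (at x)" for v
    using chain S' J' by (intro has_derivative_linear_app[where L = "\<lambda>y. J' (\<phi> y)", OF S] has_derivative_frechet \<phi>dd)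
      (auto simp: differentiable_def)
  have R: "((\<lambda>y. frechet_derivative \<phi> (at y) (J y v)) has_derivative
     (\<lambda>h. frechet_derivative (\<lambda>y. frechet_derivative \<phi> (at y) (J x v)) (at x) h
        + frechet_derivative \<phi> (at x) (frechet_derivative (\<lambda>y. J y v) (at x) h))) (at x)" for v
    by (intro has_derivative_linear_app[where L = "\<lambda>y. frechet_derivative \<phi> (at y)", OF S] has_derivative_frechet \<phi>dd lin\<phi> J)
  have "((\<lambda>y. J' (\<phi> y) (frechet_derivative \<phi> (at y) v)) has_derivative
     (\<lambda>h. frechet_derivative (\<lambda>y. frechet_derivative \<phi> (at y) (J x v)) (at x) h
        + frechet_derivative \<phi> (at x) (frechet_derivative (\<lambda>y. J y v) (at x) h))) (at x)" for v
    by (rule has_derivative_transform_within_open[OF R S]) (simp add: tr)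
  from has_derivative_unique[OF L this]
  have eq: "D' (\<phi>' h) (\<phi>' v) + J' (\<phi> x) (\<phi>'' h v) = \<phi>'' h (J x v) + \<phi>' (D h v)" for h v
    unfolding frechet_derivative_eqI[OF chain]
    by (simp add: D_def \<phi>''_def fun_eq_iff flip: \<phi>'_def)
  have eq': "D' (\<phi>' h) (\<phi>' v) = \<phi>'' h (J x v) + \<phi>' (D h v) - J' (\<phi> x) (\<phi>'' h v)" for h v
    using eq[of h v] by (simp add: eq_diff_eq)
  have linJ': "linear (J' (\<phi> x))" using J' S' S by blast
  have tr': "J' (\<phi> x) (\<phi>' v) = \<phi>' (J x v)" for v
    unfolding \<phi>'_def by (rule tr[OF S(2)])
  have "nijenhuis J' (\<phi> x) (\<phi>' u) (\<phi>' v) =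
     D' (\<phi>' (J x u)) (\<phi>' v) - D' (\<phi>' (J x v)) (\<phi>' u) + J' (\<phi> x) (D' (\<phi>' v) (\<phi>' u)) - J' (\<phi> x) (D' (\<phi>' u) (\<phi>' v))"
    by (simp add: nijenhuis_eq[of J' "\<phi> x", OF linJ'] D'_def tr')
  also have "\<dots> = \<phi>' (nijenhuis J x u v)"
    unfolding eq' nijenhuis_eq[of J x, OF J(1)[OF S(2)]]
    using sym[of "J x u" "J x v"] sym[of "J x u" v] sym[of "J x v" u] sym[of u v]
    by (simp add: D_def[symmetric] linear_add[OF lin'] linear_diff[OF lin'] linear_add[OF linJ'] linear_diff[OF linJ'] tr')
  finally show ?thesis by (simp add: \<phi>'_def)
qed

section \<open>Torsion forms and their closedness\<close>

text \<open>In terms of types, the hypothesis says that \<open>\<omega>\<close> is the (1,1)-part of the closed form \<open>F\<close>. The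
  right-hand side is the differential of \<open>F\<^sup>2\<^sup>,\<^sup>0 + F\<^sup>0\<^sup>,\<^sup>2\<close> composed with \<open>J\<close>, and \<open>dF = 0\<close> turns
  \<open>d\<^sup>c\<close> of the former into \<open>d\<close> of the latter.\<close>

lemma dc2_invariant_part:
  fixes J :: "'e::euclidean_space \<Rightarrow> 'e \<Rightarrow> 'e" and F :: "'e \<Rightarrow> 'e \<Rightarrow> 'e \<Rightarrow> real"
  assumes S: "open S" "x \<in> S"
    and J: "\<And>y. y \<in> S \<Longrightarrow> linear (J y)" "\<And>v. (\<lambda>y. J y v) differentiable (at x)"
      "\<And>y v. y \<in> S \<Longrightarrow> J y (J y v) = - v" "\<And>u v. nijenhuis J x u v = 0"
    and F: "\<And>y. y \<in> S \<Longrightarrow> bilinear (F y)" "\<And>v w. (\<lambda>y. F y v w) differentiable (at x)"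
      "\<And>y v w. y \<in> S \<Longrightarrow> F y v w = - F y w v" "\<And>u v w. ext_d2 F x u v w = 0"
    and \<omega>: "\<And>y v w. y \<in> S \<Longrightarrow> \<omega> y v w = (F y v w + F y (J y v) (J y w)) / 2"
  shows "dc2 J \<omega> x u v w = ext_d2 (\<lambda>y a b. (F y a (J y b) + F y (J y a) b) / 2) x u v w"
proof -
  define D where "D h v = frechet_derivative (\<lambda>y. J y v) (at x) h" for h v
  define E where "E h v w = frechet_derivative (\<lambda>y. F y v w) (at x) h" for h v w
  let ?J = "J x" and ?F = "F x"
  have linJ: "linear ?J" and JJ: "?J (?J v) = - v" for v
    using J(1)[OF S(2)] J(3)[OF S(2)] by simp_all
  have Fl: "bilinear ?F" and skew: "?F v w = - ?F w v" for v w
    by (rule F(1)[OF S(2)], rule F(3)[OF S(2)])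
  have Eskew: "E h v w = - E h w v" for h v w
    unfolding E_def
  proof (rule frechet_derivative_eqI)
    show "((\<lambda>y. F y v w) has_derivative (\<lambda>h. - frechet_derivative (\<lambda>y. F y w v) (at x) h)) (at x)"
      by (rule has_derivative_transform_within_open[OF has_derivative_minus[OF has_derivative_frechet[OF F(2)]] S])
        (rule F(3)[symmetric])
  qed
  have linE: "linear (\<lambda>v. E h v w)" "linear (\<lambda>w. E h v w)" for h v w
    unfolding E_def using F(1)
    by (intro linear_frechet_param[OF S, where L = "\<lambda>y v. F y v w"] linear_frechet_param[OF S, where L = "\<lambda>y w. F y v w"] F(2);
        simp add: bilinear_def)+
  have DJ: "D h (?J v) = - ?J (D h v)" for h v
    unfolding D_def by (rule frechet_square_minus_one[OF S J(1-3)])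
  have Jd: "((\<lambda>y. J y v) has_derivative (\<lambda>h. D h v)) (at x)" for v
    unfolding D_def by (rule has_derivative_frechet[OF J(2)])
  have dF: "((\<lambda>y. F y v w) has_derivative (\<lambda>h. E h v w)) (at x)" for v w
    unfolding E_def by (rule has_derivative_frechet[OF F(2)])
  have dFJJ: "((\<lambda>y. F y (J y v) (J y w)) has_derivative
      (\<lambda>h. E h (?J v) (?J w) + ?F (D h v) (?J w) + ?F (?J v) (D h w))) (at x)" for v w
    unfolding E_def by (rule has_derivative_bilinear_app[OF S F(1,2) Jd Jd])
  have dFJ1: "((\<lambda>y. F y v (J y w)) has_derivative
      (\<lambda>h. E h v (?J w) + ?F 0 (?J w) + ?F v (D h w))) (at x)" for v w
    unfolding E_def by (rule has_derivative_bilinear_app[OF S F(1,2) has_derivative_const Jd])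
  have dFJ2: "((\<lambda>y. F y (J y v) w) has_derivative
      (\<lambda>h. E h (?J v) w + ?F (D h v) w + ?F (?J v) 0)) (at x)" for v w
    unfolding E_def by (rule has_derivative_bilinear_app[OF S F(1,2) Jd has_derivative_const])
  have half: "((\<lambda>y. (f y + g y) / 2) has_derivative (\<lambda>h. (f' h + g' h) / 2)) (at x)"
    if "(f has_derivative f') (at x)" "(g has_derivative g') (at x)" for f g :: "'e \<Rightarrow> real" and f' g'
    using that by (auto intro!: derivative_eq_intros)
  have "((\<lambda>y. \<omega> y (J y v) (J y w)) has_derivative
      (\<lambda>h. (E h v w + (E h (?J v) (?J w) + ?F (D h v) (?J w) + ?F (?J v) (D h w))) / 2)) (at x)" for v w
  proof (rule has_derivative_transform_within_open[OF half[OF dF dFJJ] S])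
    show "(F y v w + F y (J y v) (J y w)) / 2 = \<omega> y (J y v) (J y w)" if "y \<in> S" for y
      using that F(1)[OF that] by (simp add: \<omega> J bilinear_lneg bilinear_rneg)
  qed
  then have lhs: "frechet_derivative (\<lambda>y. \<omega> y (J y v) (J y w)) (at x) h =
      (E h v w + (E h (?J v) (?J w) + ?F (D h v) (?J w) + ?F (?J v) (D h w))) / 2" for h v w
    by (rule frechet_derivative_eqI)
  have rhs: "frechet_derivative (\<lambda>y. (F y v (J y w) + F y (J y v) w) / 2) (at x) h =
      (E h v (?J w) + ?F v (D h w) + (E h (?J v) w + ?F (D h v) w)) / 2" for h v w
    using frechet_derivative_eqI[OF half[OF dFJ1 dFJ2]] by (simp add: bilinear_lzero[OF Fl] bilinear_rzero[OF Fl])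
  have cl: "E u v w - E v u w + E w u v = 0" for u v w
    using F(4)[of u v w] by (simp add: ext_d2_def E_def)
  \<comment> \<open>The vanishing Nijenhuis tensor composed with \<open>J\<close>. In this form it
    trades the derivatives of \<open>J\<close> along \<open>J u\<close> and \<open>J v\<close>,
    which occur in \<open>dc2\<close>, for derivatives along \<open>u\<close> and
    \<open>v\<close>.\<close>
  have N: "?J (D (?J u) v) - ?J (D (?J v) u) = D v u - D u v" for u v
  proof -
    have "D (?J u) v - D (?J v) u + ?J (D v u) - ?J (D u v) = 0"
      using J(4)[of u v] by (simp add: nijenhuis_eq[of J x, OF linJ] D_def)
    then have "?J (D (?J u) v - D (?J v) u + ?J (D v u) - ?J (D u v)) = 0"
      by (simp add: linear_0[OF linJ])
    then show ?thesis
      by (simp add: linear_add[OF linJ] linear_diff[OF linJ] JJ algebra_simps)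
  qed
  have NF: "?F (?J (D (?J u) v)) w - ?F (?J (D (?J v) u)) w = ?F (D v u) w - ?F (D u v) w" for u v w
    using arg_cong[OF N[of u v], of "\<lambda>z. ?F z w"] by (simp add: bilinear_lsub[OF Fl])
  note simps = linear_neg[OF linE(1)] linear_neg[OF linE(2)] bilinear_lneg[OF Fl] bilinear_rneg[OF Fl] JJ DJ
  have "2 * dc2 J \<omega> x u v w =
    - (E (?J u) (?J v) (?J w) + E (?J u) v w + ?F (?J (D (?J u) v)) w + ?F v (?J (D (?J u) w)))
    + (E (?J v) (?J u) (?J w) + E (?J v) u w + ?F (?J (D (?J v) u)) w + ?F u (?J (D (?J v) w)))
    - (E (?J w) (?J u) (?J v) + E (?J w) u v + ?F (?J (D (?J w) u)) v + ?F u (?J (D (?J w) v)))"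
    by (simp add: dc2_def ext_d2_def lhs simps add_divide_distrib)
  moreover have "2 * ext_d2 (\<lambda>y a b. (F y a (J y b) + F y (J y a) b) / 2) x u v w =
    (E u v (?J w) + ?F v (D u w) + (E u (?J v) w + ?F (D u v) w))
    - (E v u (?J w) + ?F u (D v w) + (E v (?J u) w + ?F (D v u) w))
    + (E w u (?J v) + ?F u (D w v) + (E w (?J u) v + ?F (D w u) v))"
    unfolding ext_d2_def rhs by (simp add: field_simps)
  moreover have "?F v (?J (D (?J u) w)) = - ?F (?J (D (?J u) w)) v" "?F u (?J (D (?J v) w)) = - ?F (?J (D (?J v) w)) u"
    "?F u (?J (D (?J w) v)) = - ?F (?J (D (?J w) v)) u" "?F v (D u w) = - ?F (D u w) v"
    "?F u (D v w) = - ?F (D v w) u" "?F u (D w v) = - ?F (D w v) u"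
    by (rule skew)+
  ultimately show ?thesis
    using NF[of u v w] NF[of v w u] NF[of w u v] cl[of "?J u" "?J v" "?J w"] cl[of "?J u" v w] cl[of u "?J v" w] cl[of u v "?J w"]
      Eskew[of v "?J u" w] Eskew[of u "?J v" w]  Eskew[of w u "?J v"]
    by linarith
qed

text \<open>The twelve second derivatives cancel in six symmetric pairs. Once the torsion is
  exhibited as a differential, its closedness follows from this.\<close>

lemma ext_d3_ext_d2:
  assumes S: "open S" "x \<in> S" and b: "\<And>v w. smooth_on (\<lambda>y. b y v w) S"
  shows "ext_d3 (ext_d2 b) x u v w z = 0"
proof -
  define D where "D h k v w = frechet_derivative (\<lambda>y. frechet_derivative (\<lambda>y. b y v w) (at y) k) (at x) h" for h k v w
  have sym: "D h k v w = D k h v w" for h k v w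
    unfolding D_def by (rule second_derivative_symmetric[OF S b])
  have "((\<lambda>y. ext_d2 b y v w z) has_derivative (\<lambda>h. D h v w z - D h w v z + D h z v w)) (at x)" for v w z
    unfolding ext_d2_def D_def
    using smooth_on_imp_differentiable[OF smooth_on_frechet_derivative[OF b] S(2)]
    by (intro has_derivative_add has_derivative_diff has_derivative_frechet)
  then have "frechet_derivative (\<lambda>y. ext_d2 b y v w z) (at x) h = D h v w z - D h w v z + D h z v w" for h v w z
    by (rule frechet_derivative_eqI)
  then show ?thesis
    using sym[of u v w z] sym[of u w v z] sym[of u z v w] sym[of v w u z] sym[of v z u w] sym[of w z u v]
    by (simp add: ext_d3_def)
qed

lemma ext_d2_cong:
  assumes "open S" "x \<in> S" "\<And>y v w. y \<in> S \<Longrightarrow> a y v w = b y v w"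
  shows "ext_d2 a x u v w = ext_d2 b x u v w"
proof -
  have "frechet_derivative (\<lambda>y. a y v w) (at x) = frechet_derivative (\<lambda>y. b y v w) (at x)" for v w
    using assms by (intro frechet_derivative_cong_open) auto
  then show ?thesis by (simp add: ext_d2_def)
qed

lemma ext_d3_cong:
  assumes "open S" "x \<in> S" "\<And>y u v w. y \<in> S \<Longrightarrow> a y u v w = b y u v w"
  shows "ext_d3 a x u v w z = ext_d3 b x u v w z"
proof -
  have "frechet_derivative (\<lambda>y. a y u v w) (at x) = frechet_derivative (\<lambda>y. b y u v w) (at x)" for u v w
    using assms by (intro frechet_derivative_cong_open) auto
  then show ?thesis by (simp add: ext_d3_def)
qed


section \<open>Charts and tensor fields\<close>

lemma inv_chart_image: "is_chart c \<Longrightarrow> p \<in> fst c \<Longrightarrow> inv_chart c (snd c p) = p"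
  unfolding is_chart_def homeomorphism_def by blast

lemma snd_inv_chart: "is_chart c \<Longrightarrow> x \<in> snd c ` fst c \<Longrightarrow> snd c (inv_chart c x) = x"
  unfolding is_chart_def homeomorphism_def by blast

lemma inv_chart_mem: "is_chart c \<Longrightarrow> x \<in> snd c ` fst c \<Longrightarrow> inv_chart c x \<in> fst c"
  using inv_chart_image by fastforce

lemma continuous_on_inv_chart: "is_chart c \<Longrightarrow> continuous_on (snd c ` fst c) (inv_chart c)"
  unfolding is_chart_def homeomorphism_def by blast

lemma continuous_on_chart: "is_chart c \<Longrightarrow> continuous_on (fst c) (snd c)"
  unfolding is_chart_def homeomorphism_def by blast

lemma open_chart_image:
  assumes "is_chart c" "open W"
  shows "open (snd c ` (fst c \<inter> W))"
proof -
  have "snd c ` (fst c \<inter> W) = snd c ` fst c \<inter> inv_chart c -` W"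
    using inv_chart_image[OF assms(1)] by force
  moreover have "open (snd c ` fst c \<inter> inv_chart c -` W)"
    using assms continuous_on_inv_chart[OF assms(1)]
    by (intro continuous_open_preimage) (auto simp: is_chart_def)
  ultimately show ?thesis by simp
qed

lemma open_chart_domain: "is_chart c \<Longrightarrow> open (fst c)"
  by (simp add: is_chart_def)

lemma local_rep_chart: "is_chart c \<Longrightarrow> p \<in> fst c \<Longrightarrow> local_rep c T (snd c p) = T c p"
  by (simp add: local_rep_def inv_chart_image)

lemma smooth_structure_chart: "smooth_structure \<A> \<Longrightarrow> c \<in> \<A> \<Longrightarrow> is_chart c"
  by (simp add: smooth_structure_def)

lemma smooth_structure_cover:
  assumes "smooth_structure \<A>"
  obtains c where "c \<in> \<A>" "p \<in> fst c"
proof -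
  have "p \<in> (\<Union>c\<in>\<A>. fst c)" using assms unfolding smooth_structure_def by blast
  then show ?thesis using that by blast
qed

lemma smooth_on_transition:
  "smooth_structure \<A> \<Longrightarrow> c \<in> \<A> \<Longrightarrow> d \<in> \<A> \<Longrightarrow> smooth_on (transition c d) (snd c ` (fst c \<inter> fst d))"
  by (simp add: smooth_structure_def compatible_def)

lemma transition_chart: "is_chart c \<Longrightarrow> p \<in> fst c \<Longrightarrow> transition c d (snd c p) = snd d p"
  by (simp add: transition_def inv_chart_image)

lemma open_overlap:
  assumes "smooth_structure \<A>" "c \<in> \<A>" "d \<in> \<A>"
  shows "open (snd c ` (fst c \<inter> fst d))"
  by (rule open_chart_image[OF smooth_structure_chart[OF assms(1,2)]
        open_chart_domain[OF smooth_structure_chart[OF assms(1,3)]]])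

lemma has_derivative_transition:
  assumes "smooth_structure \<A>" "c \<in> \<A>" "d \<in> \<A>" "p \<in> fst c" "p \<in> fst d"
  shows "(transition c d has_derivative (\<lambda>h. change c d p h)) (at (snd c p))"
  unfolding change_def
  using assms smooth_on_transition[OF assms(1-3)]
  by (intro has_derivative_frechet smooth_on_imp_differentiable) auto

lemma linear_change:
  assumes "smooth_structure \<A>" "c \<in> \<A>" "d \<in> \<A>" "p \<in> fst c" "p \<in> fst d"
  shows "linear (change c d p)"
  using has_derivative_transition[OF assms] has_derivative_linear by blast

lemma change_change:
  assumes "smooth_structure \<A>" "c \<in> \<A>" "d \<in> \<A>" "p \<in> fst c" "p \<in> fst d"
  shows "change d c p (change c d p v) = v"
proof -
  note ch = smooth_structure_chart[OF assms(1,2)]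
  have "((\<lambda>x. transition d c (transition c d x)) has_derivative (\<lambda>h. change d c p (change c d p h))) (at (snd c p))"
    using has_derivative_compose[OF has_derivative_transition[OF assms], of "transition d c" "change d c p"]
      has_derivative_transition[OF assms(1,3,2,5,4)] transition_chart[OF ch assms(4), of d] by simp
  moreover have "((\<lambda>x. transition d c (transition c d x)) has_derivative (\<lambda>h. h)) (at (snd c p))"
  proof (rule has_derivative_transform_within_open[OF has_derivative_ident open_overlap[OF assms(1-3)]])
    show "x = transition d c (transition c d x)" if "x \<in> snd c ` (fst c \<inter> fst d)" for x
      using that by (auto simp: transition_chart ch smooth_structure_chart[OF assms(1,3)])
  qed (use assms in auto)
  ultimately show ?thesis using has_derivative_unique[THEN fun_cong] by blast
qed

text \<open>The functions live on the coordinate image, whereas density is known in the manifold;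
  composing with the coordinate map makes the set of disagreement an open set of the manifold, which
  has to meet \<open>W\<close>.\<close>

lemma dense_eq:
  fixes f g :: "'e::euclidean_space \<Rightarrow> 'b::real_normed_vector"
  assumes c: "is_chart c" and W: "closure W = UNIV"
    and f: "continuous_on (snd c ` fst c) f" and g: "continuous_on (snd c ` fst c) g"
    and eq: "\<And>q. q \<in> fst c \<inter> W \<Longrightarrow> f (snd c q) = g (snd c q)" and p: "p \<in> fst c"
  shows "f (snd c p) = g (snd c p)"
proof (rule ccontr)
  assume ne: "f (snd c p) \<noteq> g (snd c p)"
  have "continuous_on (fst c) (\<lambda>q. f (snd c q) - g (snd c q))"
    using continuous_on_compose2[OF f continuous_on_chart[OF c]]
      continuous_on_compose2[OF g continuous_on_chart[OF c]] by (intro continuous_on_diff) auto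
  then have "open (fst c \<inter> (\<lambda>q. f (snd c q) - g (snd c q)) -` (- {0}))"
    using c by (intro continuous_open_preimage) (auto simp: is_chart_def)
  moreover have "p \<in> fst c \<inter> (\<lambda>q. f (snd c q) - g (snd c q)) -` (- {0})" using ne p by simp
  ultimately obtain q where "q \<in> W" "q \<in> fst c \<inter> (\<lambda>q. f (snd c q) - g (snd c q)) -` (- {0})"
    using open_Int_closure_eq_empty[of "fst c \<inter> (\<lambda>q. f (snd c q) - g (snd c q)) -` (- {0})" W] W by blast
  then show False using eq by auto
qed

lemma vector_fieldD:
  assumes "vector_field \<A> W X" "c \<in> \<A>"
  shows "smooth_on (local_rep c X) (snd c ` (fst c \<inter> W))"
    "d \<in> \<A> \<Longrightarrow> p \<in> fst c \<Longrightarrow> p \<in> fst d \<Longrightarrow> p \<in> W \<Longrightarrow> X d p = change c d p (X c p)"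
  using assms unfolding vector_field_def by blast+

lemma bilinear_fieldD:
  assumes "bilinear_field \<A> W B" "c \<in> \<A>"
  shows "p \<in> fst c \<Longrightarrow> p \<in> W \<Longrightarrow> bilinear (B c p)"
    "smooth_on (\<lambda>x. local_rep c B x v w) (snd c ` (fst c \<inter> W))"
    "d \<in> \<A> \<Longrightarrow> p \<in> fst c \<Longrightarrow> p \<in> fst d \<Longrightarrow> p \<in> W \<Longrightarrow> B d p (change c d p v) (change c d p w) = B c p v w"
  using assms unfolding bilinear_field_def by blast+

lemma endo_fieldD:
  assumes "endo_field \<A> W J" "c \<in> \<A>"
  shows "p \<in> fst c \<Longrightarrow> p \<in> W \<Longrightarrow> linear (J c p)"
    "smooth_on (\<lambda>x. local_rep c J x v) (snd c ` (fst c \<inter> W))"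
    "d \<in> \<A> \<Longrightarrow> p \<in> fst c \<Longrightarrow> p \<in> fst d \<Longrightarrow> p \<in> W \<Longrightarrow> J d p (change c d p v) = change c d p (J c p v)"
  using assms unfolding endo_field_def by blast+

lemma smooth_bilinear_field_app:
  assumes A: "smooth_structure \<A>" and B: "bilinear_field \<A> UNIV B" and c: "c \<in> \<A>"
    and fg: "smooth_on f (snd c ` fst c)" "smooth_on g (snd c ` fst c)"
  shows "smooth_on (\<lambda>x. local_rep c B x (f x) (g x)) (snd c ` fst c)"
proof -
  have ch: "is_chart c" using A c smooth_structure_chart by blast
  have op: "open (snd c ` fst c)" using open_chart_image[OF ch open_UNIV] by simp
  have "bilinear (local_rep c B y)" if "y \<in> snd c ` fst c" for y
    using that bilinear_fieldD(1)[OF B c] by (auto simp: local_rep_chart[OF ch])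
  moreover have "smooth_on (\<lambda>x. local_rep c B x v w) (snd c ` fst c)" for v w
    using bilinear_fieldD(2)[OF B c] by simp
  ultimately show ?thesis
    by (rule smooth_on_bilinear_app[where B = "local_rep c B", OF op _ _ fg])
qed

lemma smooth_endo_field_app:
  assumes A: "smooth_structure \<A>" and J: "endo_field \<A> UNIV J" and c: "c \<in> \<A>"
    and f: "smooth_on f (snd c ` fst c)"
  shows "smooth_on (\<lambda>x. local_rep c J x (f x)) (snd c ` fst c)"
proof -
  have ch: "is_chart c" using A c smooth_structure_chart by blast
  have op: "open (snd c ` fst c)" using open_chart_image[OF ch open_UNIV] by simp
  have "linear (local_rep c J y)" if "y \<in> snd c ` fst c" for y
    using that endo_fieldD(1)[OF J c] by (auto simp: local_rep_chart[OF ch])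
  moreover have "smooth_on (\<lambda>x. local_rep c J x v) (snd c ` fst c)" for v
    using endo_fieldD(2)[OF J c] by simp
  ultimately show ?thesis
    by (rule smooth_on_linear_app[where L = "local_rep c J", OF op _ _ f])
qed

lemma symplecticD:
  assumes "symplectic \<A> W F"
  shows "bilinear_field \<A> W F"
    "c \<in> \<A> \<Longrightarrow> p \<in> fst c \<Longrightarrow> p \<in> W \<Longrightarrow> F c p v w = - F c p w v"
    "c \<in> \<A> \<Longrightarrow> p \<in> fst c \<Longrightarrow> p \<in> W \<Longrightarrow> ext_d2 (local_rep c F) (snd c p) u v w = 0"
  using assms unfolding symplectic_def by blast+

lemma complex_structureD:
  assumes "complex_structure \<A> W J"
  shows "endo_field \<A> W J"
    "c \<in> \<A> \<Longrightarrow> p \<in> fst c \<Longrightarrow> p \<in> W \<Longrightarrow> J c p (J c p v) = - v"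
    "c \<in> \<A> \<Longrightarrow> p \<in> fst c \<Longrightarrow> p \<in> W \<Longrightarrow> nijenhuis (local_rep c J) (snd c p) u v = 0"
  using assms unfolding complex_structure_def by blast+

text \<open>Integrability is required in every chart of the atlas but computed in one toric chart
  around each point. Naturality under the transition map, whose differential is invertible, closes
  this gap.\<close>

lemma nijenhuis_transfer:
  assumes A: "smooth_structure \<A>" "open W" and J: "endo_field \<A> W J"
    and cd: "c \<in> \<A>" "d \<in> \<A>" "p \<in> fst c" "p \<in> fst d" "p \<in> W"
    and N: "\<And>u v. nijenhuis (local_rep d J) (snd d p) u v = 0"
  shows "nijenhuis (local_rep c J) (snd c p) u v = 0"
proof -
  note ch = smooth_structure_chart[OF A(1)]
  have chc: "is_chart c" and chd: "is_chart d" using ch cd by auto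
  let ?S = "snd c ` (fst c \<inter> (fst d \<inter> W))" and ?S' = "snd d ` (fst d \<inter> W)"
  have opS: "open ?S" using chc chd A(2) by (intro open_chart_image) (auto simp: is_chart_def)
  have opS': "open ?S'" using chd A(2) by (rule open_chart_image)
  have sub: "?S \<subseteq> snd c ` (fst c \<inter> W)" by blast
  have fr: "frechet_derivative (transition c d) (at (snd c q)) v = change c d q v" for q v
    by (simp add: change_def)
  have "nijenhuis (local_rep d J) (transition c d (snd c p)) (frechet_derivative (transition c d) (at (snd c p)) u)
      (frechet_derivative (transition c d) (at (snd c p)) v) =
    frechet_derivative (transition c d) (at (snd c p)) (nijenhuis (local_rep c J) (snd c p) u v)"
  proof (rule nijenhuis_naturality[OF opS _ _ opS'])
    show "snd c p \<in> ?S" using cd by blast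
    show "smooth_on (transition c d) ?S"
      by (rule smooth_on_subset[OF smooth_on_transition[OF A(1) cd(1,2)]]) blast
    show "transition c d y \<in> ?S'" if "y \<in> ?S" for y
      using that chc by (auto simp: transition_chart)
    show "linear (local_rep c J y)" if "y \<in> ?S" for y
      using that endo_fieldD(1)[OF J cd(1)] by (auto simp: local_rep_chart[OF chc])
    show "(\<lambda>y. local_rep c J y v) differentiable (at (snd c p))" for v
      using cd by (intro smooth_on_imp_differentiable[OF endo_fieldD(2)[OF J cd(1)]]) blast
    show "linear (local_rep d J y)" if "y \<in> ?S'" for y
      using that endo_fieldD(1)[OF J cd(2)] by (auto simp: local_rep_chart[OF chd])
    show "(\<lambda>y. local_rep d J y v) differentiable (at (transition c d (snd c p)))" for v
      unfolding transition_chart[OF chc cd(3)]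
      using cd by (intro smooth_on_imp_differentiable[OF endo_fieldD(2)[OF J cd(2)]]) blast
    show "local_rep d J (transition c d y) (frechet_derivative (transition c d) (at y) v) =
        frechet_derivative (transition c d) (at y) (local_rep c J y v)" if "y \<in> ?S" for y v
      using that endo_fieldD(3)[OF J cd(1,2)]
      by (auto simp: transition_chart[OF chc] local_rep_chart[OF chc] local_rep_chart[OF chd] fr)
  qed
  then have "change c d p (nijenhuis (local_rep c J) (snd c p) u v) = 0"
    unfolding fr transition_chart[OF chc cd(3)] N by simp
  then show ?thesis
    by (metis change_change[OF A(1) cd(1-4)] linear_0[OF linear_change[OF A(1) cd(2,1,4,3)]])
qed

lemma nijenhuis_extend:
  assumes A: "smooth_structure \<A>" "open W" "closure W = UNIV" and J': "endo_field \<A> UNIV J'"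
    and agree: "agree_on \<A> W J J'" and c: "c \<in> \<A>" "p \<in> fst c"
    and N: "\<And>q. q \<in> fst c \<inter> W \<Longrightarrow> nijenhuis (local_rep c J) (snd c q) u v = 0"
  shows "nijenhuis (local_rep c J') (snd c p) u v = 0"
proof -
  have ch: "is_chart c" using A c smooth_structure_chart by blast
  have op: "open (snd c ` fst c)" using open_chart_image[OF ch open_UNIV] by simp
  have "continuous_on (snd c ` fst c) (\<lambda>x. nijenhuis (local_rep c J') x u v)"
    using endo_fieldD[OF J' c(1)] by (intro continuous_on_nijenhuis op) (auto simp: local_rep_chart[OF ch])
  then show ?thesis
  proof (rule dense_eq[OF ch A(3) _ continuous_on_const _ c(2)])
    fix q assume q: "q \<in> fst c \<inter> W"
    have "nijenhuis (local_rep c J') (snd c q) u v = nijenhuis (local_rep c J) (snd c q) u v"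
      by (rule nijenhuis_cong[OF open_chart_image[OF ch A(2)]])
        (use q agree c in \<open>auto simp: agree_on_def local_rep_chart[OF ch]\<close>)
    then show "nijenhuis (local_rep c J') (snd c q) u v = 0" using N[OF q] by simp
  qed
qed

section \<open>Tamed complex structures\<close>

text \<open>If \<open>J\<close> is compatible with \<open>F\<close>, the two summands coincide and
  this is the Kaehler metric; if \<open>J\<close> is merely tamed by \<open>F\<close>, symmetrising
  is what leaves a metric.\<close>

definition sym_form :: "('m, 'e::euclidean_space) bil_field \<Rightarrow> ('m, 'e) end_field \<Rightarrow> ('m, 'e) bil_field" where
  "sym_form F J c p v w = (F c p v (J c p w) + F c p w (J c p v)) / 2"

lemma bilinear_field_sym_form:
  assumes A: "smooth_structure \<A>" and F: "bilinear_field \<A> UNIV F" and J: "endo_field \<A> UNIV J"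
  shows "bilinear_field \<A> UNIV (sym_form F J)"
  unfolding bilinear_field_def
proof (intro conjI ballI allI)
  fix c p assume c: "c \<in> \<A>" "p \<in> fst c \<inter> UNIV"
  have F': "bilinear (F c p)" and J': "linear (J c p)"
    using bilinear_fieldD(1)[OF F c(1)] endo_fieldD(1)[OF J c(1)] c by auto
  show "bilinear (sym_form F J c p)"
    unfolding bilinear_def sym_form_def
    by (intro conjI allI linearI)
      (simp_all add: linear_add[OF J'] linear_scale[OF J'] bilinear_ladd[OF F'] bilinear_radd[OF F']
       bilinear_lmul[OF F'] bilinear_rmul[OF F'] field_simps)
next
  fix c v w assume c: "c \<in> \<A>"
  have ch: "is_chart c" using A c smooth_structure_chart by blast
  have op: "open (snd c ` fst c)" using open_chart_image[OF ch open_UNIV] by simp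
  have t: "smooth_on (\<lambda>x. local_rep c F x v (local_rep c J x w)) (snd c ` fst c)" for v w
    by (rule smooth_bilinear_field_app[OF A F c smooth_on_const smooth_endo_field_app[OF A J c smooth_on_const]])
  have "smooth_on (\<lambda>x. (1/2) * (local_rep c F x v (local_rep c J x w) + local_rep c F x w (local_rep c J x v))) (snd c ` fst c)"
    by (rule smooth_on_mult[OF op smooth_on_const smooth_on_add[OF op t t]])
  then show "smooth_on (\<lambda>x. local_rep c (sym_form F J) x v w) (snd c ` (fst c \<inter> UNIV))"
    by (simp add: local_rep_def sym_form_def)
next
  fix c d p v w assume "c \<in> \<A>" "d \<in> \<A>" "p \<in> fst c \<inter> fst d \<inter> UNIV"
  then show "sym_form F J d p (change c d p v) (change c d p w) = sym_form F J c p v w"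
    using bilinear_fieldD(3)[OF F] endo_fieldD(3)[OF J] by (simp add: sym_form_def)
qed

text \<open>By \<open>J J = - 1\<close> and the skewness of \<open>F\<close>, replacing
  \<open>v, w\<close> by \<open>J v, J w\<close> exchanges the two summands of
  \<open>sym_form\<close>, whence invariance; on the diagonal the form is \<open>F(v, J v)\<close>,
  so taming is positivity.\<close>

lemma hermitian_sym_form:
  assumes A: "smooth_structure \<A>" and F: "symplectic \<A> UNIV F" and J: "complex_structure \<A> UNIV J"
    and tame: "\<And>c p v. c \<in> \<A> \<Longrightarrow> p \<in> fst c \<Longrightarrow> v \<noteq> 0 \<Longrightarrow> 0 < F c p v (J c p v)"
  shows "hermitian \<A> UNIV (sym_form F J) J"
  unfolding hermitian_def riemannian_def
proof (intro conjI ballI allI impI)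
  show "bilinear_field \<A> UNIV (sym_form F J)"
    by (rule bilinear_field_sym_form[OF A symplecticD(1)[OF F] complex_structureD(1)[OF J]])
  fix c p v w assume c: "c \<in> \<A>" "p \<in> fst c \<inter> UNIV"
  show "sym_form F J c p v w = sym_form F J c p w v" by (simp add: sym_form_def)
  show "0 < sym_form F J c p v v" if "v \<noteq> 0" using tame[OF c(1) _ that] c by (simp add: sym_form_def)
  have Fb: "bilinear (F c p)" using bilinear_fieldD(1)[OF symplecticD(1)[OF F]] c by blast
  have skew: "F c p v w = - F c p w v" for v w using symplecticD(2)[OF F] c by blast
  have "J c p (J c p v) = - v" for v using complex_structureD(2)[OF J] c by blast
  then show "sym_form F J c p (J c p v) (J c p w) = sym_form F J c p v w"
    using skew[of "J c p v" w] skew[of "J c p w" v] by (simp add: sym_form_def bilinear_rneg[OF Fb])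
qed (rule J)

text \<open>The fundamental form of \<open>sym_form F J\<close> is the \<open>J\<close>-invariant
  part of \<open>F\<close>, so the previous computation applies. The metric enters through its
  values on the chart, since \<open>I\<close> will be paired with the metric built from
  \<open>J\<close>.\<close>

lemma dc2_sym_form:
  assumes A: "smooth_structure \<A>" and F: "symplectic \<A> UNIV F" and J: "complex_structure \<A> UNIV J"
    and c: "c \<in> \<A>" "p \<in> fst c"
    and g: "\<And>q v w. q \<in> fst c \<Longrightarrow> g c q v w = sym_form F J c q v w"
  shows "dc2 (local_rep c J) (local_rep c (fund_form g J)) (snd c p) u v w =
    ext_d2 (\<lambda>y a b. (local_rep c F y a (local_rep c J y b) + local_rep c F y (local_rep c J y a) b) / 2) (snd c p) u v w"
proof -
  have ch: "is_chart c" using A c smooth_structure_chart by blast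
  have op: "open (snd c ` fst c)" using open_chart_image[OF ch open_UNIV] by simp
  have F': "bilinear_field \<A> UNIV F" and J': "endo_field \<A> UNIV J"
    using symplecticD(1)[OF F] complex_structureD(1)[OF J] by auto
  have sk: "F c q v w = - F c q w v" if "q \<in> fst c" for q v w
    using symplecticD(2)[OF F] c that by blast
  have JJ: "J c q (J c q v) = - v" if "q \<in> fst c" for q v
    using complex_structureD(2)[OF J] c that by blast
  show ?thesis
  proof (rule dc2_invariant_part[OF op])
    show "snd c p \<in> snd c ` fst c" using c by blast
    show "linear (local_rep c J y)" "local_rep c J y (local_rep c J y v) = - v" if "y \<in> snd c ` fst c" for y v
      using that endo_fieldD(1)[OF J' c(1)] by (auto simp: local_rep_chart[OF ch] JJ)
    show "(\<lambda>y. local_rep c J y v) differentiable (at (snd c p))" for v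
      using c by (intro smooth_on_imp_differentiable[OF endo_fieldD(2)[OF J' c(1)]]) blast
    show "nijenhuis (local_rep c J) (snd c p) u v = 0" for u v
      using complex_structureD(3)[OF J] c by blast
    show "bilinear (local_rep c F y)" if "y \<in> snd c ` fst c" for y
      using that bilinear_fieldD(1)[OF F' c(1)] by (auto simp: local_rep_chart[OF ch])
    show "local_rep c F y v w = - local_rep c F y w v" if "y \<in> snd c ` fst c" for y v w
      using that sk[of "inv_chart c y" v w] inv_chart_mem[OF ch] by (simp add: local_rep_def)
    show "(\<lambda>y. local_rep c F y v w) differentiable (at (snd c p))" for v w
      using c by (intro smooth_on_imp_differentiable[OF bilinear_fieldD(2)[OF F' c(1)]]) blast
    show "ext_d2 (local_rep c F) (snd c p) u v w = 0" for u v w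
      using symplecticD(3)[OF F] c by blast
    show "local_rep c (fund_form g J) y v w =
        (local_rep c F y v w + local_rep c F y (local_rep c J y v) (local_rep c J y w)) / 2"
      if y: "y \<in> snd c ` fst c" for y v w
    proof -
      obtain q where q: "q \<in> fst c" "y = snd c q" using y by blast
      have "F c q w (- v) = F c q v w"
        using sk[OF q(1), of v w] bilinear_fieldD(1)[OF F' c(1) q(1)] by (simp add: bilinear_rneg)
      then show ?thesis using q by (simp add: local_rep_chart[OF ch] fund_form_def g sym_form_def JJ)
    qed
  qed
qed

text \<open>The adjointness of \<open>I\<close> and \<open>J\<close> with respect to \<open>F\<close> gives both the same metric and opposite
  2-form potentials for their torsions.\<close>

lemma generalized_kaehler_sym_form:
  assumes A: "smooth_structure \<A>" and F: "symplectic \<A> UNIV F"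
    and I: "complex_structure \<A> UNIV I" and J: "complex_structure \<A> UNIV J"
    and tame: "\<And>c p v. c \<in> \<A> \<Longrightarrow> p \<in> fst c \<Longrightarrow> v \<noteq> 0 \<Longrightarrow> 0 < F c p v (J c p v)"
    and adj: "\<And>c p v w. c \<in> \<A> \<Longrightarrow> p \<in> fst c \<Longrightarrow> F c p (I c p v) w = - F c p v (J c p w)"
  shows "generalized_kaehler \<A> UNIV (sym_form F J) I J"
proof -
  have sk: "F c q v w = - F c q w v" if "c \<in> \<A>" "q \<in> fst c" for c q v w
    using symplecticD(2)[OF F] that by blast
  have adj': "F c p v (I c p w) = - F c p (J c p v) w" if "c \<in> \<A>" "p \<in> fst c" for c p v w
    using adj[OF that, of w v] sk[OF that, of v] sk[OF that, of w "J c p v"] by simp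
  have IJ: "sym_form F I c p v w = sym_form F J c p v w" if "c \<in> \<A>" "p \<in> fst c" for c p v w
    using sk[OF that, of "J c p v" w] sk[OF that, of "J c p w" v] by (simp add: sym_form_def adj'[OF that])
  have hJ: "hermitian \<A> UNIV (sym_form F J) J"
    using A F J tame by (rule hermitian_sym_form)
  have "hermitian \<A> UNIV (sym_form F I) I"
  proof (rule hermitian_sym_form[OF A F I])
    fix c p and v :: 'b assume cp: "c \<in> \<A>" "p \<in> fst c" "v \<noteq> 0"
    show "0 < F c p v (I c p v)"
      using tame[OF cp] adj'[OF cp(1,2), of v v] sk[OF cp(1,2), of v "J c p v"] by simp
  qed
  then have "hermitian \<A> UNIV (sym_form F J) I"
    using hJ IJ by (auto simp: hermitian_def)
  moreover
  {
    fix c p assume c: "c \<in> \<A>" "p \<in> fst c"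
    have ch: "is_chart c" using A c smooth_structure_chart by blast
    have op: "open (snd c ` fst c)" using open_chart_image[OF ch open_UNIV] by simp
    have F': "bilinear_field \<A> UNIV F" and J': "endo_field \<A> UNIV J"
      using symplecticD(1)[OF F] complex_structureD(1)[OF J] by auto
    define b where "b y v w = (local_rep c F y v (local_rep c J y w) + local_rep c F y (local_rep c J y v) w) / 2" for y v w
    define b' where "b' y v w = (local_rep c F y v (local_rep c I y w) + local_rep c F y (local_rep c I y v) w) / 2" for y v w
    let ?HI = "dc2 (local_rep c I) (local_rep c (fund_form (sym_form F J) I))"
    let ?HJ = "dc2 (local_rep c J) (local_rep c (fund_form (sym_form F J) J))"
    have HJ: "?HJ (snd c q) u v w = ext_d2 b (snd c q) u v w" if "q \<in> fst c" for q u v w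
      using dc2_sym_form[OF A F J c(1) that, of "sym_form F J"] by (simp add: b_def[abs_def])
    have HI: "?HI (snd c q) u v w = ext_d2 b' (snd c q) u v w" if "q \<in> fst c" for q u v w
      using dc2_sym_form[OF A F I c(1) that, of "sym_form F J"] IJ c by (simp add: b'_def[abs_def])
    have smb: "smooth_on (\<lambda>y. b y v w) (snd c ` fst c)" for v w
    proof -
      have "smooth_on (\<lambda>y. (1/2) * (local_rep c F y v (local_rep c J y w) + local_rep c F y (local_rep c J y v) w)) (snd c ` fst c)"
        by (intro smooth_on_mult smooth_on_add smooth_bilinear_field_app[OF A F' c(1)]
            smooth_endo_field_app[OF A J' c(1)] op smooth_on_const)
      then show ?thesis by (simp add: b_def)
    qed
    have bb: "b' y v w = - b y v w" if "y \<in> snd c ` fst c" for y v w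
      using that c by (auto simp: b_def b'_def local_rep_chart[OF ch] adj adj' field_simps)
    have cp: "snd c p \<in> snd c ` fst c" using c by blast
    have neg: "ext_d2 b' y u v w = - ext_d2 b y u v w" if "y \<in> snd c ` fst c" for y u v w
    proof -
      have "ext_d2 b' y u v w = ext_d2 (\<lambda>y v w. - b y v w) y u v w"
        by (rule ext_d2_cong[OF op that bb])
      moreover have "frechet_derivative (\<lambda>y. - b y v w) (at y) h = - frechet_derivative (\<lambda>y. b y v w) (at y) h" for v w h
        by (intro frechet_derivative_eqI has_derivative_minus has_derivative_frechet
            smooth_on_imp_differentiable[OF smb that])
      ultimately show ?thesis by (simp add: ext_d2_def)
    qed
    have "ext_d3 ?HI (snd c p) u v w z = ext_d3 (ext_d2 b') (snd c p) u v w z" for u v w z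
      by (rule ext_d3_cong[OF op cp]) (auto simp: HI)
    moreover have "smooth_on (\<lambda>y. b' y v w) (snd c ` fst c)" for v w
      by (rule smooth_on_cong[OF op _ smooth_on_uminus[OF op smb]]) (simp add: bb)
    ultimately have "ext_d3 ?HI (snd c p) u v w z = 0" for u v w z
      using ext_d3_ext_d2[OF op cp] by simp
    moreover have "?HI (snd c p) u v w = - ?HJ (snd c p) u v w" for u v w
      using HI HJ c neg[OF cp] by simp
    ultimately have "(\<forall>u v w. ?HI (snd c p) u v w = - ?HJ (snd c p) u v w) \<and>
       (\<forall>u v w z. ext_d3 ?HI (snd c p) u v w z = 0)" by blast
  }
  ultimately show ?thesis using hJ by (simp add: generalized_kaehler_def Let_def)
qed


section \<open>Deformation by a bivector\<close>

text \<open>The bivector \<open>\<Sum> A\<^sub>i\<^sub>j X\<^sub>i \<and> X\<^sub>j\<close>, turned into an endomorphism by \<open>F\<close>. It takes values in the span of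
  the \<open>X\<^sub>i\<close>, which is isotropic, so its square vanishes.\<close>

definition bivector :: "real ^ 'n ^ 'n \<Rightarrow> ('m, 'e::euclidean_space) bil_field \<Rightarrow> ('n::finite \<Rightarrow> ('m, 'e) vec_field)
    \<Rightarrow> ('m, 'e) end_field" where
  "bivector A F X c p v = (\<Sum>i\<in>UNIV. \<Sum>j\<in>UNIV. (A $ i $ j * F c p (X i c p) v) *\<^sub>R X j c p)"

text \<open>The endomorphism \<open>J\<close> is a parameter so that one definition covers the three
  conjugating maps: \<open>A\<close> with \<open>J\<^sub>K\<close> for \<open>T\<close>,
  \<open>- A\<close> with \<open>J\<^sub>K\<close> for \<open>S\<close>, and \<open>- A\<close> with
  the deformed \<open>J\<close> for \<open>R\<close>.\<close>

definition shear :: "real ^ 'n ^ 'n \<Rightarrow> ('m, 'e::euclidean_space) bil_field \<Rightarrow> ('n::finite \<Rightarrow> ('m, 'e) vec_field)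
    \<Rightarrow> ('m, 'e) end_field \<Rightarrow> ('m, 'e) end_field" where
  "shear A F X J c p v = v + bivector A F X c p (J c p v)"

text \<open>\<open>inv\<close> is the total inverse obtained by choice; it is a genuine inverse as
  soon as taming makes the shear bijective.\<close>

definition deform :: "real ^ 'n ^ 'n \<Rightarrow> ('m, 'e::euclidean_space) bil_field \<Rightarrow> ('n::finite \<Rightarrow> ('m, 'e) vec_field)
    \<Rightarrow> ('m, 'e) end_field \<Rightarrow> ('m, 'e) end_field" where
  "deform A F X J c p v = shear A F X J c p (J c p (inv (shear A F X J c p) v))"

lemma skew_matrix_entry: "transpose A = - A \<Longrightarrow> A $ i $ j = - A $ j $ i" for A :: "real ^ 'n ^ 'n"
  by (drule arg_cong[of _ _ "\<lambda>M. M $ j $ i"]) (simp add: transpose_def)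

lemma bilinear_sum_left: "bilinear f \<Longrightarrow> f (\<Sum>i\<in>I. g i) w = (\<Sum>i\<in>I. f (g i) w)"
  using linear_sum[of "\<lambda>v. f v w"] by (simp add: bilinear_def)

lemma bilinear_sum_right: "bilinear f \<Longrightarrow> f v (\<Sum>i\<in>I. g i) = (\<Sum>i\<in>I. f v (g i))"
  using linear_sum[of "f v"] by (simp add: bilinear_def)

lemma bivector_change:
  assumes A: "smooth_structure \<A>" and F: "bilinear_field \<A> W F" and X: "\<And>i. vector_field \<A> W (X i)"
    and cd: "c \<in> \<A>" "d \<in> \<A>" "p \<in> fst c" "p \<in> fst d" "p \<in> W"
  shows "bivector A F X d p (change c d p v) = change c d p (bivector A F X c p v)"
proof -
  have lin: "linear (change c d p)" using A cd by (intro linear_change)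
  have "X i d p = change c d p (X i c p)" for i
    by (rule vector_fieldD(2)[OF X cd])
  moreover have "F d p (change c d p (X i c p)) (change c d p v) = F c p (X i c p) v" for i
    by (rule bilinear_fieldD(3)[OF F cd])
  ultimately show ?thesis
    by (simp add: bivector_def linear_sum[OF lin] linear_scale[OF lin])
qed

lemma shear_change:
  assumes A: "smooth_structure \<A>" and F: "bilinear_field \<A> W F" and X: "\<And>i. vector_field \<A> W (X i)"
    and J: "endo_field \<A> W J"
    and cd: "c \<in> \<A>" "d \<in> \<A>" "p \<in> fst c" "p \<in> fst d" "p \<in> W"
  shows "shear A F X J d p (change c d p v) = change c d p (shear A F X J c p v)"
  using linear_add[OF linear_change[OF A cd(1-4)]]
  by (simp add: shear_def endo_fieldD(3)[OF J cd] bivector_change[OF A F X cd])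

lemma linear_bivector:
  assumes "bilinear (F c p)"
  shows "linear (bivector A F X c p)"
  by (rule linearI)
    (simp_all add: bivector_def bilinear_radd[OF assms] bilinear_rmul[OF assms] algebra_simps sum.distrib scaleR_sum_right)

lemma shear_eq: "linear (J c p) \<Longrightarrow> J c p (J c p v) = - v \<Longrightarrow> bilinear (F c p) \<Longrightarrow>
    shear A F X J c p (J c p v) = J c p v - bivector A F X c p v"
  by (simp add: shear_def linear_neg[OF linear_bivector])

lemma bivector_uminus: "bivector (- A) F X c p v = - bivector A F X c p v"
  by (simp add: bivector_def sum_negf)

context
  fixes F :: "('m, 'e::euclidean_space) bil_field" and X :: "'n::finite \<Rightarrow> ('m, 'e) vec_field"
    and A :: "real ^ 'n ^ 'n" and c p
  assumes bil: "bilinear (F c p)" and skew: "\<And>v w. F c p v w = - F c p w v"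
    and iso: "\<And>i j. F c p (X i c p) (X j c p) = 0" and A: "transpose A = - A"
begin

lemma form_bivector_left:
  "F c p (bivector A F X c p v) w = (\<Sum>i\<in>UNIV. \<Sum>j\<in>UNIV. A $ i $ j * F c p (X i c p) v * F c p (X j c p) w)"
  using bil by (simp add: bivector_def bilinear_sum_left bilinear_lmul)

text \<open>Transposing the double sum costs one sign from \<open>A\<close> and one from
  \<open>F\<close>, and the two cancel: \<open>B\<close> is self-adjoint for \<open>F\<close>, so
  \<open>F(B v, w)\<close> is again skew.\<close>

lemma bivector_adjoint: "F c p (bivector A F X c p v) w = F c p v (bivector A F X c p w)"
proof -
  note sk = skew_matrix_entry[OF A]
  have "F c p v (bivector A F X c p w) = - F c p (bivector A F X c p w) v" by (rule skew)
  also have "\<dots> = - (\<Sum>i\<in>UNIV. \<Sum>j\<in>UNIV. A $ i $ j * F c p (X i c p) w * F c p (X j c p) v)"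
    by (simp only: form_bivector_left)
  also have "\<dots> = (\<Sum>i\<in>UNIV. \<Sum>j\<in>UNIV. A $ j $ i * F c p (X j c p) v * F c p (X i c p) w)"
    by (simp add: sum_negf[symmetric]) (intro sum.cong refl, subst sk, simp)
  also have "\<dots> = F c p (bivector A F X c p v) w"
    by (subst sum.swap) (simp only: form_bivector_left)
  finally show ?thesis by simp
qed

lemma bivector_isotropic: "F c p (bivector A F X c p v) v = 0"
  using bivector_adjoint[of v v] skew[of v "bivector A F X c p v"] by simp

lemma bivector_bivector: "bivector A F X c p (bivector A F X c p v) = 0"
proof -
  have "F c p (X i c p) (bivector A F X c p v) = 0" for i
    using bil by (simp add: bivector_def bilinear_sum_right bilinear_rmul iso)
  then show ?thesis by (simp add: bivector_def[of A F X c p "bivector A F X c p v"])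
qed

lemma form_bivector_bivector: "F c p (bivector A F X c p v) (bivector A F X c p w) = 0"
  using bil by (simp add: bivector_adjoint bivector_bivector bilinear_rzero)

text \<open>Expanding \<open>F(v + B J v, J v - B v)\<close>, both mixed terms have the shape
  \<open>F(B w, w)\<close> up to adjointness and vanish, as does \<open>F(B J v, B v)\<close>. This
  carries taming over to the conjugated structure.\<close>

lemma shear_form:
  assumes J: "linear (J c p)" and JJ: "\<And>v. J c p (J c p v) = - v"
  shows "F c p (shear A F X J c p v) (shear A F X J c p (J c p v)) = F c p v (J c p v)"
proof -
  have "F c p (bivector A F X c p (J c p v)) (J c p v) = 0" by (rule bivector_isotropic)
  moreover have "F c p v (bivector A F X c p v) = 0"
    using bivector_isotropic[of v] bivector_adjoint[of v v] by simp
  ultimately show ?thesis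
    unfolding shear_eq[where J = J and F = F and c = c and p = p, OF J JJ bil]
    using bil by (simp add: shear_def bilinear_ladd bilinear_rsub form_bivector_bivector)
qed

lemma inj_shear:
  assumes J: "linear (J c p)" and tame: "\<And>v. v \<noteq> 0 \<Longrightarrow> 0 < F c p v (J c p v)"
  shows "inj (shear A F X J c p)"
proof -
  have lin: "linear (shear A F X J c p)"
    unfolding shear_def[abs_def]
    using linear_compose[OF J linear_bivector[where F = F and c = c and p = p, OF bil]]
    by (intro linear_compose_add linear_id[unfolded id_def]) (simp add: o_def)
  show ?thesis
    unfolding linear_injective_0[OF lin]
  proof (intro allI impI)
    fix v assume "shear A F X J c p v = 0"
    then have v: "v = - bivector A F X c p (J c p v)" by (simp add: shear_def add_eq_0_iff2)
    have "F c p v (J c p v) = - F c p (bivector A F X c p (J c p v)) (J c p v)"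
      using bilinear_lneg[OF bil] v by metis
    also have "\<dots> = 0" by (simp add: bivector_isotropic)
    finally show "v = 0" using tame[of v] by force
  qed
qed

end

text \<open>The common data of the conjugations: with \<open>A\<close> and \<open>- A\<close> for an
  extended Kaehler structure, and with \<open>- A\<close> for an extended generalized Kaehler
  structure. Integrability is treated separately, by density.\<close>

locale tamed_isotropic =
  fixes \<A> :: "('m::topological_space, 'e::euclidean_space) chart set"
    and A :: "real ^ 'n ^ 'n" and F :: "('m, 'e) bil_field" and X :: "'n::finite \<Rightarrow> ('m, 'e) vec_field"
    and J :: "('m, 'e) end_field"
  assumes \<A>: "smooth_structure \<A>" and A: "transpose A = - A"
    and F: "bilinear_field \<A> UNIV F"
    and skew: "\<And>c p v w. c \<in> \<A> \<Longrightarrow> p \<in> fst c \<Longrightarrow> F c p v w = - F c p w v"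
    and X: "\<And>i. vector_field \<A> UNIV (X i)"
    and iso: "\<And>c p i j. c \<in> \<A> \<Longrightarrow> p \<in> fst c \<Longrightarrow> F c p (X i c p) (X j c p) = 0"
    and J: "endo_field \<A> UNIV J"
    and square: "\<And>c p v. c \<in> \<A> \<Longrightarrow> p \<in> fst c \<Longrightarrow> J c p (J c p v) = - v"
    and tame: "\<And>c p v. c \<in> \<A> \<Longrightarrow> p \<in> fst c \<Longrightarrow> v \<noteq> 0 \<Longrightarrow> 0 < F c p v (J c p v)"
begin

abbreviation "T \<equiv> shear A F X J"

lemma bilF: "c \<in> \<A> \<Longrightarrow> p \<in> fst c \<Longrightarrow> bilinear (F c p)"
  using bilinear_fieldD(1)[OF F] by blast

lemma linJ: "c \<in> \<A> \<Longrightarrow> p \<in> fst c \<Longrightarrow> linear (J c p)"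
  using endo_fieldD(1)[OF J] by blast

lemma linear_shear: "c \<in> \<A> \<Longrightarrow> p \<in> fst c \<Longrightarrow> linear (T c p)"
  unfolding shear_def[abs_def]
  using linear_compose[OF linJ linear_bivector[OF bilF]]
  by (intro linear_compose_add linear_id[unfolded id_def]) (simp add: o_def)

lemma bij_shear: "c \<in> \<A> \<Longrightarrow> p \<in> fst c \<Longrightarrow> bij (T c p)"
  using inj_shear[where F = F and X = X and J = J and A = A, OF bilF skew iso A linJ tame]
    linear_injective_imp_surjective[OF linear_shear] by (auto simp: bij_def)

lemma shear_inv: "c \<in> \<A> \<Longrightarrow> p \<in> fst c \<Longrightarrow> T c p (inv (T c p) v) = v"
  using bij_shear by (simp add: bij_is_surj surj_f_inv_f)

lemma inv_shear: "c \<in> \<A> \<Longrightarrow> p \<in> fst c \<Longrightarrow> inv (T c p) (T c p v) = v"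
  using bij_shear by (simp add: bij_is_inj inv_f_f)

lemma deform_shear: "c \<in> \<A> \<Longrightarrow> p \<in> fst c \<Longrightarrow> deform A F X J c p (T c p v) = T c p (J c p v)"
  by (simp add: deform_def inv_shear)

text \<open>The shear is onto, so the intertwining relation determines the conjugate. Over the dense
  set this identifies the structures given by toric formulas with the globally defined ones.\<close>

lemma deform_eqI:
  assumes "c \<in> \<A>" "p \<in> fst c" "\<And>v. K c p (T c p v) = T c p (J c p v)"
  shows "K c p v = deform A F X J c p v"
  using assms(3)[of "inv (T c p) v"] by (simp add: shear_inv[OF assms(1,2)] deform_def)

lemma smooth_bivector:
  assumes c: "c \<in> \<A>" and f: "smooth_on f (snd c ` fst c)"
  shows "smooth_on (\<lambda>x. local_rep c (bivector A F X) x (f x)) (snd c ` fst c)"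
proof -
  have op: "open (snd c ` fst c)"
    using open_chart_image[OF smooth_structure_chart[OF \<A> c] open_UNIV] by simp
  have X': "smooth_on (local_rep c (X i)) (snd c ` fst c)" for i
    using vector_fieldD(1)[OF X c] by simp
  have "smooth_on (\<lambda>x. \<Sum>i\<in>UNIV. \<Sum>j\<in>UNIV.
      (A $ i $ j * local_rep c F x (local_rep c (X i) x) (f x)) *\<^sub>R local_rep c (X j) x) (snd c ` fst c)"
    by (intro smooth_on_sum smooth_on_scaleR smooth_on_mult op smooth_on_const X' smooth_bilinear_field_app[OF \<A> F c] f)
  then show ?thesis by (simp add: local_rep_def bivector_def)
qed

lemma smooth_shear:
  assumes c: "c \<in> \<A>" and f: "smooth_on f (snd c ` fst c)"
  shows "smooth_on (\<lambda>x. local_rep c T x (f x)) (snd c ` fst c)"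
proof -
  have op: "open (snd c ` fst c)"
    using open_chart_image[OF smooth_structure_chart[OF \<A> c] open_UNIV] by simp
  have "smooth_on (\<lambda>x. f x + local_rep c (bivector A F X) x (local_rep c J x (f x))) (snd c ` fst c)"
    by (intro smooth_on_add op f smooth_bivector c smooth_endo_field_app[OF \<A> J c])
  then show ?thesis by (simp add: local_rep_def shear_def)
qed

lemma endo_field_deform: "endo_field \<A> UNIV (deform A F X J)"
  unfolding endo_field_def
proof (intro conjI ballI allI)
  fix c p assume c: "c \<in> \<A>" "p \<in> fst c \<inter> UNIV"
  then have cp: "c \<in> \<A>" "p \<in> fst c" by auto
  have "linear (inv (T c p))"
  proof (rule linearI)
    fix a b r
    have "inv (T c p) (T c p (inv (T c p) a + inv (T c p) b)) = inv (T c p) a + inv (T c p) b"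
      by (rule inv_shear[OF cp])
    then show "inv (T c p) (a + b) = inv (T c p) a + inv (T c p) b"
      by (simp only: linear_add[OF linear_shear[OF cp]] shear_inv[OF cp])
    have "inv (T c p) (T c p (r *\<^sub>R inv (T c p) a)) = r *\<^sub>R inv (T c p) a"
      by (rule inv_shear[OF cp])
    then show "inv (T c p) (r *\<^sub>R a) = r *\<^sub>R inv (T c p) a"
      by (simp only: linear_scale[OF linear_shear[OF cp]] shear_inv[OF cp])
  qed
  from linear_compose[OF this linear_compose[OF linJ[OF cp] linear_shear[OF cp]]]
  show "linear (deform A F X J c p)" by (simp add: deform_def[abs_def] o_def)
next
  fix c v assume c: "c \<in> \<A>"
  have ch: "is_chart c" using \<A> c smooth_structure_chart by blast
  have op: "open (snd c ` fst c)" using open_chart_image[OF ch open_UNIV] by simp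
  \<comment> \<open>The only place where smoothness could be lost off the dense set: pointwise
    invertibility of the smooth family is enough for a smooth inverse.\<close>
  have "smooth_on (\<lambda>x. inv (local_rep c T x) v) (snd c ` fst c)"
  proof (rule smooth_on_inverse[OF op])
    show "smooth_on (\<lambda>x. local_rep c T x v) (snd c ` fst c)" for v
      by (rule smooth_shear[OF c smooth_on_const])
  qed (auto simp: local_rep_chart[OF ch] linear_shear shear_inv inv_shear c)
  then have "smooth_on (\<lambda>x. local_rep c T x (local_rep c J x (inv (local_rep c T x) v))) (snd c ` fst c)"
    by (intro smooth_shear c smooth_endo_field_app[OF \<A> J c])
  then show "smooth_on (\<lambda>x. local_rep c (deform A F X J) x v) (snd c ` (fst c \<inter> UNIV))"
    by (simp add: local_rep_def deform_def[abs_def])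
next
  fix c d p v assume *: "c \<in> \<A>" "d \<in> \<A>" "p \<in> fst c \<inter> fst d \<inter> UNIV"
  then have cd: "c \<in> \<A>" "d \<in> \<A>" "p \<in> fst c" "p \<in> fst d" by auto
  \<comment> \<open>Writing the vector as an image under the shear removes the inverse, and the
    transformation laws of shear and \<open>J\<close> finish.\<close>
  define z where "z = inv (T c p) v"
  have z: "v = T c p z" by (simp add: z_def shear_inv cd)
  note shc = shear_change[OF \<A> F X J cd UNIV_I]
  show "deform A F X J d p (change c d p v) = change c d p (deform A F X J c p v)"
    unfolding z deform_shear[OF cd(1,3)]
    by (simp add: shc[symmetric] deform_shear[OF cd(2,4)] endo_fieldD(3)[OF J cd UNIV_I, symmetric])
qed

lemma deform_square:
  assumes "c \<in> \<A>" "p \<in> fst c"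
  shows "deform A F X J c p (deform A F X J c p v) = - v"
proof -
  define z where "z = inv (T c p) v"
  have z: "v = T c p z" by (simp add: z_def shear_inv assms)
  show ?thesis
    unfolding z deform_shear[OF assms] square[OF assms] by (rule linear_neg[OF linear_shear[OF assms]])
qed

lemma deform_form:
  assumes "c \<in> \<A>" "p \<in> fst c"
  shows "F c p (T c p z) (deform A F X J c p (T c p z)) = F c p z (J c p z)"
  unfolding deform_shear[OF assms]
  by (rule shear_form[where F = F and X = X and J = J and A = A, OF bilF[OF assms] skew[OF assms] iso[OF assms] A linJ[OF assms] square[OF assms]])

lemma deform_tame:
  assumes "c \<in> \<A>" "p \<in> fst c" "v \<noteq> 0"
  shows "0 < F c p v (deform A F X J c p v)"
proof -
  define z where "z = inv (T c p) v"
  have z: "v = T c p z" by (simp add: z_def shear_inv assms)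
  have "z \<noteq> 0" using assms(3) z linear_0[OF linear_shear[OF assms(1,2)]] by auto
  then show ?thesis unfolding z deform_form[OF assms(1,2)] by (rule tame[OF assms(1,2)])
qed

text \<open>Put \<open>S = 1 - B J\<close> and \<open>T = 1 + B J\<close>. As \<open>J\<close> is
  skew and \<open>B\<close> self-adjoint for \<open>F\<close>, the adjoint of \<open>S\<close> is
  \<open>1 + J B\<close>, and \<open>B B = 0\<close> gives
  \<open>(1 + J B) T = 1 + J B + B J\<close>. This product commutes with \<open>J\<close>, which is
  equivalent to the claim for the two conjugates.\<close>

lemma deform_adjoint:
  assumes c: "c \<in> \<A>" "p \<in> fst c" and comp: "\<And>v w. F c p (J c p v) w = - F c p v (J c p w)"
    and minus: "tamed_isotropic \<A> (- A) F X J"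
  shows "F c p (deform (- A) F X J c p v) w = - F c p v (deform A F X J c p w)"
proof -
  interpret m: tamed_isotropic \<A> "- A" F X J by (rule minus)
  define z where "z = inv (m.T c p) v"
  define y where "y = inv (T c p) w"
  have z: "v = m.T c p z" by (simp add: z_def m.shear_inv c)
  have y: "w = T c p y" by (simp add: y_def shear_inv c)
  let ?B = "bivector A F X c p" and ?J = "J c p"
  note bil = bilF[OF c]
  have adj: "F c p (?B v) w = F c p v (?B w)" for v w
    by (rule bivector_adjoint[where F = F and X = X and A = A, OF bil skew[OF c] iso[OF c] A])
  have BB: "?B (?B v) = 0" for v
    by (rule bivector_bivector[where F = F and X = X and A = A, OF bil skew[OF c] iso[OF c] A])
  have e1: "m.T c p z = z - ?B (?J z)" "m.T c p (?J z) = ?J z + ?B z"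
    "T c p y = y + ?B (?J y)" "T c p (?J y) = ?J y - ?B y"
    using linear_neg[OF linear_bivector[where A = A and X = X, where F = F, OF bil]]
    by (simp_all add: shear_def bivector_uminus square[OF c])
  have "F c p (?J z) (?B (?J y)) = F c p (?B (?J z)) (?J y)" by (simp only: adj)
  then show ?thesis
    unfolding z y m.deform_shear[OF c] deform_shear[OF c]
    unfolding e1
    by (simp add: bilinear_ladd[OF bil] bilinear_radd[OF bil] bilinear_lsub[OF bil] bilinear_rsub[OF bil]
       comp adj BB bilinear_rzero[OF bil])
qed

end

section \<open>Toric charts\<close>

text \<open>The block form lists the images of basis vectors row by row; acting on coordinate
  columns therefore produces transposes.\<close>

lemma has_block_form_eval:
  assumes J: "linear J" and P: "has_block_form J P"
  shows "J (a, b) = (transpose P *v b, - (transpose (matrix_inv P) *v a))"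
proof -
  have ab: "(a, b) = (\<Sum>i\<in>UNIV. a $ i *\<^sub>R dt i) + (\<Sum>i\<in>UNIV. b $ i *\<^sub>R dmu i)"
  proof -
    have "(\<Sum>i\<in>UNIV. a $ i *\<^sub>R dt i) = ((\<Sum>i\<in>UNIV. a $ i *\<^sub>R axis i 1), 0)"
      "(\<Sum>i\<in>UNIV. b $ i *\<^sub>R dmu i) = (0, (\<Sum>i\<in>UNIV. b $ i *\<^sub>R axis i 1))"
      by (simp_all add: dt_def dmu_def prod_eq_iff fst_sum snd_sum)
    then show ?thesis
      using basis_expansion[of a] basis_expansion[of b] by (simp add: scalar_mult_eq_scaleR)
  qed
  have "J (a, b) = (\<Sum>i\<in>UNIV. a $ i *\<^sub>R J (dt i)) + (\<Sum>i\<in>UNIV. b $ i *\<^sub>R J (dmu i))"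
    unfolding ab by (simp add: linear_add[OF J] linear_sum[OF J] linear_scale[OF J])
  also have "\<dots> = (\<Sum>i\<in>UNIV. a $ i *\<^sub>R (- (\<Sum>j\<in>UNIV. matrix_inv P $ i $ j *\<^sub>R dmu j)))
      + (\<Sum>i\<in>UNIV. b $ i *\<^sub>R (\<Sum>j\<in>UNIV. P $ i $ j *\<^sub>R dt j))"
    using P by (simp add: has_block_form_def)
  also have "\<dots> = (transpose P *v b, - (transpose (matrix_inv P) *v a))"
    by (simp add: prod_eq_iff vec_eq_iff fst_sum snd_sum dt_def dmu_def matrix_vector_mult_def transpose_def
        axis_def if_distrib sum_distrib_left sum_negf mult.commute cong: if_cong del: transpose_matrix_vector)
  finally show ?thesis .
qed

lemma block_metric_eval:
  "block_metric P Q (a, b) (c, d) = b \<bullet> (P *v d) + a \<bullet> (Q *v c)"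
  by (simp add: block_metric_def inner_vec_def matrix_vector_mult_def sum.distrib sum_distrib_left mult_ac)

text \<open>The minus sign in \<open>F(X_i, w)\<close> is absorbed by the skewness of
  \<open>A\<close>, so \<open>B\<close> is \<open>A\<close> placed in the block from the
  \<open>\<mu>\<close>- to the \<open>t\<close>-directions.\<close>

lemma bivector_toric:
  assumes "transpose A = - A" and X: "\<And>i. X i c p = dt i"
    and F: "\<And>i w. F c p (X i c p) w = - (snd w $ i)"
  shows "bivector A F X c p (a, b) = (A *v b, 0)"
proof -
  note sk = skew_matrix_entry[OF assms(1)]
  have "(\<Sum>i\<in>UNIV. A $ i $ j * - (b $ i)) = (A *v b) $ j" for j
    unfolding matrix_vector_mult_def by (simp add: sk[of _ j] cong: sum.cong)
  then show ?thesis
    unfolding bivector_def F unfolding X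
    by (simp add: prod_eq_iff vec_eq_iff fst_sum snd_sum dt_def axis_def if_distrib cong: if_cong)
qed

lemma matrix_vector_mult_minus: "(- A) *v x = - (A *v x)" for A :: "real ^ 'n ^ 'm"
  by (simp add: matrix_vector_mult_def vec_eq_iff sum_negf)

lemma skew_quadratic: "transpose A = - A \<Longrightarrow> x \<bullet> (A *v x) = 0" for A :: "real ^ 'n ^ 'n"
proof -
  assume "transpose A = - A"
  then have "x v* A = - (A *v x)"
    using transpose_matrix_vector[of A x] by (simp add: matrix_vector_mult_minus del: transpose_matrix_vector)
  then have "x \<bullet> (A *v x) = - (x \<bullet> (A *v x))"
    using dot_lmul_matrix[of x A x] by (simp add: inner_commute)
  then show ?thesis by simp
qed


lemma transpose_plus: "transpose (M + N) = transpose M + transpose N"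
  by (simp add: transpose_def vec_eq_iff)

text \<open>A positive quadratic form forces a trivial kernel. It serves both \<open>G\<close> and
  the non-symmetric \<open>G + A\<close>, whose quadratic form is that of \<open>G\<close>.\<close>

lemma positive_definite_matrix_inv:
  fixes M :: "real ^ 'n ^ 'n"
  assumes "\<And>\<xi>. \<xi> \<noteq> 0 \<Longrightarrow> 0 < \<xi> \<bullet> (M *v \<xi>)"
  shows "M ** matrix_inv M = mat 1" "matrix_inv M ** M = mat 1"
proof -
  have "\<forall>x. M *v x = 0 \<longrightarrow> x = 0"
    using assms by (metis inner_zero_right less_irrefl)
  then have "invertible M"
    unfolding invertible_left_inverse matrix_left_invertible_ker .
  then have "M ** matrix_inv M = mat 1 \<and> matrix_inv M ** M = mat 1"
    unfolding invertible_def matrix_inv_def by (rule someI_ex)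
  then show "M ** matrix_inv M = mat 1" "matrix_inv M ** M = mat 1" by auto
qed

text \<open>With \<open>U = \<Psi>\<^sup>T\<close> and \<open>V = U\<inverse>\<close>, the deformed structures are \<open>J (a, b) = (U b, - V a)\<close>; the
  three identities below then reduce to \<open>U = G - A\<close>.\<close>

lemma toric_block_identities:
  fixes G A :: "real ^ 'n ^ 'n"
  assumes A: "transpose A = - A" and sym: "transpose G = G"
    and pos: "\<And>\<xi>. \<xi> \<noteq> 0 \<Longrightarrow> 0 < \<xi> \<bullet> (G *v \<xi>)"
    and X: "\<And>i. X i c p = dt i" and FX: "\<And>i w. F c p (X i c p) w = - (snd w $ i)"
    and K: "linear (K c p)" "has_block_form (K c p) G"
    and J: "linear (J c p)" "has_block_form (J c p) (G + A)"
  shows "J c p (shear A F X K c p v) = shear A F X K c p (K c p v)"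
    and "K c p (shear (- A) F X J c p v) = shear (- A) F X J c p (J c p v)"
    and "\<And>a b. J c p (a, b) = ((G - A) *v b, - (transpose (matrix_inv (G + A)) *v a))"
    and "J c p (J c p v) = - v"
proof -
  define \<Psi> where "\<Psi> = G + A"
  define U where "U = G - A"
  define V where "V = transpose (matrix_inv \<Psi>)"
  define Gi where "Gi = transpose (matrix_inv G)"
  have tU: "transpose \<Psi> = U" by (simp add: \<Psi>_def U_def transpose_plus A sym)
  have "0 < \<xi> \<bullet> (\<Psi> *v \<xi>)" if "\<xi> \<noteq> 0" for \<xi>
    using pos[OF that] skew_quadratic[OF A] by (simp add: \<Psi>_def matrix_vector_mult_add_rdistrib inner_add_right)
  note inv\<Psi> = positive_definite_matrix_inv[OF this] and invG = positive_definite_matrix_inv[OF pos]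
  have UV: "U ** V = mat 1" "V ** U = mat 1"
    unfolding V_def tU[symmetric] using inv\<Psi> by (simp_all flip: matrix_transpose_mul)
  have "transpose G ** Gi = mat 1" "Gi ** transpose G = mat 1"
    unfolding Gi_def using invG by (simp_all flip: matrix_transpose_mul)
  then have GG: "G ** Gi = mat 1" "Gi ** G = mat 1" by (simp_all add: sym)
  have UVv: "U *v (V *v x) = x" "V *v (U *v x) = x" "G *v (Gi *v x) = x" "Gi *v (G *v x) = x" for x
    using UV GG by (simp_all add: matrix_vector_mul_assoc)
  have Uv: "U *v x = G *v x - A *v x" for x
    by (simp add: U_def matrix_vector_mult_diff_rdistrib)
  have Jf: "J c p (a, b) = (U *v b, - (V *v a))" for a b
    using has_block_form_eval[OF J] by (simp add: tU V_def flip: \<Psi>_def)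
  then show "\<And>a b. J c p (a, b) = ((G - A) *v b, - (transpose (matrix_inv (G + A)) *v a))"
    by (simp only: U_def V_def \<Psi>_def)
  have Kf: "K c p (a, b) = (G *v b, - (Gi *v a))" for a b
    using has_block_form_eval[OF K] by (simp add: sym Gi_def)
  have B: "bivector A F X c p (a, b) = (A *v b, 0)" for a b
    by (rule bivector_toric[where F = F and X = X and c = c and p = p, OF A X FX])
  \<comment> \<open>As \<open>A = G - U\<close>, this is the resolvent identity for the inverses
    \<open>V\<close> of \<open>U\<close> and \<open>Gi\<close> of \<open>G\<close>;
    \<open>GA\<close> is the same with the factors in the other order.\<close>
  have VA: "V *v (A *v (Gi *v a)) = V *v a - Gi *v a" for a
  proof -
    have "A *v (Gi *v a) = a - U *v (Gi *v a)" by (simp add: Uv UVv)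
    then show ?thesis by (simp add: matrix_vector_mult_diff_distrib UVv)
  qed
  have GA: "Gi *v (A *v (V *v a)) = V *v a - Gi *v a" for a
  proof -
    have "A *v (V *v a) = G *v (V *v a) - a" using Uv[of "V *v a"] by (simp add: UVv algebra_simps)
    then show ?thesis by (simp add: matrix_vector_mult_diff_distrib UVv)
  qed
  obtain a b where v: "v = (a, b)" by fastforce
  have n: "M *v (- x) = - (M *v x)" for M :: "real ^ 'n ^ 'n" and x
    using matrix_vector_mult_diff_distrib[of M 0 x] by simp
  show "J c p (J c p v) = - v" by (simp add: v Jf n UVv)
  show "J c p (shear A F X K c p v) = shear A F X K c p (K c p v)"
    by (simp add: v shear_def Kf B Jf n VA UVv Uv matrix_vector_right_distrib matrix_vector_mult_diff_distrib)
  show "K c p (shear (- A) F X J c p v) = shear (- A) F X J c p (J c p v)"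
    by (simp add: v shear_def Kf B Jf n GA UVv bivector_uminus matrix_vector_right_distrib) (simp add: Uv)
qed

text \<open>\<open>F(v, J w)\<close> has the block \<open>G - A\<close> in \<open>\<mu>\<close> and
  the transposed inverse of \<open>G + A\<close> in \<open>t\<close>. Symmetrising removes
  \<open>A\<close> from the first block and turns the second into \<open>sym_part\<close>.\<close>

lemma toric_metric_identity:
  fixes G A :: "real ^ 'n ^ 'n"
  assumes F: "\<And>v w. F c p v w = (\<Sum>i\<in>UNIV. snd v $ i * fst w $ i - fst v $ i * snd w $ i)"
    and J: "\<And>a b. J c p (a, b) = ((G - A) *v b, - (transpose (matrix_inv (G + A)) *v a))"
    and A: "transpose A = - A" and sym: "transpose G = G"
    and g: "g c p = block_metric G (sym_part (matrix_inv (G + A)))"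
  shows "g c p v w = sym_form F J c p v w"
proof -
  define W where "W = matrix_inv (G + A)"
  obtain a b where v: "v = (a, b)" by fastforce
  obtain e d where w: "w = (e, d)" by fastforce
  have Fv: "F c p (a, b) (e, d) = b \<bullet> e - a \<bullet> d" for a b e d
    by (simp add: F inner_vec_def sum_subtractf)
  have tr: "x \<bullet> (M *v y) = y \<bullet> (transpose M *v x)" for x y and M :: "real ^ 'n ^ 'n"
    by (metis dot_lmul_matrix inner_commute transpose_matrix_vector)
  have "d \<bullet> (A *v b) = - (b \<bullet> (A *v d))"
    using tr[of d A b] by (simp add: A matrix_vector_mult_minus del: transpose_matrix_vector)
  moreover have "d \<bullet> (G *v b) = b \<bullet> (G *v d)"
    using tr[of d G b] by (simp add: sym del: transpose_matrix_vector)
  moreover have "e \<bullet> (transpose W *v a) = a \<bullet> (W *v e)"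
    by (rule tr[symmetric])
  moreover have "sym_part W *v e = (1/2) *\<^sub>R (W *v e + transpose W *v e)"
    by (simp add: sym_part_def scaleR_matrix_vector_assoc[symmetric] matrix_vector_mult_add_rdistrib del: transpose_matrix_vector)
  ultimately show ?thesis
    unfolding g sym_form_def v w J Fv block_metric_eval W_def[symmetric]
    by (simp add: matrix_vector_mult_diff_rdistrib inner_diff_right inner_add_right field_simps del: transpose_matrix_vector)
qed

text \<open>The potential \<open>u\<close> lives on the projection of the chart image to the
  \<open>\<mu>\<close>-space; openness of this projection makes the calculus on open sets applicable
  to \<open>u\<close>.\<close>

lemma snd_image_chart_open: "is_chart d \<Longrightarrow> open (snd ` snd d ` fst d)"
  for d :: "('m::topological_space, 'a::euclidean_space \<times> 'b::euclidean_space) chart"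
  using open_map_snd[of euclidean euclidean]
  by (auto simp: open_map_def is_chart_def euclidean_product_topology)

lemma hess_symmetric:
  assumes "open S" "x \<in> S" "smooth_on u S"
  shows "transpose (hess u x) = hess u x"
  using second_derivative_symmetric[OF assms] by (simp add: hess_def transpose_def vec_eq_iff)

lemma hess_transpose_mult:
  assumes S: "open S" "x \<in> S" "smooth_on u S"
  shows "(transpose (hess u x) *v b) $ k = frechet_derivative (\<lambda>y. frechet_derivative u (at y) (axis k 1)) (at x) b"
proof -
  let ?D = "frechet_derivative (\<lambda>y. frechet_derivative u (at y) (axis k 1)) (at x)"
  have lin: "linear ?D"
    by (rule linear_frechet_derivative[OF smooth_on_imp_differentiable[OF smooth_on_frechet_derivative[OF S(3)] S(2)]])
  have "?D b = ?D (\<Sum>i\<in>UNIV. b $ i *\<^sub>R axis i 1)"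
    using basis_expansion[of b] by (simp add: scalar_mult_eq_scaleR)
  also have "\<dots> = (\<Sum>i\<in>UNIV. b $ i * ?D (axis i 1))"
    by (simp add: linear_sum[OF lin] linear_scale[OF lin])
  finally show ?thesis
    by (simp add: matrix_vector_mult_def transpose_def hess_def mult.commute del: transpose_matrix_vector)
qed

text \<open>Since \<open>N (J u, v) = - J (N (u, v))\<close>, it suffices to consider the vectors \<open>(0, b)\<close>, for which
  only the symmetry of the third derivatives of \<open>u\<close> matters.\<close>

lemma nijenhuis_block_form:
  fixes J :: "'n::finite model \<Rightarrow> 'n model \<Rightarrow> 'n model" and C :: "real ^ 'n ^ 'n"
  assumes S: "open S" "x \<in> S" and \<Omega>: "open \<Omega>" "\<And>y. y \<in> S \<Longrightarrow> snd y \<in> \<Omega>" "smooth_on u \<Omega>"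
    and J: "\<And>y. y \<in> S \<Longrightarrow> linear (J y)" "\<And>v. (\<lambda>y. J y v) differentiable (at x)"
      "\<And>y v. y \<in> S \<Longrightarrow> J y (J y v) = - v"
    and block: "\<And>y. y \<in> S \<Longrightarrow> has_block_form (J y) (hess u (snd y) + C)"
  shows "nijenhuis J x v w = 0"
proof -
  define D where "D h k \<mu> = frechet_derivative (\<lambda>z. frechet_derivative u (at z) (axis k 1)) (at \<mu>) h" for h k \<mu>
  have Dsm: "smooth_on (D h k) \<Omega>" for h k
    unfolding D_def[abs_def] by (intro smooth_on_frechet_derivative \<Omega>)
  have Jf: "J y (a, b) = (transpose (hess u (snd y) + C) *v b, - (transpose (matrix_inv (hess u (snd y) + C)) *v a))"
    if "y \<in> S" for y a b
    by (rule has_block_form_eval[OF J(1)[OF that] block[OF that]])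
  have J0: "J y (0, b) = (\<Sum>k\<in>UNIV. (D b k (snd y) + (transpose C *v b) $ k) *\<^sub>R dt k)" if "y \<in> S" for y b
  proof -
    have "(transpose (hess u (snd y) + C) *v b) $ k = D b k (snd y) + (transpose C *v b) $ k" for k
      using hess_transpose_mult[OF \<Omega>(1) \<Omega>(2)[OF that] \<Omega>(3)]
      by (simp add: D_def transpose_plus matrix_vector_mult_add_rdistrib del: transpose_matrix_vector)
    then show ?thesis
      unfolding Jf[OF that]
      by (simp add: prod_eq_iff vec_eq_iff fst_sum snd_sum dt_def axis_def if_distrib
          cong: if_cong del: transpose_matrix_vector)
  qed
  \<comment> \<open>The constant matrix \<open>C\<close> drops out here, so the deformation does not
    affect the derivatives of \<open>J\<close> on these vectors.\<close>
  have dJ: "frechet_derivative (\<lambda>y. J y (0, b)) (at x) h =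
      (\<Sum>k\<in>UNIV. frechet_derivative (D b k) (at (snd x)) (snd h) *\<^sub>R dt k)" for b h
  proof (rule frechet_derivative_eqI)
    have "((\<lambda>y. D b k (snd y)) has_derivative (\<lambda>h. frechet_derivative (D b k) (at (snd x)) (snd h))) (at x)" for k
      by (rule has_derivative_compose[OF has_derivative_snd[OF has_derivative_ident]
            has_derivative_frechet[OF smooth_on_imp_differentiable[OF Dsm \<Omega>(2)[OF S(2)]]]])
    then have "((\<lambda>y. \<Sum>k\<in>UNIV. (D b k (snd y) + (transpose C *v b) $ k) *\<^sub>R dt k) has_derivative
        (\<lambda>h. \<Sum>k\<in>UNIV. frechet_derivative (D b k) (at (snd x)) (snd h) *\<^sub>R dt k)) (at x)"
      by (auto intro!: has_derivative_sum has_derivative_scaleR_left derivative_eq_intros simp del: transpose_matrix_vector)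
    then show "((\<lambda>y. J y (0, b)) has_derivative
        (\<lambda>h. \<Sum>k\<in>UNIV. frechet_derivative (D b k) (at (snd x)) (snd h) *\<^sub>R dt k)) (at x)"
      by (rule has_derivative_transform_within_open[OF _ S]) (simp add: J0)
  qed
  have sym: "frechet_derivative (D b k) (at (snd x)) d = frechet_derivative (D d k) (at (snd x)) b" for b d k
    unfolding D_def[abs_def]
    by (rule second_derivative_symmetric[OF \<Omega>(1) \<Omega>(2)[OF S(2)] smooth_on_frechet_derivative[OF \<Omega>(3)]])
  have lin0: "frechet_derivative (D b k) (at (snd x)) 0 = 0" for b k
    by (rule linear_0[OF linear_frechet_derivative[OF smooth_on_imp_differentiable[OF Dsm \<Omega>(2)[OF S(2)]]]])
  have linJ: "linear (J x)" using J S by blast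
  \<comment> \<open>\<open>J (0, b)\<close> is a \<open>t\<close>-vector while the coefficients
    depend on \<open>\<mu>\<close> only, so the derivatives along \<open>J (0, b)\<close> and
    \<open>J (0, d)\<close> vanish; the remaining two terms agree by \<open>sym\<close>.\<close>
  have N1: "nijenhuis J x (0, b) (0, d) = 0" for b d
  proof -
    have "snd (J x (0, b)) = 0" for b unfolding Jf[OF S(2)] by (simp del: transpose_matrix_vector)
    then show ?thesis
      unfolding nijenhuis_eq[of J x, OF linJ] dJ by (simp add: lin0 sym[of b])
  qed
  have ext: "nijenhuis J x v w = 0" if "\<And>b. nijenhuis J x (0, b) w = 0" for v w
  proof -
    obtain a b where v: "v = (a, b)" by fastforce
    have "J x (a, 0) = (0, snd (J x (a, 0)))" unfolding Jf[OF S(2)] by (simp del: transpose_matrix_vector)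
    moreover have "J x (J x (a, 0)) = - (a, 0)" using J S by blast
    ultimately have "J x (0, - snd (J x (a, 0))) = (a, 0)"
      using linear_neg[OF linJ, of "J x (a, 0)"] by (metis minus_minus uminus_Pair minus_zero)
    then obtain \<beta> where \<beta>: "J x (0, \<beta>) = (a, 0)" by blast
    have "nijenhuis J x (a, 0) w = 0"
      using nijenhuis_J_left[OF S J, of "(0, \<beta>)" w] that by (simp add: \<beta> linear_0[OF linJ])
    moreover have "v = (a, 0) + (0, b)" by (simp add: v)
    ultimately show ?thesis
      using linear_add[OF linear_nijenhuis_left[OF S J(1,2)], of "(a, 0)" "(0, b)" w] that by simp
  qed
  \<comment> \<open>\<open>ext\<close> frees one slot at a time: the first slot directly, the second
    after exchanging the slots by skewness.\<close>
  have "nijenhuis J x v (0, d) = 0" for v d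
    by (rule ext[OF N1])
  then have "nijenhuis J x (0, d) v = 0" for v d
    using nijenhuis_skew[of J x "(0, d)" v] linJ by simp
  then show ?thesis by (rule ext)
qed

text \<open>Since Hessians are symmetric, \<open>transpose (G + A) = G - A\<close>; hence
  \<open>I\<close> is the \<open>J\<close> of the deformation by \<open>- A\<close>, and the same
  block identities and the same integrability computation apply to both.\<close>

lemma A_deformation_chart:
  assumes A: "smooth_structure \<A>" and W: "open W"
    and K: "locally_toric_kaehler \<A> W F gK K X" and D: "A_deformation \<A> W A F gK K X g I J" and p: "p \<in> W"
  obtains d where "d \<in> \<A>" "p \<in> fst d"
    "\<And>v. J d p (shear A F X K d p v) = shear A F X K d p (K d p v)"
    "\<And>v. I d p (shear (- A) F X K d p v) = shear (- A) F X K d p (K d p v)"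
    "\<And>v. K d p (shear (- A) F X J d p v) = shear (- A) F X J d p (J d p v)"
    "\<And>v w. g d p v w = sym_form F J d p v w"
    "\<And>u v. nijenhuis (local_rep d J) (snd d p) u v = 0"
    "\<And>u v. nijenhuis (local_rep d I) (snd d p) u v = 0"
proof -
  have skA: "transpose A = - A" and eJ: "endo_field \<A> W J" and eI: "endo_field \<A> W I"
    using D unfolding A_deformation_def by blast+
  have eK: "endo_field \<A> W K"
    using K unfolding locally_toric_kaehler_def kaehler_def hermitian_def complex_structure_def by blast
  obtain d u where d: "d \<in> \<A>" "p \<in> fst d" "fst d \<subseteq> W" and tc: "toric_chart d F gK K X u"
    and bl: "\<forall>q\<in>fst d. let G = hess u (snd (snd d q)); \<Psi> = G + A in
             has_block_form (J d q) \<Psi> \<and> has_block_form (I d q) (transpose \<Psi>) \<and>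
             g d q = block_metric G (sym_part (matrix_inv \<Psi>))"
    using D p unfolding A_deformation_def by meson
  have ch: "is_chart d" using A d smooth_structure_chart by blast
  let ?\<Omega> = "snd ` snd d ` fst d"
  define G where "G q = hess u (snd (snd d q))" for q
  have \<Omega>: "open ?\<Omega>" by (rule snd_image_chart_open[OF ch])
  have u: "smooth_on u ?\<Omega>" using tc by (simp add: toric_chart_def)
  have symG: "transpose (G q) = G q" if "q \<in> fst d" for q
    unfolding G_def using that by (intro hess_symmetric[OF \<Omega> _ u]) blast
  have trP: "transpose (G q + A) = G q + - A" if "q \<in> fst d" for q
  proof -
    show ?thesis by (simp add: transpose_plus symG[OF that] skA)
  qed
  have bJ: "has_block_form (J d q) (G q + A)" and bI: "has_block_form (I d q) (G q + - A)"
    and bg: "g d q = block_metric (G q) (sym_part (matrix_inv (G q + A)))" if "q \<in> fst d" for q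
    using bspec[OF bl that] trP[OF that] unfolding Let_def G_def by simp_all
  have tc': "\<And>i. X i d q = dt i" "\<And>i w. F d q (X i d q) w = - (snd w $ i)"
    "\<And>v w. F d q v w = (\<Sum>i\<in>UNIV. snd v $ i * fst w $ i - fst v $ i * snd w $ i)"
    "\<And>\<xi>. \<xi> \<noteq> 0 \<Longrightarrow> 0 < \<xi> \<bullet> (G q *v \<xi>)" "has_block_form (K d q) (G q)" if "q \<in> fst d" for q
    using tc that unfolding toric_chart_def G_def Let_def by blast+
  have lin: "linear (J d q)" "linear (I d q)" "linear (K d q)" if "q \<in> fst d" for q
    using endo_fieldD(1)[OF eJ d(1)] endo_fieldD(1)[OF eI d(1)] endo_fieldD(1)[OF eK d(1)] that d(3) by blast+
  have skA': "transpose (- A) = - (- A)"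
    using arg_cong[OF skA, of uminus] by (simp add: transpose_def vec_eq_iff)
  note tbJ = toric_block_identities[where A = A and F = F and X = X and K = K and J = J and c = d, OF skA symG tc'(4) tc'(1) tc'(2) lin(3) tc'(5) lin(1) bJ]
  note tbI = toric_block_identities[where A = "- A" and F = F and X = X and K = K and J = I and c = d, OF skA' symG tc'(4) tc'(1) tc'(2) lin(3) tc'(5) lin(2) bI]
  have op: "open (snd d ` fst d)" using ch by (simp add: is_chart_def)
  have N: "nijenhuis (local_rep d L) (snd d p) v w = 0"
    if L: "endo_field \<A> W L" "\<And>q v. q \<in> fst d \<Longrightarrow> L d q (L d q v) = - v"
      "\<And>q. q \<in> fst d \<Longrightarrow> has_block_form (L d q) (G q + C)" for L C v w
  proof (rule nijenhuis_block_form[OF op _ \<Omega> _ u])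
    show "snd d p \<in> snd d ` fst d" using d by blast
    show "linear (local_rep d L y)" if "y \<in> snd d ` fst d" for y
      using that endo_fieldD(1)[OF L(1) d(1)] d(3) by (auto simp: local_rep_chart[OF ch])
    show "(\<lambda>y. local_rep d L y v) differentiable (at (snd d p))" for v
      by (rule smooth_on_imp_differentiable[OF endo_fieldD(2)[OF L(1) d(1)]]) (use d in blast)
  qed (use L in \<open>auto simp: local_rep_chart[OF ch] G_def\<close>)
  show ?thesis
  proof (rule that[OF d(1,2)])
    show "J d p (shear A F X K d p v) = shear A F X K d p (K d p v)" for v
      by (rule tbJ(1)[OF d(2) d(2) _ d(2) d(2) d(2) d(2) d(2) d(2)])
    show "I d p (shear (- A) F X K d p v) = shear (- A) F X K d p (K d p v)" for v
      by (rule tbI(1)[OF d(2) d(2) _ d(2) d(2) d(2) d(2) d(2) d(2)])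
    show "K d p (shear (- A) F X J d p v) = shear (- A) F X J d p (J d p v)" for v
      by (rule tbJ(2)[OF d(2) d(2) _ d(2) d(2) d(2) d(2) d(2) d(2)])
    show "g d p v w = sym_form F J d p v w" for v w
      by (rule toric_metric_identity[where G = "G p" and A = A and F = F and J = J and g = g and c = d and p = p, OF tc'(3)[OF d(2)] _ skA symG[OF d(2)] bg[OF d(2)]])
        (rule tbJ(3)[OF d(2) d(2) _ d(2) d(2) d(2) d(2) d(2) d(2)])
    show "nijenhuis (local_rep d J) (snd d p) u v = 0" for u v
      by (rule N[OF eJ tbJ(4) bJ])
    show "nijenhuis (local_rep d I) (snd d p) u v = 0" for u v
      by (rule N[OF eI tbI(4) bI])
  qed
qed

text \<open>All assertions are tensorial, so they pass from the toric chart around the point to an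
  arbitrary chart of the atlas.\<close>

lemma A_deformation_identities:
  assumes A: "smooth_structure \<A>" and W: "open W"
    and K: "locally_toric_kaehler \<A> W F gK K X" and D: "A_deformation \<A> W A F gK K X g I J"
    and c: "c \<in> \<A>" "p \<in> fst c" "p \<in> W"
  shows "J c p (shear A F X K c p v) = shear A F X K c p (K c p v)"
    "I c p (shear (- A) F X K c p v) = shear (- A) F X K c p (K c p v)"
    "K c p (shear (- A) F X J c p v) = shear (- A) F X J c p (J c p v)"
    "g c p v w = sym_form F J c p v w"
    "nijenhuis (local_rep c J) (snd c p) v w = 0"
    "nijenhuis (local_rep c I) (snd c p) v w = 0"
proof -
  have eJ: "endo_field \<A> W J" and eI: "endo_field \<A> W I" and g: "bilinear_field \<A> W g"
    using D unfolding A_deformation_def by blast+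
  have eK: "endo_field \<A> W K" and F: "bilinear_field \<A> W F" and X: "\<And>i. vector_field \<A> W (X i)"
    using K unfolding locally_toric_kaehler_def kaehler_def hermitian_def complex_structure_def symplectic_def by blast+
  obtain d where d: "d \<in> \<A>" "p \<in> fst d"
    and e: "\<And>v. J d p (shear A F X K d p v) = shear A F X K d p (K d p v)"
    "\<And>v. I d p (shear (- A) F X K d p v) = shear (- A) F X K d p (K d p v)"
    "\<And>v. K d p (shear (- A) F X J d p v) = shear (- A) F X J d p (J d p v)"
    "\<And>v w. g d p v w = sym_form F J d p v w"
    and N: "\<And>u v. nijenhuis (local_rep d J) (snd d p) u v = 0"
    "\<And>u v. nijenhuis (local_rep d I) (snd d p) u v = 0"
    using A_deformation_chart[OF A W K D c(3)] by metis
  note cd = c(1) d(1) c(2) d(2) c(3)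
  have inj: "x = y" if "change c d p x = change c d p y" for x y
    using that change_change[OF A cd(1-4)] by metis
  have tr: "L c p (shear B F X L' c p v) = shear B F X L' c p (L' c p v)"
    if L: "endo_field \<A> W L" "endo_field \<A> W L'" and eq: "\<And>v. L d p (shear B F X L' d p v) = shear B F X L' d p (L' d p v)"
    for L L' B v
    by (rule inj) (simp only: shear_change[OF A F X L(2) cd, symmetric] endo_fieldD(3)[OF L(1) cd, symmetric]
        endo_fieldD(3)[OF L(2) cd, symmetric] eq)
  show "J c p (shear A F X K c p v) = shear A F X K c p (K c p v)" by (rule tr[OF eJ eK e(1)])
  show "I c p (shear (- A) F X K c p v) = shear (- A) F X K c p (K c p v)" by (rule tr[OF eI eK e(2)])
  show "K c p (shear (- A) F X J c p v) = shear (- A) F X J c p (J c p v)" by (rule tr[OF eK eJ e(3)])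
  show "g c p v w = sym_form F J c p v w"
    using e(4)[of "change c d p v" "change c d p w"]
    by (simp add: bilinear_fieldD(3)[OF g cd] sym_form_def endo_fieldD(3)[OF eJ cd] bilinear_fieldD(3)[OF F cd])
  show "nijenhuis (local_rep c J) (snd c p) v w = 0"
    by (rule nijenhuis_transfer[OF A W eJ cd N(1)])
  show "nijenhuis (local_rep c I) (snd c p) v w = 0"
    by (rule nijenhuis_transfer[OF A W eI cd N(2)])
qed


section \<open>Length and completeness\<close>

lemma riemannianD:
  assumes "riemannian \<A> W g"
  shows "bilinear_field \<A> W g"
    "c \<in> \<A> \<Longrightarrow> p \<in> fst c \<Longrightarrow> p \<in> W \<Longrightarrow> g c p v w = g c p w v"
    "c \<in> \<A> \<Longrightarrow> p \<in> fst c \<Longrightarrow> p \<in> W \<Longrightarrow> v \<noteq> 0 \<Longrightarrow> 0 < g c p v v"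
  using assms unfolding riemannian_def by blast+

lemma riemannian_nonneg:
  assumes "riemannian \<A> UNIV g" "c \<in> \<A>" "p \<in> fst c"
  shows "0 \<le> g c p v v"
proof (cases "v = 0")
  case True
  then show ?thesis using bilinear_lzero[OF bilinear_fieldD(1)[OF riemannianD(1)[OF assms(1)] assms(2,3)]] by simp
next
  case False
  then show ?thesis using riemannianD(3)[OF assms(1-3)] by (simp add: less_imp_le)
qed

lemma speed_nonneg:
  assumes "smooth_structure \<A>" "riemannian \<A> UNIV g"
  shows "0 \<le> speed \<A> g \<gamma> t"
proof -
  obtain c where "c \<in> \<A>" "\<gamma> t \<in> fst c" using smooth_structure_cover[OF assms(1)] .
  then have "(SOME c. c \<in> \<A> \<and> \<gamma> t \<in> fst c) \<in> \<A> \<and> \<gamma> t \<in> fst (SOME c. c \<in> \<A> \<and> \<gamma> t \<in> fst c)"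
    by (intro someI_ex[of "\<lambda>c. c \<in> \<A> \<and> \<gamma> t \<in> fst c"]) blast
  then show ?thesis using riemannian_nonneg[OF assms(2)] by (simp add: speed_def Let_def)
qed

text \<open>\<open>speed\<close> selects an arbitrary chart at each time; the chain rule for the
  transition map and the invariance of \<open>g\<close> allow any other chart to be used
  instead.\<close>

lemma speed_eq:
  assumes A: "smooth_structure \<A>" and g: "bilinear_field \<A> UNIV g"
    and c: "c \<in> \<A>" "\<gamma> t \<in> fst c" and cont: "isCont \<gamma> t"
    and v: "((snd c \<circ> \<gamma>) has_vector_derivative v) (at t)"
  shows "speed \<A> g \<gamma> t = sqrt (g c (\<gamma> t) v v)"
proof -
  define d where "d = (SOME c. c \<in> \<A> \<and> \<gamma> t \<in> fst c)"
  have d: "d \<in> \<A>" "\<gamma> t \<in> fst d"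
    using someI[of "\<lambda>c. c \<in> \<A> \<and> \<gamma> t \<in> fst c" c] c by (auto simp: d_def)
  have ch: "is_chart c" using A c smooth_structure_chart by blast
  have lin: "linear (change c d (\<gamma> t))" by (rule linear_change[OF A c(1) d(1) c(2) d(2)])
  have "((\<lambda>s. transition c d ((snd c \<circ> \<gamma>) s)) has_derivative (\<lambda>h. change c d (\<gamma> t) (h *\<^sub>R v))) (at t)"
    using has_derivative_compose[OF v[unfolded has_vector_derivative_def], of "transition c d" "change c d (\<gamma> t)"]
      has_derivative_transition[OF A c(1) d(1) c(2) d(2)] by simp
  then have der: "((\<lambda>s. transition c d ((snd c \<circ> \<gamma>) s)) has_vector_derivative change c d (\<gamma> t) v) (at t)"
    by (simp add: has_vector_derivative_def linear_scale[OF lin])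
  have "\<exists>U. open U \<and> t \<in> U \<and> (\<forall>s\<in>U. \<gamma> s \<in> fst c)"
  proof -
    have "open (fst c)" by (rule open_chart_domain[OF ch])
    then show ?thesis using cont c(2) unfolding continuous_at_open by blast
  qed
  then obtain U where U: "open U" "t \<in> U" "\<And>s. s \<in> U \<Longrightarrow> \<gamma> s \<in> fst c" by blast
  have "((snd d \<circ> \<gamma>) has_vector_derivative change c d (\<gamma> t) v) (at t)"
    by (rule has_vector_derivative_transform_within_open[OF der U(1,2)]) (simp add: transition_chart[OF ch U(3)])
  then have "vector_derivative (snd d \<circ> \<gamma>) (at t) = change c d (\<gamma> t) v" by (rule vector_derivative_at)
  then show ?thesis
    using bilinear_fieldD(3)[OF g c(1) d(1) c(2) d(2)] by (simp add: speed_def Let_def flip: d_def)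
qed

text \<open>At the end points \<open>speed\<close> refers to a two-sided derivative that need not
  exist. In the interior it agrees with an expression that is continuous up to the end points, which
  is enough for integrability.\<close>

lemma speed_on_piece:
  assumes A: "smooth_structure \<A>" and g: "riemannian \<A> UNIV g"
    and \<gamma>: "C1_path_on \<A> \<gamma> {a..b}" and c: "c \<in> \<A>" "\<gamma> ` {a..b} \<subseteq> fst c"
  shows "(\<And>t. t \<in> {a<..<b} \<Longrightarrow>
      ((snd c \<circ> \<gamma>) has_vector_derivative vector_derivative (snd c \<circ> \<gamma>) (at t)) (at t) \<and>
      speed \<A> g \<gamma> t = sqrt (g c (\<gamma> t) (vector_derivative (snd c \<circ> \<gamma>) (at t)) (vector_derivative (snd c \<circ> \<gamma>) (at t))))"
    and "speed \<A> g \<gamma> integrable_on {a..b}"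
proof -
  have ch: "is_chart c" using A c smooth_structure_chart by blast
  have op: "open (snd c ` fst c)" using open_chart_image[OF ch open_UNIV] by simp
  note gb = riemannianD(1)[OF g]
  have eq: "{t\<in>{a..b}. \<gamma> t \<in> fst c} = {a..b}" using c by blast
  have cont: "continuous_on {a..b} \<gamma>" using \<gamma> unfolding C1_path_on_def by blast
  have "\<exists>D. continuous_on {a..b} D \<and> (\<forall>t\<in>{a..b}. ((snd c \<circ> \<gamma>) has_vector_derivative D t) (at t within {a..b}))"
    using \<gamma> c(1) unfolding C1_path_on_def Let_def by (metis (no_types, lifting) eq)
  then obtain D where D: "continuous_on {a..b} D"
    "\<And>t. t \<in> {a..b} \<Longrightarrow> ((snd c \<circ> \<gamma>) has_vector_derivative D t) (at t within {a..b})" by blast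
  have Di: "((snd c \<circ> \<gamma>) has_vector_derivative D t) (at t)" if "t \<in> {a<..<b}" for t
  proof -
    have "t \<in> {a..b}" using that by simp
    moreover have "at t within {a..b} = at t" using that by (intro at_within_Icc_at) auto
    ultimately show ?thesis using D(2)[of t] by simp
  qed
  have sp: "speed \<A> g \<gamma> t = sqrt (g c (\<gamma> t) (D t) (D t))" if t: "t \<in> {a<..<b}" for t
  proof (rule speed_eq[OF A gb c(1) _ _ Di[OF t]])
    show "\<gamma> t \<in> fst c" using c t by force
    show "isCont \<gamma> t" using cont t by (simp add: continuous_on_interior interior_atLeastAtMost_real)
  qed
  show "((snd c \<circ> \<gamma>) has_vector_derivative vector_derivative (snd c \<circ> \<gamma>) (at t)) (at t) \<and>
      speed \<A> g \<gamma> t = sqrt (g c (\<gamma> t) (vector_derivative (snd c \<circ> \<gamma>) (at t)) (vector_derivative (snd c \<circ> \<gamma>) (at t)))"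
    if "t \<in> {a<..<b}" for t
    using Di[OF that] sp[OF that] by (simp add: vector_derivative_at)
  have gexp: "g c q v v = (\<Sum>b\<in>Basis. \<Sum>b'\<in>Basis. (v \<bullet> b) * (v \<bullet> b') * g c q b b')" if "q \<in> fst c" for q v
    using bilinear_fieldD(1)[OF gb c(1) that UNIV_I] by (rule bilinear_expand_Basis)
  have gc: "continuous_on {a..b} (\<lambda>t. g c (\<gamma> t) b' b'')" for b' b''
  proof -
    have "continuous_on (snd c ` fst c) (\<lambda>x. local_rep c g x b' b'')"
      using smooth_on_imp_continuous_on[OF bilinear_fieldD(2)[OF gb c(1)]] by simp
    moreover have "continuous_on {a..b} (\<lambda>t. snd c (\<gamma> t))"
      using continuous_on_compose2[OF continuous_on_chart[OF ch] cont] c by blast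
    ultimately have "continuous_on {a..b} (\<lambda>t. local_rep c g (snd c (\<gamma> t)) b' b'')"
      by (rule continuous_on_compose2) (use c in blast)
    then show ?thesis
      by (rule continuous_on_cong[THEN iffD1, rotated 2]) (use c in \<open>auto simp: local_rep_chart[OF ch] image_subset_iff\<close>)
  qed
  have "continuous_on {a..b} (\<lambda>t. sqrt (\<Sum>b\<in>Basis. \<Sum>b'\<in>Basis. (D t \<bullet> b) * (D t \<bullet> b') * g c (\<gamma> t) b b'))"
    by (intro continuous_intros gc D)
  then have i1: "(\<lambda>t. sqrt (\<Sum>b\<in>Basis. \<Sum>b'\<in>Basis. (D t \<bullet> b) * (D t \<bullet> b') * g c (\<gamma> t) b b')) integrable_on {a..b}"
    by (rule integrable_continuous_real)
  have i2: "speed \<A> g \<gamma> t = sqrt (\<Sum>b\<in>Basis. \<Sum>b'\<in>Basis. (D t \<bullet> b) * (D t \<bullet> b') * g c (\<gamma> t) b b')"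
    if "t \<in> {a..b} - {a, b}" for t
  proof -
    have t: "t \<in> {a<..<b}" using that by auto
    then have "\<gamma> t \<in> fst c" using c(2) by (simp add: image_subset_iff)
    then show ?thesis unfolding sp[OF t] by (simp only: gexp)
  qed
  show "speed \<A> g \<gamma> integrable_on {a..b}"
    by (rule integrable_spike_finite[of "{a, b}", OF _ i2 i1]) simp_all
qed

text \<open>Integrability is local on the compact interval. Around each time a short interval stays
  in one chart and meets the break points at most in that time itself; splitting there leaves two
  \<open>C1\<close> pieces.\<close>

lemma speed_integrable:
  assumes A: "smooth_structure \<A>" and g: "riemannian \<A> UNIV g" and \<gamma>: "piecewise_C1_path \<A> \<gamma>"
  shows "speed \<A> g \<gamma> integrable_on {0..1}"
proof -
  obtain K where K: "finite K" and piece: "\<And>a b. 0 \<le> a \<Longrightarrow> a < b \<Longrightarrow> b \<le> 1 \<Longrightarrow> {a<..<b} \<inter> K = {} \<Longrightarrow> C1_path_on \<A> \<gamma> {a..b}"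
    using \<gamma> unfolding piecewise_C1_path_def by blast
  have cont: "continuous_on {0..1} \<gamma>" using \<gamma> unfolding piecewise_C1_path_def by blast
  have "\<exists>d>0. \<forall>u v. x \<in> {u..v} \<and> {u..v} \<subseteq> ball x d \<and> {u..v} \<subseteq> {0..1} \<longrightarrow> speed \<A> g \<gamma> integrable_on {u..v}"
    if x: "x \<in> {0..1}" for x
  proof -
    obtain c where c: "c \<in> \<A>" "\<gamma> x \<in> fst c" using smooth_structure_cover[OF A] .
    have "open (fst c)" using A c smooth_structure_chart open_chart_domain by blast
    then obtain U where U: "open U" "U \<inter> {0..1} = \<gamma> -` fst c \<inter> {0..1}"
      using cont unfolding continuous_on_open_invariant by blast
    then have "x \<in> U" using x c by blast
    then obtain d1 where d1: "d1 > 0" "ball x d1 \<subseteq> U" using U(1) openE by blast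
    obtain d2 where d2: "d2 > 0" "\<And>k. k \<in> K \<Longrightarrow> k \<noteq> x \<Longrightarrow> d2 \<le> dist x k"
      using finite_set_avoid[OF K, of x] by blast
    have main: "speed \<A> g \<gamma> integrable_on {a..b}"
      if "a \<le> b" "{a..b} \<subseteq> ball x (min d1 d2)" "{a..b} \<subseteq> {0..1}" "x = a \<or> x = b" for a b
    proof (cases "a = b")
      case True
      then show ?thesis using has_integral_refl(2)[of "speed \<A> g \<gamma>" b] by (auto simp: integrable_on_def)
    next
      case False
      have "{a<..<b} \<inter> K = {}"
      proof -
        have False if k: "k \<in> {a<..<b}" "k \<in> K" for k
        proof -
          have "k \<in> {a..b}" using k by simp
          then have "k \<in> ball x (min d1 d2)" using \<open>{a..b} \<subseteq> ball x (min d1 d2)\<close> by blast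
          then have "dist x k < min d1 d2" by simp
          moreover have "k \<noteq> x" using k \<open>x = a \<or> x = b\<close> by auto
          ultimately show False using d2(2)[OF k(2)] by linarith
        qed
        then show ?thesis by blast
      qed
      then have "C1_path_on \<A> \<gamma> {a..b}" using that False by (intro piece) auto
      moreover have "\<gamma> ` {a..b} \<subseteq> fst c"
      proof -
        have "ball x (min d1 d2) \<subseteq> ball x d1" by (rule subset_ball) simp
        then have "{a..b} \<subseteq> U" using that(2) d1(2) by blast
        then show ?thesis using U(2) that(3) by blast
      qed
      ultimately show ?thesis by (rule speed_on_piece(2)[OF A g _ c(1)])
    qed
    show ?thesis
    proof (intro exI[of _ "min d1 d2"] conjI allI impI)
      show "0 < min d1 d2" using d1 d2 by simp
      fix u v assume uv: "x \<in> {u..v} \<and> {u..v} \<subseteq> ball x (min d1 d2) \<and> {u..v} \<subseteq> {0..1}"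
      have sub: "{u..x} \<subseteq> {u..v}" "{x..v} \<subseteq> {u..v}" using uv by auto
      have s: "{u..x} \<subseteq> ball x (min d1 d2)" "{u..x} \<subseteq> {0..1}" "{x..v} \<subseteq> ball x (min d1 d2)" "{x..v} \<subseteq> {0..1}"
        using uv sub by blast+
      have "speed \<A> g \<gamma> integrable_on {u..x}" by (rule main[OF _ s(1,2)]) (use uv in auto)
      moreover have "speed \<A> g \<gamma> integrable_on {x..v}" by (rule main[OF _ s(3,4)]) (use uv in auto)
      ultimately show "speed \<A> g \<gamma> integrable_on {u..v}"
        using uv by (intro Henstock_Kurzweil_Integration.integrable_combine[of u x v]) auto
    qed
  qed
  then show ?thesis
    using integrable_on_little_subintervals[of 0 1 "speed \<A> g \<gamma>"] by simp
qed

text \<open>The norm of \<open>g\<close> attains positive extrema on the compact product of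
  \<open>K\<close> with the unit sphere; homogeneity extends the bounds to all vectors.\<close>

lemma metric_bounds:
  fixes g :: "'e::euclidean_space \<Rightarrow> 'e \<Rightarrow> 'e \<Rightarrow> real"
  assumes K: "compact K" and g: "\<And>x. x \<in> K \<Longrightarrow> bilinear (g x)" "\<And>v w. continuous_on K (\<lambda>x. g x v w)"
    and pos: "\<And>x v. x \<in> K \<Longrightarrow> v \<noteq> 0 \<Longrightarrow> 0 < g x v v"
  obtains m M where "m > 0" "M > 0" "\<And>x v. x \<in> K \<Longrightarrow> m * norm v \<le> sqrt (g x v v)"
    "\<And>x v. x \<in> K \<Longrightarrow> sqrt (g x v v) \<le> M * norm v"
proof (cases "K = {}")
  case True
  then show ?thesis using that[of 1 1] by auto
next
  case False
  \<comment> \<open>The expansion in coefficients makes the joint continuity in base point and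
    vector visible.\<close>
  let ?f = "\<lambda>z. \<Sum>b\<in>Basis. \<Sum>b'\<in>Basis. (snd z \<bullet> b) * (snd z \<bullet> b') * g (fst z) b b'"
  have f: "g x v v = ?f (x, v)" if "x \<in> K" for x v
    using bilinear_expand_Basis[OF g(1)[OF that], of v v] by simp
  let ?S = "K \<times> sphere (0::'e) 1"
  have "continuous_on ?S (\<lambda>z. g (fst z) b b')" for b b'
    by (rule continuous_on_compose2[OF g(2) continuous_on_fst[OF continuous_on_id]]) auto
  then have cont: "continuous_on ?S (\<lambda>z. sqrt (?f z))" by (intro continuous_intros)
  have comp: "compact ?S" using K by (intro compact_Times) auto
  obtain e :: 'e where "e \<in> Basis" using nonempty_Basis by blast
  then have "e \<in> sphere 0 1" by simp
  then have ne: "?S \<noteq> {}" using False by blast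
  obtain z1 where z1: "z1 \<in> ?S" "\<forall>z\<in>?S. sqrt (?f z1) \<le> sqrt (?f z)"
    using continuous_attains_inf[OF comp ne cont] ..
  obtain z2 where z2: "z2 \<in> ?S" "\<forall>z\<in>?S. sqrt (?f z) \<le> sqrt (?f z2)"
    using continuous_attains_sup[OF comp ne cont] ..
  have posf: "0 < sqrt (?f z)" if "z \<in> ?S" for z
  proof -
    have "fst z \<in> K" "snd z \<noteq> 0" using that by auto
    then show ?thesis using f[of "fst z" "snd z"] pos[of "fst z" "snd z"] by simp
  qed
  have scale: "sqrt (g x v v) = norm v * sqrt (?f (x, v /\<^sub>R norm v))" if "x \<in> K" "v \<noteq> 0" for x v
  proof -
    have "g x v v = g x (norm v *\<^sub>R (v /\<^sub>R norm v)) (norm v *\<^sub>R (v /\<^sub>R norm v))" using that by simp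
    also have "\<dots> = (norm v)\<^sup>2 * g x (v /\<^sub>R norm v) (v /\<^sub>R norm v)"
      unfolding bilinear_lmul[OF g(1)[OF that(1)]] bilinear_rmul[OF g(1)[OF that(1)]] by (simp add: power2_eq_square)
    finally show ?thesis using f[OF that(1)] by (simp add: real_sqrt_mult)
  qed
  have mem: "(x, v /\<^sub>R norm v) \<in> ?S" if "x \<in> K" "v \<noteq> 0" for x v using that by simp
  show ?thesis
  proof (rule that[of "sqrt (?f z1)" "sqrt (?f z2)"])
    show "0 < sqrt (?f z1)" "0 < sqrt (?f z2)" using posf z1(1) z2(1) by blast+
    fix x v assume x: "x \<in> K"
    have z0: "g x 0 0 = 0" using bilinear_lzero[OF g(1)[OF x]] .
    show "sqrt (?f z1) * norm v \<le> sqrt (g x v v)"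
      using scale[OF x, of v] bspec[OF z1(2) mem[OF x, of v]] z0
      by (cases "v = 0") (simp_all add: mult.commute mult_left_mono)
    show "sqrt (g x v v) \<le> sqrt (?f z2) * norm v"
      using scale[OF x, of v] bspec[OF z2(2) mem[OF x, of v]] z0
      by (cases "v = 0") (simp_all add: mult.commute mult_left_mono)
  qed
qed

text \<open>Near a point, \<open>g\<close> is comparable to the Euclidean norm of a chart; the
  closed coordinate ball is compact, which makes the two constants uniform.\<close>

lemma chart_ball:
  assumes A: "smooth_structure \<A>" and g: "riemannian \<A> UNIV g" and V: "open V" "p \<in> V"
  obtains c r m M where "c \<in> \<A>" "p \<in> fst c" "r > 0" "cball (snd c p) r \<subseteq> snd c ` (fst c \<inter> V)" "m > 0" "M > 0"
    "\<And>q v. q \<in> fst c \<Longrightarrow> snd c q \<in> cball (snd c p) r \<Longrightarrow> m * norm v \<le> sqrt (g c q v v)"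
    "\<And>q v. q \<in> fst c \<Longrightarrow> snd c q \<in> cball (snd c p) r \<Longrightarrow> sqrt (g c q v v) \<le> M * norm v"
proof -
  obtain c where c: "c \<in> \<A>" "p \<in> fst c" using smooth_structure_cover[OF A] .
  have ch: "is_chart c" using A c smooth_structure_chart by blast
  note gb = riemannianD(1)[OF g]
  have "open (snd c ` (fst c \<inter> V))" by (rule open_chart_image[OF ch V(1)])
  moreover have "snd c p \<in> snd c ` (fst c \<inter> V)" using c V by blast
  ultimately obtain r where r: "r > 0" "cball (snd c p) r \<subseteq> snd c ` (fst c \<inter> V)"
    using open_contains_cball by blast
  have sub: "cball (snd c p) r \<subseteq> snd c ` fst c" using r by blast
  obtain m M where mM: "m > 0" "M > 0"
    "\<And>x v. x \<in> cball (snd c p) r \<Longrightarrow> m * norm v \<le> sqrt (local_rep c g x v v)"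
    "\<And>x v. x \<in> cball (snd c p) r \<Longrightarrow> sqrt (local_rep c g x v v) \<le> M * norm v"
  proof (rule metric_bounds[of "cball (snd c p) r" "local_rep c g"])
    fix x assume x: "x \<in> cball (snd c p) r"
    then obtain q where q: "q \<in> fst c" "x = snd c q" using sub by blast
    show "bilinear (local_rep c g x)"
      using bilinear_fieldD(1)[OF gb c(1) q(1)] by (simp add: q local_rep_chart[OF ch])
    show "0 < local_rep c g x v v" if "v \<noteq> 0" for v
      using riemannianD(3)[OF g c(1) q(1) _ that] by (simp add: q local_rep_chart[OF ch])
  next
    show "continuous_on (cball (snd c p) r) (\<lambda>x. local_rep c g x v w)" for v w
      using smooth_on_imp_continuous_on[OF bilinear_fieldD(2)[OF gb c(1), of v w]] sub
      by (auto intro: continuous_on_subset)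
  qed auto
  show ?thesis
  proof (rule that[OF c r mM(1,2)])
    fix q v assume q: "q \<in> fst c" "snd c q \<in> cball (snd c p) r"
    show "m * norm v \<le> sqrt (g c q v v)" "sqrt (g c q v v) \<le> M * norm v"
      using mM(3)[OF q(2), of v] mM(4)[OF q(2), of v] unfolding local_rep_chart[OF ch q(1)] by auto
  qed
qed

text \<open>A path ending in \<open>p\<close> that starts outside \<open>V\<close> must cross a
  coordinate ball of radius \<open>r\<close> contained in \<open>V\<close>, and the part of it after
  the last entrance has length at least \<open>m * r\<close>.\<close>

lemma riem_dist_small_imp_near:
  fixes \<A> :: "('m::t2_space, 'e::euclidean_space) chart set"
  assumes A: "smooth_structure \<A>" and g: "riemannian \<A> UNIV g" and V: "open V" "p \<in> V"
  shows "\<exists>\<epsilon>>0. \<forall>q. riem_dist \<A> g q p < ennreal \<epsilon> \<longrightarrow> q \<in> V"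
proof -
  obtain c r m M where c: "c \<in> \<A>" "p \<in> fst c" and r: "r > 0" "cball (snd c p) r \<subseteq> snd c ` (fst c \<inter> V)"
    and m: "m > 0" "\<And>q v. q \<in> fst c \<Longrightarrow> snd c q \<in> cball (snd c p) r \<Longrightarrow> m * norm v \<le> sqrt (g c q v v)"
    using chart_ball[OF A g V] by metis
  have ch: "is_chart c" using A c smooth_structure_chart by blast
  define U where "U = fst c \<inter> snd c -` ball (snd c p) r"
  define Z where "Z = inv_chart c ` cball (snd c p) r"
  have U: "open U" unfolding U_def
    by (rule continuous_open_preimage[OF continuous_on_chart[OF ch] open_chart_domain[OF ch] open_ball])
  have "compact Z" unfolding Z_def
    by (rule compact_continuous_image[OF continuous_on_subset[OF continuous_on_inv_chart[OF ch]] compact_cball])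
      (use r in blast)
  \<comment> \<open>Uses the Hausdorff property: the closed coordinate ball is closed in the
    manifold, so a path cannot leave the chart in the limit.\<close>
  then have Z: "closed Z" by (rule compact_imp_closed)
  have Zc: "y \<in> fst c" "y \<in> V" "snd c y \<in> cball (snd c p) r" if y: "y \<in> Z" for y
  proof -
    obtain x where x: "x \<in> cball (snd c p) r" "y = inv_chart c x" using y by (auto simp: Z_def)
    then obtain q where "q \<in> fst c \<inter> V" "x = snd c q" using r by blast
    then show "y \<in> fst c" "y \<in> V" "snd c y \<in> cball (snd c p) r" using x by (simp_all add: inv_chart_image[OF ch])
  qed
  have UZ: "U \<subseteq> Z"
  proof
    fix y assume "y \<in> U"
    then have "y = inv_chart c (snd c y)" "snd c y \<in> cball (snd c p) r" by (auto simp: U_def inv_chart_image[OF ch])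
    then show "y \<in> Z" unfolding Z_def by blast
  qed
  have "q \<in> V" if lt: "riem_dist \<A> g q p < ennreal (m * r)" for q
  proof (rule ccontr)
    assume q: "q \<notin> V"
    obtain \<gamma> where \<gamma>: "piecewise_C1_path \<A> \<gamma>" "\<gamma> 0 = q" "\<gamma> 1 = p" "ennreal (integral {0..1} (speed \<A> g \<gamma>)) < ennreal (m * r)"
      using lt unfolding riem_dist_def INF_less_iff by blast
    have len: "integral {0..1} (speed \<A> g \<gamma>) < m * r"
      using \<gamma>(4) m(1) r(1) by (metis ennreal_leI leD leI)
    obtain K where K: "finite K" and piece: "\<And>a b. 0 \<le> a \<Longrightarrow> a < b \<Longrightarrow> b \<le> 1 \<Longrightarrow> {a<..<b} \<inter> K = {} \<Longrightarrow> C1_path_on \<A> \<gamma> {a..b}"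
      using \<gamma>(1) unfolding piecewise_C1_path_def by blast
    have cont: "continuous_on {0..1} \<gamma>" using \<gamma>(1) unfolding piecewise_C1_path_def by blast
    have "closed ({0..1} \<inter> \<gamma> -` (- U))"
      by (rule continuous_closed_preimage[OF cont]) (use U in auto)
    then have "compact ({0..1} \<inter> \<gamma> -` (- U))"
      by (metis compact_Icc compact_Int_closed inf.left_idem)
    moreover have "0 \<in> {0..1} \<inter> \<gamma> -` (- U)" using q \<gamma>(2) UZ Zc by auto
    then have "{0..1} \<inter> \<gamma> -` (- U) \<noteq> {}" by blast
    ultimately have "\<exists>s\<in>{0..1} \<inter> \<gamma> -` (- U). \<forall>t\<in>{0..1} \<inter> \<gamma> -` (- U). t \<le> s"
      by (rule compact_attains_sup)
    \<comment> \<open>The last time outside the open ball; from then on the path stays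
      inside.\<close>
    then obtain t0 where t0: "t0 \<in> {0..1} \<inter> \<gamma> -` (- U)" "\<And>t. t \<in> {0..1} \<inter> \<gamma> -` (- U) \<Longrightarrow> t \<le> t0"
      by blast
    have "p \<in> U" using c r by (simp add: U_def)
    then have t01: "0 \<le> t0" "t0 < 1" using t0(1) \<gamma>(3) by (auto simp: order.order_iff_strict)
    have inU: "\<gamma> t \<in> U" if "t \<in> {t0<..1}" for t
      using t0(2)[of t] that t01 by force
    have "closed ({t0..1} \<inter> \<gamma> -` Z)"
      by (rule continuous_closed_preimage[OF continuous_on_subset[OF cont]]) (use t01 Z in auto)
    moreover have "{t0<..1} \<subseteq> {t0..1} \<inter> \<gamma> -` Z" using inU UZ by force
    ultimately have "closure {t0<..1} \<subseteq> {t0..1} \<inter> \<gamma> -` Z" by (rule closure_minimal[rotated])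
    \<comment> \<open>Closedness of \<open>Z\<close> includes the time \<open>t0\<close> itself, so
      the coordinates of the path are defined and continuous on the closed interval.\<close>
    then have inZ: "\<gamma> t \<in> Z" if "t \<in> {t0..1}" for t
      using that t01 by auto
    define \<sigma> where "\<sigma> = snd c \<circ> \<gamma>"
    have \<sigma>cont: "continuous_on {t0..1} \<sigma>"
      unfolding \<sigma>_def o_def
      by (rule continuous_on_compose2[OF continuous_on_chart[OF ch] continuous_on_subset[OF cont]])
        (use t01 inZ Zc in auto)
    define f where "f t = vector_derivative \<sigma> (at t)" for t
    have der: "(\<sigma> has_vector_derivative f t) (at t) \<and> m * norm (f t) \<le> speed \<A> g \<gamma> t"
      if t: "t \<in> {t0<..<1} - K" for t
    proof -
      obtain d where d: "d > 0" "\<And>k. k \<in> K \<Longrightarrow> k \<noteq> t \<Longrightarrow> d \<le> dist t k"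
        using finite_set_avoid[OF K, of t] by blast
      define a where "a = max ((t0 + t) / 2) (t - d)"
      define b where "b = min ((1 + t) / 2) (t + d)"
      have ab: "a < t" "t < b" "t0 < a" "b < 1" "t - d \<le> a" "b \<le> t + d"
        using t d(1) by (auto simp: a_def b_def less_max_iff_disj min_less_iff_disj)
      have "{a<..<b} \<inter> K = {}"
      proof -
        have False if k: "k \<in> {a<..<b}" "k \<in> K" for k
        proof -
          have "k \<noteq> t" using k t by auto
          then have "d \<le> dist t k" using d k by blast
          moreover have "t - d < k" "k < t + d" using k ab by auto
          ultimately show False by (auto simp: dist_real_def)
        qed
        then show ?thesis by blast
      qed
      then have C1: "C1_path_on \<A> \<gamma> {a..b}" using ab t01 by (intro piece) auto
      have sub: "\<gamma> ` {a..b} \<subseteq> fst c" using inZ Zc ab by force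
      have tab: "t \<in> {a<..<b}" using ab by simp
      have tZ: "\<gamma> t \<in> Z" using inZ t by simp
      show ?thesis
        using speed_on_piece(1)[OF A g C1 c(1) sub tab] m(2)[OF Zc(1)[OF tZ] Zc(3)[OF tZ]]
        by (simp add: f_def \<sigma>_def)
    qed
    have int: "(f has_integral (\<sigma> 1 - \<sigma> t0)) {t0..1}"
      by (rule fundamental_theorem_of_calculus_interior_strong[OF K]) (use t01 der \<sigma>cont in auto)
    \<comment> \<open>At the break points and end points nothing bounds \<open>f\<close>; setting it
      to \<open>0\<close> there keeps the integral and makes the norm bound valid
      everywhere.\<close>
    define f' where "f' t = (if t \<in> insert t0 (insert 1 K) then 0 else f t)" for t
    have int': "(f' has_integral (\<sigma> 1 - \<sigma> t0)) {t0..1}"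
      by (rule has_integral_spike_finite[OF _ _ int, of "insert t0 (insert 1 K)"]) (use K in \<open>auto simp: f'_def\<close>)
    have spi: "speed \<A> g \<gamma> integrable_on {t0..1}"
      by (rule integrable_subinterval_real[OF speed_integrable[OF A g \<gamma>(1)]]) (use t01 in auto)
    have le: "norm (f' t) \<le> speed \<A> g \<gamma> t * (1 / m)" if t: "t \<in> {t0..1}" for t
      using der[of t] speed_nonneg[OF A g, of \<gamma> t] t m(1)
      by (auto simp: f'_def field_simps)
    have "norm (integral {t0..1} f') \<le> integral {t0..1} (\<lambda>t. speed \<A> g \<gamma> t * (1 / m))"
      by (rule integral_norm_bound_integral[OF has_integral_integrable[OF int'] integrable_on_mult_left[OF spi] le])
    then have "norm (\<sigma> 1 - \<sigma> t0) \<le> integral {t0..1} (speed \<A> g \<gamma>) * (1 / m)"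
      using integral_unique[OF int'] by simp
    also have "\<dots> \<le> integral {0..1} (speed \<A> g \<gamma>) * (1 / m)"
      using m(1) t01 by (intro mult_right_mono integral_subset_le spi speed_integrable[OF A g \<gamma>(1)])
        (auto simp: speed_nonneg[OF A g])
    also have "\<dots> < r" using len m(1) by (simp add: field_simps)
    finally have "norm (\<sigma> 1 - \<sigma> t0) < r" .
    moreover have "\<gamma> t0 \<in> fst c" using inZ[of t0] Zc t01 by auto
    then have "r \<le> norm (\<sigma> 1 - \<sigma> t0)" using t0(1) by (auto simp: U_def \<sigma>_def \<gamma>(3) dist_norm)
    ultimately show False by linarith
  qed
  then show ?thesis using m(1) r(1) by (intro exI[of _ "m * r"]) auto
qed

text \<open>The straight coordinate segment from \<open>q\<close> to \<open>p\<close> is an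
  admissible path, of length at most \<open>M\<close> times the coordinate distance.\<close>

lemma near_imp_riem_dist_small:
  assumes A: "smooth_structure \<A>" and g: "riemannian \<A> UNIV g" and \<delta>: "\<delta> > 0"
  shows "\<exists>V. open V \<and> p \<in> V \<and> (\<forall>q\<in>V. riem_dist \<A> g q p < ennreal \<delta>)"
proof -
  obtain c r M where c: "c \<in> \<A>" "p \<in> fst c" and r: "r > 0" "cball (snd c p) r \<subseteq> snd c ` (fst c \<inter> UNIV)"
    and M: "M > 0" "\<And>q v. q \<in> fst c \<Longrightarrow> snd c q \<in> cball (snd c p) r \<Longrightarrow> sqrt (g c q v v) \<le> M * norm v"
    using chart_ball[OF A g open_UNIV UNIV_I, of p] by metis
  have ch: "is_chart c" using A c smooth_structure_chart by blast
  \<comment> \<open>The factor \<open>2\<close> gives \<open>M * \<rho> \<le> \<delta> / 2\<close>,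
    hence a strict bound.\<close>
  define \<rho> where "\<rho> = min r (\<delta> / (2 * M))"
  have \<rho>: "\<rho> > 0" "\<rho> \<le> r" "M * \<rho> < \<delta>"
  proof -
    show "\<rho> > 0" "\<rho> \<le> r" using r M \<delta> by (simp_all add: \<rho>_def)
    have "M * \<rho> \<le> M * (\<delta> / (2 * M))" using M by (intro mult_left_mono) (simp_all add: \<rho>_def)
    then show "M * \<rho> < \<delta>" using M \<delta> by simp
  qed
  define V where "V = fst c \<inter> snd c -` ball (snd c p) \<rho>"
  have "open V" unfolding V_def
    by (rule continuous_open_preimage[OF continuous_on_chart[OF ch] open_chart_domain[OF ch] open_ball])
  moreover have "p \<in> V" using c \<rho> by (simp add: V_def)
  moreover have "riem_dist \<A> g q p < ennreal \<delta>" if q: "q \<in> V" for q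
  proof -
    define w where "w = snd c p - snd c q"
    define l where "l t = snd c q + t *\<^sub>R w" for t :: real
    define \<gamma> where "\<gamma> t = inv_chart c (l t)" for t
    have lb: "l t \<in> ball (snd c p) \<rho>" if "t \<in> {0..1}" for t
    proof -
      have "l t = (1 - t) *\<^sub>R snd c q + t *\<^sub>R snd c p" by (simp add: l_def w_def algebra_simps)
      moreover have "snd c q \<in> ball (snd c p) \<rho>" "snd c p \<in> ball (snd c p) \<rho>" using q \<rho> by (auto simp: V_def)
      ultimately show ?thesis using convex_ball[of "snd c p" \<rho>] that unfolding convex_alt by auto
    qed
    have lc: "l t \<in> cball (snd c p) r" "l t \<in> snd c ` fst c" if "t \<in> {0..1}" for t
    proof -
      show *: "l t \<in> cball (snd c p) r" using lb[OF that] \<rho>(2) by auto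
      show "l t \<in> snd c ` fst c" using * r by blast
    qed
    have \<gamma>c: "\<gamma> t \<in> fst c" "snd c (\<gamma> t) = l t" if "t \<in> {0..1}" for t
      using lc[OF that] by (simp_all add: \<gamma>_def inv_chart_mem[OF ch] snd_inv_chart[OF ch])
    have lder: "(l has_vector_derivative w) (at t within S)" for t S
      unfolding l_def by (auto intro!: derivative_eq_intros)
    have lcont: "continuous_on S l" for S unfolding l_def by (intro continuous_intros)
    have \<gamma>cont: "continuous_on {0..1} \<gamma>" unfolding \<gamma>_def
      by (rule continuous_on_compose2[OF continuous_on_inv_chart[OF ch] lcont]) (use lc in blast)
    have C1: "C1_path_on \<A> \<gamma> {a..b}" if "0 \<le> a" "b \<le> 1" for a b
      unfolding C1_path_on_def Let_def
    proof (intro conjI ballI)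
      show "continuous_on {a..b} \<gamma>" by (rule continuous_on_subset[OF \<gamma>cont]) (use that in auto)
      fix d assume d: "d \<in> \<A>"
      let ?S = "{t \<in> {a..b}. \<gamma> t \<in> fst d}"
      have S: "t \<in> {0..1}" if "t \<in> ?S" for t using that \<open>0 \<le> a\<close> \<open>b \<le> 1\<close> by auto
      show "\<exists>D. continuous_on ?S D \<and> (\<forall>t\<in>?S. ((snd d \<circ> \<gamma>) has_vector_derivative D t) (at t within ?S))"
      proof (intro exI conjI ballI)
        have "continuous_on ?S (\<lambda>t. frechet_derivative (transition c d) (at (l t)) w)"
        proof (rule continuous_on_compose2[OF smooth_on_imp_continuous_on[OF smooth_on_frechet_derivative[OF
                  smooth_on_transition[OF A c(1) d]]] lcont], safe)
          fix t assume t: "t \<in> {a..b}" "\<gamma> t \<in> fst d"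
          then have "t \<in> {0..1}" using S by blast
          then show "l t \<in> snd c ` (fst c \<inter> fst d)" using \<gamma>c[of t] t by force
        qed
        then show "continuous_on ?S (\<lambda>t. change c d (\<gamma> t) w)"
          by (rule continuous_on_cong[THEN iffD1, rotated 2]) (use S in \<open>auto simp: change_def \<gamma>c\<close>)
        fix t assume t: "t \<in> ?S"
        have t1: "t \<in> {0..1}" using S[OF t] .
        have lin: "linear (change c d (\<gamma> t))"
          using t by (intro linear_change[OF A c(1) d \<gamma>c(1)[OF t1]]) auto
        have "(transition c d has_derivative change c d (\<gamma> t)) (at (l t))"
          using has_derivative_transition[OF A c(1) d \<gamma>c(1)[OF t1]] t by (simp add: \<gamma>c(2)[OF t1])
        then have "((\<lambda>s. transition c d (l s)) has_derivative (\<lambda>h. change c d (\<gamma> t) (h *\<^sub>R w))) (at t within ?S)"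
          by (rule has_derivative_compose[OF lder[unfolded has_vector_derivative_def]])
        moreover have "snd d \<circ> \<gamma> = (\<lambda>s. transition c d (l s))" by (simp add: fun_eq_iff \<gamma>_def transition_def)
        ultimately show "((snd d \<circ> \<gamma>) has_vector_derivative change c d (\<gamma> t) w) (at t within ?S)"
          by (simp add: has_vector_derivative_def linear_scale[OF lin])
      qed
    qed
    have pw: "piecewise_C1_path \<A> \<gamma>"
      unfolding piecewise_C1_path_def using \<gamma>cont C1 by (intro conjI exI[of _ "{}"]) auto
    have ends: "\<gamma> 0 = q" "\<gamma> 1 = p"
      using q c by (simp_all add: \<gamma>_def l_def w_def V_def inv_chart_image[OF ch])
    have sp: "speed \<A> g \<gamma> t \<le> M * norm w" if t: "t \<in> {0<..<1}" for t
    proof -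
      have t1: "t \<in> {0..1}" using t by auto
      have "((snd c \<circ> \<gamma>) has_vector_derivative w) (at t)"
        by (rule has_vector_derivative_transform_within_open[OF lder[of t UNIV] _ t]) (auto simp: \<gamma>c)
      moreover have "isCont \<gamma> t"
        using \<gamma>cont t by (simp add: continuous_on_interior interior_atLeastAtMost_real)
      ultimately have "speed \<A> g \<gamma> t = sqrt (g c (\<gamma> t) w w)"
        using speed_eq[where \<gamma> = \<gamma> and t = t, OF A riemannianD(1)[OF g] c(1) \<gamma>c(1)[OF t1]] by blast
      then show ?thesis using M(2)[OF \<gamma>c(1)[OF t1]] lc[OF t1] \<gamma>c(2)[OF t1] by simp
    qed
    \<comment> \<open>The speed bound is established on the open interval only; altering two values
      does not change the integral.\<close>
    define f where "f t = (if t \<in> {0, 1} then 0 else speed \<A> g \<gamma> t)" for t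
    have "f integrable_on {0..1}"
      by (rule integrable_spike_finite[OF _ _ speed_integrable[OF A g pw], of "{0,1}"]) (auto simp: f_def)
    then have "integral {0..1} f \<le> integral {0..1} (\<lambda>t::real. M * norm w)"
    proof (rule integral_le)
      show "f t \<le> M * norm w" if "t \<in> {0..1}" for t using sp[of t] that M(1) by (auto simp: f_def)
    qed auto
    moreover have "integral {0..1} (speed \<A> g \<gamma>) = integral {0..1} f"
      by (rule integral_spike[of "{0,1}"]) (auto simp: f_def)
    moreover have "norm w < \<rho>" using q by (simp add: w_def V_def dist_norm)
    then have "M * norm w < M * \<rho>" using M(1) by simp
    ultimately have lt: "integral {0..1} (speed \<A> g \<gamma>) < \<delta>" using \<rho>(3) by simp
    have "riem_dist \<A> g q p \<le> ennreal (integral {0..1} (speed \<A> g \<gamma>))"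
      unfolding riem_dist_def by (rule INF_lower) (use pw ends in auto)
    also have "\<dots> < ennreal \<delta>" using lt \<delta> by (simp add: ennreal_lessI)
    finally show ?thesis .
  qed
  ultimately show ?thesis by blast
qed

lemma riem_dist_mono:
  assumes A: "smooth_structure \<A>" and g: "riemannian \<A> UNIV g" and h: "riemannian \<A> UNIV h"
    and le: "\<And>c p v. c \<in> \<A> \<Longrightarrow> p \<in> fst c \<Longrightarrow> g c p v v \<le> h c p v v"
  shows "riem_dist \<A> g p q \<le> riem_dist \<A> h p q"
  unfolding riem_dist_def
proof (rule INF_mono)
  fix \<gamma> assume \<gamma>: "\<gamma> \<in> {\<gamma>. piecewise_C1_path \<A> \<gamma> \<and> \<gamma> 0 = p \<and> \<gamma> 1 = q}"
  have "speed \<A> g \<gamma> t \<le> speed \<A> h \<gamma> t" for t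
  proof -
    obtain c where "c \<in> \<A>" "\<gamma> t \<in> fst c" using smooth_structure_cover[OF A] .
    then have "(SOME c. c \<in> \<A> \<and> \<gamma> t \<in> fst c) \<in> \<A> \<and> \<gamma> t \<in> fst (SOME c. c \<in> \<A> \<and> \<gamma> t \<in> fst c)"
      by (intro someI_ex[of "\<lambda>c. c \<in> \<A> \<and> \<gamma> t \<in> fst c"]) blast
    then show ?thesis using le by (simp add: speed_def Let_def)
  qed
  then have "integral {0..1} (speed \<A> g \<gamma>) \<le> integral {0..1} (speed \<A> h \<gamma>)"
    using \<gamma> by (intro integral_le speed_integrable[OF A g] speed_integrable[OF A h]) auto
  then show "\<exists>\<gamma>'\<in>{\<gamma>. piecewise_C1_path \<A> \<gamma> \<and> \<gamma> 0 = p \<and> \<gamma> 1 = q}.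
      ennreal (integral {0..1} (speed \<A> g \<gamma>')) \<le> ennreal (integral {0..1} (speed \<A> h \<gamma>))"
    using \<gamma> by (intro bexI[of _ \<gamma>] ennreal_leI) auto
qed

text \<open>The limit \<open>p\<close> for \<open>g\<close> is also a limit for the larger
  \<open>h\<close>: an \<open>h\<close>-ball around \<open>p\<close> contains a neighbourhood of
  \<open>p\<close>, and this neighbourhood contains a \<open>g\<close>-ball.\<close>

lemma complete_riemannian_mono:
  fixes \<A> :: "('m::t2_space, 'e::euclidean_space) chart set"
  assumes A: "smooth_structure \<A>" and g: "complete_riemannian \<A> g" and h: "riemannian \<A> UNIV h"
    and le: "\<And>c p v. c \<in> \<A> \<Longrightarrow> p \<in> fst c \<Longrightarrow> g c p v v \<le> h c p v v"
  shows "complete_riemannian \<A> h"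
  unfolding complete_riemannian_def
proof (intro conjI allI impI)
  show "riemannian \<A> UNIV h" by (rule h)
  have gr: "riemannian \<A> UNIV g" using g unfolding complete_riemannian_def by blast
  fix s :: "nat \<Rightarrow> 'm"
  assume "\<forall>\<epsilon>>0. \<exists>N. \<forall>i\<ge>N. \<forall>j\<ge>N. riem_dist \<A> h (s i) (s j) < \<epsilon>"
  then have "\<forall>\<epsilon>>0. \<exists>N. \<forall>i\<ge>N. \<forall>j\<ge>N. riem_dist \<A> g (s i) (s j) < \<epsilon>"
    using riem_dist_mono[OF A gr h le] by (meson le_less_trans)
  then obtain p where p: "(\<lambda>i. riem_dist \<A> g (s i) p) \<longlonglongrightarrow> 0"
    using g unfolding complete_riemannian_def by blast
  have "(\<lambda>i. riem_dist \<A> h (s i) p) \<longlonglongrightarrow> 0"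
  proof (rule order_tendstoI)
    fix a :: ennreal assume "0 < a"
    then obtain \<delta> where \<delta>: "\<delta> > 0" "ennreal \<delta> \<le> a"
    proof (cases a)
      case (real r)
      then show ?thesis using \<open>0 < a\<close> that[of r] by simp
    next
      case top
      then show ?thesis using that[of 1] by simp
    qed
    obtain V where V: "open V" "p \<in> V" "\<And>q. q \<in> V \<Longrightarrow> riem_dist \<A> h q p < ennreal \<delta>"
      using near_imp_riem_dist_small[OF A h \<delta>(1), of p] by auto
    obtain \<epsilon> where \<epsilon>: "\<epsilon> > 0" "\<And>q. riem_dist \<A> g q p < ennreal \<epsilon> \<Longrightarrow> q \<in> V"
      using riem_dist_small_imp_near[OF A gr V(1,2)] by auto
    have "\<forall>\<^sub>F i in sequentially. riem_dist \<A> g (s i) p < ennreal \<epsilon>"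
      using order_tendstoD(2)[OF p, of "ennreal \<epsilon>"] \<epsilon>(1) by simp
    then show "\<forall>\<^sub>F i in sequentially. riem_dist \<A> h (s i) p < a"
      by eventually_elim (rule less_le_trans[OF V(3)[OF \<epsilon>(2)] \<delta>(2)])
  qed simp
  then show "\<exists>p. (\<lambda>i. riem_dist \<A> h (s i) p) \<longlonglongrightarrow> 0" by blast
qed


section \<open>Extension to the whole manifold\<close>

lemma bilinear_field_dense_eq:
  assumes A: "smooth_structure \<A>" "closure W = UNIV"
    and B: "bilinear_field \<A> UNIV B" "bilinear_field \<A> UNIV B'"
    and c: "c \<in> \<A>" "p \<in> fst c" and eq: "\<And>q. q \<in> fst c \<inter> W \<Longrightarrow> B c q v w = B' c q v w"
  shows "B c p v w = B' c p v w"
proof -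
  have ch: "is_chart c" using A c smooth_structure_chart by blast
  have "local_rep c B (snd c p) v w = local_rep c B' (snd c p) v w"
    by (rule dense_eq[OF ch A(2), where f = "\<lambda>x. local_rep c B x v w" and g = "\<lambda>x. local_rep c B' x v w"])
      (use c eq smooth_on_imp_continuous_on[OF bilinear_fieldD(2)[OF B(1) c(1)]]
        smooth_on_imp_continuous_on[OF bilinear_fieldD(2)[OF B(2) c(1)]] in \<open>auto simp: local_rep_chart[OF ch]\<close>)
  then show ?thesis by (simp add: local_rep_chart[OF ch c(2)])
qed

lemma hermitianD:
  assumes "hermitian \<A> W g J"
  shows "riemannian \<A> W g" "complex_structure \<A> W J"
    "c \<in> \<A> \<Longrightarrow> p \<in> fst c \<Longrightarrow> p \<in> W \<Longrightarrow> g c p (J c p v) (J c p w) = g c p v w"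
  using assms unfolding hermitian_def by blast+

lemma kaehlerD:
  assumes "kaehler \<A> W F g J"
  shows "hermitian \<A> W g J" "symplectic \<A> W F"
    "c \<in> \<A> \<Longrightarrow> p \<in> fst c \<Longrightarrow> p \<in> W \<Longrightarrow> F c p v w = g c p (J c p v) w"
proof -
  show "hermitian \<A> W g J" "symplectic \<A> W F" using assms unfolding kaehler_def by blast+
  assume "c \<in> \<A>" "p \<in> fst c" "p \<in> W"
  then have "F c p = fund_form g J c p" using assms unfolding kaehler_def by blast
  then show "F c p v w = g c p (J c p v) w" by (simp add: fund_form_def)
qed

lemma kaehler_metric:
  assumes K: "kaehler \<A> W F g J" and c: "c \<in> \<A>" "p \<in> fst c" "p \<in> W"
  shows "F c p v (J c p w) = g c p v w" "F c p (J c p v) w = - g c p v w"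
proof -
  show "F c p v (J c p w) = g c p v w"
    unfolding kaehlerD(3)[OF K c] by (rule hermitianD(3)[OF kaehlerD(1)[OF K] c])
  have "bilinear (g c p)"
    by (rule bilinear_fieldD(1)[OF riemannianD(1)[OF hermitianD(1)[OF kaehlerD(1)[OF K]]] c])
  then show "F c p (J c p v) w = - g c p v w"
    unfolding kaehlerD(3)[OF K c] complex_structureD(2)[OF hermitianD(2)[OF kaehlerD(1)[OF K]] c]
    by (rule bilinear_lneg)
qed

locale toric_deformation =
  fixes \<A> :: "('m::topological_space, 'n::finite model) chart set"
    and M0 :: "'m set" and A :: "real ^ 'n ^ 'n"
    and F F' g\<^sub>K g :: "('m, 'n model) bil_field" and J\<^sub>K I J :: "('m, 'n model) end_field"
    and X X' :: "'n \<Rightarrow> ('m, 'n model) vec_field"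
  assumes M: "smooth_structure \<A>"
    and M0: "open M0" "closure M0 = UNIV"
    and toric: "locally_toric_kaehler \<A> M0 F g\<^sub>K J\<^sub>K X"
    and deformation: "A_deformation \<A> M0 A F g\<^sub>K J\<^sub>K X g I J"
    and extension: "toric_extension \<A> M0 F X F' X'"
begin

lemma skew_A: "transpose A = - A" "transpose (- A) = - (- A)"
proof -
  show "transpose A = - A" using deformation unfolding A_deformation_def by blast
  from arg_cong[OF this, of uminus] show "transpose (- A) = - (- A)" by (simp add: transpose_def vec_eq_iff)
qed

lemma symplectic_F': "symplectic \<A> UNIV F'"
  using extension unfolding toric_extension_def by blast

lemma vector_field_X': "vector_field \<A> UNIV (X' i)"
  using extension unfolding toric_extension_def by blast

lemma kaehler_on_M0: "kaehler \<A> M0 F g\<^sub>K J\<^sub>K"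
  using toric unfolding locally_toric_kaehler_def by blast

lemma F'_eq: "c \<in> \<A> \<Longrightarrow> p \<in> fst c \<Longrightarrow> p \<in> M0 \<Longrightarrow> F' c p = F c p"
  using extension unfolding toric_extension_def agree_on_def by blast

lemma X'_eq: "c \<in> \<A> \<Longrightarrow> p \<in> fst c \<Longrightarrow> p \<in> M0 \<Longrightarrow> X' i c p = X i c p"
  using extension unfolding toric_extension_def agree_on_def by blast

lemma shear_eq_on_M0:
  "c \<in> \<A> \<Longrightarrow> p \<in> fst c \<Longrightarrow> p \<in> M0 \<Longrightarrow> L' c p = L c p \<Longrightarrow> shear B F' X' L' c p = shear B F X L c p"
  by (simp add: shear_def[abs_def] bivector_def F'_eq X'_eq)

text \<open>The fields \<open>X'\<close> may become dependent or vanish off \<open>M0\<close>, but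
  isotropy of their span is a closed condition and survives there.\<close>

lemma isotropic:
  assumes c: "c \<in> \<A>" "p \<in> fst c"
  shows "F' c p (X' i c p) (X' j c p) = 0"
proof -
  have ch: "is_chart c" using M c smooth_structure_chart by blast
  have X'_smooth: "smooth_on (local_rep c (X' i)) (snd c ` fst c)" for i
    using vector_fieldD(1)[OF vector_field_X' c(1)] by simp
  have "local_rep c F' (snd c p) (local_rep c (X' i) (snd c p)) (local_rep c (X' j) (snd c p)) = 0"
  proof (rule dense_eq[OF ch M0(2) _ continuous_on_const _ c(2),
        where f = "\<lambda>x. local_rep c F' x (local_rep c (X' i) x) (local_rep c (X' j) x)"])
    show "continuous_on (snd c ` fst c) (\<lambda>x. local_rep c F' x (local_rep c (X' i) x) (local_rep c (X' j) x))"
      by (intro smooth_on_imp_continuous_on smooth_bilinear_field_app[OF M symplecticD(1)[OF symplectic_F'] c(1)] X'_smooth)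
    fix q assume q: "q \<in> fst c \<inter> M0"
    then have "F c q (X i c q) (X j c q) = 0"
      using toric c(1) unfolding locally_toric_kaehler_def by blast
    then show "local_rep c F' (snd c q) (local_rep c (X' i) (snd c q)) (local_rep c (X' j) (snd c q)) = 0"
      using q c(1) by (simp add: local_rep_chart[OF ch] F'_eq X'_eq)
  qed
  then show ?thesis by (simp add: local_rep_chart[OF ch c(2)])
qed

lemma tamed_isotropicI:
  assumes "transpose B = - B" "endo_field \<A> UNIV L"
    "\<And>c p v. c \<in> \<A> \<Longrightarrow> p \<in> fst c \<Longrightarrow> L c p (L c p v) = - v"
    "\<And>c p v. c \<in> \<A> \<Longrightarrow> p \<in> fst c \<Longrightarrow> v \<noteq> 0 \<Longrightarrow> 0 < F' c p v (L c p v)"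
  shows "tamed_isotropic \<A> B F' X' L"
  by (unfold_locales; rule M assms symplecticD(1)[OF symplectic_F'] symplecticD(2)[OF symplectic_F' _ _ UNIV_I] vector_field_X' isotropic)

lemma complex_structure_extend:
  assumes K: "endo_field \<A> UNIV K" "\<And>c p v. c \<in> \<A> \<Longrightarrow> p \<in> fst c \<Longrightarrow> K c p (K c p v) = - v"
    and agree: "agree_on \<A> M0 L K"
    and N: "\<And>c p u v. c \<in> \<A> \<Longrightarrow> p \<in> fst c \<Longrightarrow> p \<in> M0 \<Longrightarrow> nijenhuis (local_rep c L) (snd c p) u v = 0"
  shows "complex_structure \<A> UNIV K"
  unfolding complex_structure_def
  using K nijenhuis_extend[OF M M0 K(1) agree] N by blast

section \<open>From a Kaehler extension to a generalized Kaehler one\<close>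

context
  fixes g\<^sub>K' J\<^sub>K'
  assumes ext: "kaehler_extension \<A> M0 F' g\<^sub>K J\<^sub>K g\<^sub>K' J\<^sub>K'"
begin

lemma kaehler_ext: "kaehler \<A> UNIV F' g\<^sub>K' J\<^sub>K'"
  and J\<^sub>K'_eq: "c \<in> \<A> \<Longrightarrow> p \<in> fst c \<Longrightarrow> p \<in> M0 \<Longrightarrow> J\<^sub>K' c p = J\<^sub>K c p"
  using ext unfolding kaehler_extension_def agree_on_def by blast+

lemma tamed_kaehler: "transpose B = - B \<Longrightarrow> tamed_isotropic \<A> B F' X' J\<^sub>K'"
proof (rule tamed_isotropicI)
  note h = hermitianD[OF kaehlerD(1)[OF kaehler_ext]]
  show "endo_field \<A> UNIV J\<^sub>K'" by (rule complex_structureD(1)[OF h(2)])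
  show "J\<^sub>K' c p (J\<^sub>K' c p v) = - v" if "c \<in> \<A>" "p \<in> fst c" for c p v
    by (rule complex_structureD(2)[OF h(2) that UNIV_I])
  show "0 < F' c p v (J\<^sub>K' c p v)" if "c \<in> \<A>" "p \<in> fst c" "v \<noteq> 0" for c p v
    unfolding kaehler_metric(1)[OF kaehler_ext that(1,2) UNIV_I]
    by (rule riemannianD(3)[OF h(1) that(1,2) UNIV_I that(3)])
qed

lemma gk_extension_deform:
  "gk_extension \<A> M0 g I J (sym_form F' (deform A F' X' J\<^sub>K')) (deform (- A) F' X' J\<^sub>K') (deform A F' X' J\<^sub>K')"
proof -
  interpret p: tamed_isotropic \<A> A F' X' J\<^sub>K' by (rule tamed_kaehler[OF skew_A(1)])
  interpret m: tamed_isotropic \<A> "- A" F' X' J\<^sub>K' by (rule tamed_kaehler[OF skew_A(2)])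
  note ids = A_deformation_identities[OF M M0(1) toric deformation]
  have J_eq: "J c p v = deform A F' X' J\<^sub>K' c p v" if c: "c \<in> \<A>" "p \<in> fst c" "p \<in> M0" for c p v
    by (rule p.deform_eqI[OF c(1,2)]) (simp add: shear_eq_on_M0[where L' = J\<^sub>K' and L = J\<^sub>K, OF c J\<^sub>K'_eq[OF c]] J\<^sub>K'_eq[OF c] ids(1)[OF c])
  have I_eq: "I c p v = deform (- A) F' X' J\<^sub>K' c p v" if c: "c \<in> \<A>" "p \<in> fst c" "p \<in> M0" for c p v
    by (rule m.deform_eqI[OF c(1,2)]) (simp add: shear_eq_on_M0[where L' = J\<^sub>K' and L = J\<^sub>K, OF c J\<^sub>K'_eq[OF c]] J\<^sub>K'_eq[OF c] ids(2)[OF c])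
  have agree: "agree_on \<A> M0 J (deform A F' X' J\<^sub>K')" "agree_on \<A> M0 I (deform (- A) F' X' J\<^sub>K')"
    unfolding agree_on_def using J_eq I_eq by (auto simp: fun_eq_iff)
  have cJ: "complex_structure \<A> UNIV (deform A F' X' J\<^sub>K')"
    by (rule complex_structure_extend[OF p.endo_field_deform p.deform_square agree(1) ids(5)])
  have cI: "complex_structure \<A> UNIV (deform (- A) F' X' J\<^sub>K')"
    by (rule complex_structure_extend[OF m.endo_field_deform m.deform_square agree(2) ids(6)])
  have "generalized_kaehler \<A> UNIV (sym_form F' (deform A F' X' J\<^sub>K')) (deform (- A) F' X' J\<^sub>K') (deform A F' X' J\<^sub>K')"
  proof (rule generalized_kaehler_sym_form[OF M symplectic_F' cI cJ p.deform_tame])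
    fix c p v w assume c: "c \<in> \<A>" "p \<in> fst c"
    show "F' c p (deform (- A) F' X' J\<^sub>K' c p v) w = - F' c p v (deform A F' X' J\<^sub>K' c p w)"
      by (rule p.deform_adjoint[OF c _ m.tamed_isotropic_axioms])
        (simp only: kaehler_metric[OF kaehler_ext c UNIV_I])
  qed
  moreover have "sym_form F' (deform A F' X' J\<^sub>K') c p v w = g c p v w" if c: "c \<in> \<A>" "p \<in> fst c" "p \<in> M0" for c p v w
    by (simp add: ids(4)[OF c] sym_form_def J_eq[OF c] F'_eq[OF c])
  then have "agree_on \<A> M0 g (sym_form F' (deform A F' X' J\<^sub>K'))"
    by (auto simp: agree_on_def fun_eq_iff)
  ultimately show ?thesis using agree by (simp add: gk_extension_def)
qed

text \<open>The deformed metric is the push-forward of the Kaehler metric by the shear \<open>z \<mapsto> z + B J z\<close>, and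
  \<open>B J\<close> is skew for the Kaehler metric, so the shear can only increase lengths.\<close>

lemma gk_metric_le_kaehler:
  assumes gk: "gk_extension \<A> M0 g I J g' I' J'" and c: "c \<in> \<A>" "p \<in> fst c"
  shows "g' c p v v \<le> g\<^sub>K' c p v v"
proof -
  interpret p: tamed_isotropic \<A> A F' X' J\<^sub>K' by (rule tamed_kaehler[OF skew_A(1)])
  let ?D = "deform A F' X' J\<^sub>K'" and ?B = "bivector A F' X' c p" and ?J = "J\<^sub>K' c p"
  note bF = p.bilF[OF c]
  note hK = hermitianD[OF kaehlerD(1)[OF kaehler_ext]]
  have gb: "bilinear (g\<^sub>K' c p)" by (rule bilinear_fieldD(1)[OF riemannianD(1)[OF hK(1)] c UNIV_I])
  have g'b: "bilinear_field \<A> UNIV g'"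
    using gk hermitianD(1) riemannianD(1) unfolding gk_extension_def generalized_kaehler_def by blast
  \<comment> \<open>Extensions of \<open>g\<close> are unique by density, so the inequality for an
    arbitrary extension reduces to the constructed one.\<close>
  have "g' c p v v = sym_form F' ?D c p v v"
  proof (rule bilinear_field_dense_eq[OF M M0(2) g'b bilinear_field_sym_form[OF M symplecticD(1)[OF symplectic_F'] p.endo_field_deform] c])
    fix q assume q: "q \<in> fst c \<inter> M0"
    show "g' c q v v = sym_form F' ?D c q v v"
      using gk gk_extension_deform q c(1) unfolding gk_extension_def agree_on_def by metis
  qed
  then have g': "g' c p v v = F' c p v (?D c p v)" by (simp add: sym_form_def)
  define z where "z = inv (p.T c p) v"
  have z: "v = p.T c p z" by (simp add: z_def p.shear_inv c)
  have "g' c p v v = g\<^sub>K' c p z z"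
    unfolding g' unfolding z p.deform_form[OF c] by (rule kaehler_metric(1)[OF kaehler_ext c UNIV_I])
  moreover have "g\<^sub>K' c p z (?B (?J z)) = 0"
  proof -
    have "F' c p (?B (?J z)) (?J z) = 0"
      by (rule bivector_isotropic[where F = F' and X = X' and A = A, OF bF p.skew[OF c] isotropic[OF c] skew_A(1)])
    then show ?thesis
      by (simp add: kaehler_metric(1)[OF kaehler_ext c UNIV_I] riemannianD(2)[OF hK(1) c UNIV_I, of z])
  qed
  moreover have "g\<^sub>K' c p v v = g\<^sub>K' c p z z + 2 * g\<^sub>K' c p z (?B (?J z)) + g\<^sub>K' c p (?B (?J z)) (?B (?J z))"
    using riemannianD(2)[OF hK(1) c UNIV_I, of "?B (?J z)" z]
    by (simp add: z shear_def bilinear_ladd[OF gb] bilinear_radd[OF gb])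
  ultimately show ?thesis using riemannian_nonneg[OF hK(1) c, of "?B (?J z)"] by simp
qed

end

section \<open>From a generalized Kaehler extension to a Kaehler one\<close>

lemma kaehler_extension_deform:
  assumes gk: "gk_extension \<A> M0 g I J g' I' J'"
  shows "kaehler_extension \<A> M0 F' g\<^sub>K J\<^sub>K (sym_form F' (deform (- A) F' X' J')) (deform (- A) F' X' J')"
proof -
  have h: "hermitian \<A> UNIV g' J'"
    using gk unfolding gk_extension_def generalized_kaehler_def by blast
  note eJ' = complex_structureD(1)[OF hermitianD(2)[OF h]]
  have J'_eq: "J' c p = J c p" and g'_eq: "g' c p = g c p" if "c \<in> \<A>" "p \<in> fst c" "p \<in> M0" for c p
    using gk that unfolding gk_extension_def agree_on_def by blast+
  note ids = A_deformation_identities[OF M M0(1) toric deformation]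
  \<comment> \<open>Taming of \<open>J'\<close> by \<open>F'\<close> is not part of the given
    extension; it follows because this toric identity persists by continuity and \<open>g'\<close>
    is positive definite everywhere.\<close>
  have sym: "sym_form F' J' c p v w = g' c p v w" if c: "c \<in> \<A>" "p \<in> fst c" for c p v w
  proof (rule bilinear_field_dense_eq[OF M M0(2) bilinear_field_sym_form[OF M symplecticD(1)[OF symplectic_F'] eJ']
        riemannianD(1)[OF hermitianD(1)[OF h]] c])
    fix q assume "q \<in> fst c \<inter> M0"
    then have q: "c \<in> \<A>" "q \<in> fst c" "q \<in> M0" using c by auto
    show "sym_form F' J' c q v w = g' c q v w"
      by (simp add: g'_eq[OF q] ids(4)[OF q] sym_form_def F'_eq[OF q] J'_eq[OF q])
  qed
  interpret m: tamed_isotropic \<A> "- A" F' X' J'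
  proof (rule tamed_isotropicI[OF skew_A(2) eJ' complex_structureD(2)[OF hermitianD(2)[OF h] _ _ UNIV_I]])
    fix c p and v :: "'n model" assume c: "c \<in> \<A>" "p \<in> fst c" "v \<noteq> 0"
    have "F' c p v (J' c p v) = g' c p v v" using sym[OF c(1,2), of v v] by (simp add: sym_form_def)
    then show "0 < F' c p v (J' c p v)"
      using riemannianD(3)[OF hermitianD(1)[OF h] c(1,2) UNIV_I c(3)] by simp
  qed
  let ?K = "deform (- A) F' X' J'" and ?h = "sym_form F' (deform (- A) F' X' J')"
  have K_eq: "J\<^sub>K c p v = ?K c p v" if c: "c \<in> \<A>" "p \<in> fst c" "p \<in> M0" for c p v
    by (rule m.deform_eqI[OF c(1,2)]) (simp add: shear_eq_on_M0[where L' = J' and L = J, OF c J'_eq[OF c]] J'_eq[OF c] ids(3)[OF c])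
  have agree: "agree_on \<A> M0 J\<^sub>K ?K"
    unfolding agree_on_def using K_eq by (auto simp: fun_eq_iff)
  have cK: "complex_structure \<A> UNIV ?K"
    by (rule complex_structure_extend[OF m.endo_field_deform m.deform_square agree
          complex_structureD(3)[OF hermitianD(2)[OF kaehlerD(1)[OF kaehler_on_M0]]]])
  have herm: "hermitian \<A> UNIV ?h ?K"
    by (rule hermitian_sym_form[OF M symplectic_F' cK m.deform_tame])
  have h_eq: "?h c p v w = g\<^sub>K c p v w" if c: "c \<in> \<A>" "p \<in> fst c" "p \<in> M0" for c p v w
    using riemannianD(2)[OF hermitianD(1)[OF kaehlerD(1)[OF kaehler_on_M0]] c, of w v]
    by (simp add: sym_form_def K_eq[OF c, symmetric] F'_eq[OF c] kaehler_metric(1)[OF kaehler_on_M0 c])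
  \<comment> \<open>Taming yields a Hermitian structure, but a Kaehler one needs \<open>F'\<close>
    to be the whole fundamental form. This holds over \<open>M0\<close> for \<open>J\<^sub>K\<close>
    and extends by density.\<close>
  have "F' c p v w = ?h c p (?K c p v) w" if c: "c \<in> \<A>" "p \<in> fst c" for c p v w
  proof -
    have ch: "is_chart c" using M c smooth_structure_chart by blast
    have op: "open (snd c ` fst c)" using open_chart_image[OF ch open_UNIV] by simp
    have "local_rep c F' (snd c p) v w = local_rep c ?h (snd c p) (local_rep c ?K (snd c p) v) w"
    proof (rule dense_eq[OF ch M0(2) _ _ _ c(2), where f = "\<lambda>x. local_rep c F' x v w"
          and g = "\<lambda>x. local_rep c ?h x (local_rep c ?K x v) w"])
      show "continuous_on (snd c ` fst c) (\<lambda>x. local_rep c F' x v w)"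
        using smooth_on_imp_continuous_on[OF bilinear_fieldD(2)[OF symplecticD(1)[OF symplectic_F'] c(1)]] by simp
      show "continuous_on (snd c ` fst c) (\<lambda>x. local_rep c ?h x (local_rep c ?K x v) w)"
        by (intro smooth_on_imp_continuous_on smooth_bilinear_field_app[OF M riemannianD(1)[OF hermitianD(1)[OF herm]] c(1)]
            smooth_endo_field_app[OF M m.endo_field_deform c(1)] smooth_on_const)
      fix q assume "q \<in> fst c \<inter> M0"
      then have q: "c \<in> \<A>" "q \<in> fst c" "q \<in> M0" using c by auto
      show "local_rep c F' (snd c q) v w = local_rep c ?h (snd c q) (local_rep c ?K (snd c q) v) w"
        by (simp add: local_rep_chart[OF ch q(2)] h_eq[OF q] K_eq[OF q, symmetric] F'_eq[OF q] kaehlerD(3)[OF kaehler_on_M0 q])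
    qed
    then show ?thesis by (simp add: local_rep_chart[OF ch c(2)])
  qed
  then have "kaehler \<A> UNIV F' ?h ?K"
    unfolding kaehler_def using herm symplectic_F' by (auto simp: fund_form_def fun_eq_iff)
  moreover have "agree_on \<A> M0 g\<^sub>K ?h"
    unfolding agree_on_def using h_eq by (auto simp: fun_eq_iff)
  ultimately show ?thesis using agree by (simp add: kaehler_extension_def)
qed

end

theorem proposition3p1:
  fixes \<A> :: "('m::{second_countable_topology, t2_space}, 'n::finite model) chart set"
    and M0 :: "'m set"
    and A :: "real ^ 'n ^ 'n"
    and F F' g\<^sub>K g :: "('m, 'n model) bil_field"
    and J\<^sub>K I J :: "('m, 'n model) end_field"
    and X X' :: "'n \<Rightarrow> ('m, 'n model) vec_field"
  assumes M: "smooth_structure \<A>"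
    and M0: "open M0" "closure M0 = UNIV"
    and toric: "locally_toric_kaehler \<A> M0 F g\<^sub>K J\<^sub>K X"
    and deformation: "A_deformation \<A> M0 A F g\<^sub>K J\<^sub>K X g I J"
    and extension: "toric_extension \<A> M0 F X F' X'"
  shows "((\<exists>g\<^sub>K' J\<^sub>K'. kaehler_extension \<A> M0 F' g\<^sub>K J\<^sub>K g\<^sub>K' J\<^sub>K') \<longleftrightarrow>
           (\<exists>g' I' J'. gk_extension \<A> M0 g I J g' I' J')) \<and>
         (\<forall>g\<^sub>K' J\<^sub>K' g' I' J'.
           kaehler_extension \<A> M0 F' g\<^sub>K J\<^sub>K g\<^sub>K' J\<^sub>K' \<and> gk_extension \<A> M0 g I J g' I' J' \<longrightarrow>
           (\<forall>c\<in>\<A>. \<forall>p\<in>fst c. \<forall>v. g' c p v v \<le> g\<^sub>K' c p v v)) \<and>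
         (\<forall>g' I' J'.
           gk_extension \<A> M0 g I J g' I' J' \<and> complete_riemannian \<A> g' \<longrightarrow>
           (\<exists>g\<^sub>K' J\<^sub>K'. kaehler_extension \<A> M0 F' g\<^sub>K J\<^sub>K g\<^sub>K' J\<^sub>K' \<and> complete_riemannian \<A> g\<^sub>K'))"
proof -
  interpret toric_deformation \<A> M0 A F F' g\<^sub>K g J\<^sub>K I J X X'
    using assms by unfold_locales
  show ?thesis
  proof (intro conjI iffI allI impI ballI)
    show "\<exists>g' I' J'. gk_extension \<A> M0 g I J g' I' J'"
      if "\<exists>g\<^sub>K' J\<^sub>K'. kaehler_extension \<A> M0 F' g\<^sub>K J\<^sub>K g\<^sub>K' J\<^sub>K'"
      using that gk_extension_deform by blast
    show "\<exists>g\<^sub>K' J\<^sub>K'. kaehler_extension \<A> M0 F' g\<^sub>K J\<^sub>K g\<^sub>K' J\<^sub>K'"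
      if "\<exists>g' I' J'. gk_extension \<A> M0 g I J g' I' J'"
      using that kaehler_extension_deform by blast
  next
    fix g\<^sub>K' J\<^sub>K' g' I' J' c p v
    assume "kaehler_extension \<A> M0 F' g\<^sub>K J\<^sub>K g\<^sub>K' J\<^sub>K' \<and> gk_extension \<A> M0 g I J g' I' J'" "c \<in> \<A>" "p \<in> fst c"
    then show "g' c p v v \<le> g\<^sub>K' c p v v" using gk_metric_le_kaehler by blast
  next
    fix g' I' J'
    assume gk: "gk_extension \<A> M0 g I J g' I' J' \<and> complete_riemannian \<A> g'"
    let ?K = "deform (- A) F' X' J'"
    have ext: "kaehler_extension \<A> M0 F' g\<^sub>K J\<^sub>K (sym_form F' ?K) ?K"
      using gk kaehler_extension_deform by blast
    have "complete_riemannian \<A> (sym_form F' ?K)"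
    proof (rule complete_riemannian_mono[OF M])
      show "complete_riemannian \<A> g'" using gk by blast
      show "riemannian \<A> UNIV (sym_form F' ?K)"
        by (rule hermitianD(1)[OF kaehlerD(1)[OF kaehler_ext[OF ext]]])
      show "g' c p v v \<le> sym_form F' ?K c p v v" if "c \<in> \<A>" "p \<in> fst c" for c p v
        using gk_metric_le_kaehler[OF ext _ that] gk by blast
    qed
    then show "\<exists>g\<^sub>K' J\<^sub>K'. kaehler_extension \<A> M0 F' g\<^sub>K J\<^sub>K g\<^sub>K' J\<^sub>K' \<and> complete_riemannian \<A> g\<^sub>K'"
      using ext by blast
  qed
qed

end
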